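(* Let $f$ denote the second-order correlation function of the characteristic polynomial of an unrescaled real sample covariance matrix, and let $b^*:=b-3$. For any $\alpha\in\mathbb{N}$ and any positive real numbers $\mu,\nu$, put $n:=N$, $m:=N-\alpha$, and $Z_N(\mu,\nu):=(\mu\nu/N^2)^{\alpha/2}$. Then $$ \lim_{N\to\infty}\left(\frac1{16}\,N^{-2}\,Z_N(\mu/4,\nu/4)\cdot\frac{f\big(n,m;\tfrac{\mu}{4N},\tfrac{\nu}{4N}\big)}{n!\,m!}\right)=\exp(b^* )\,\widetilde{\mathbb{J}}_\alpha(\mu,\nu). $$
   Context: Here $\mathbb{N}=\{0,1,2,\dots\}$ and $\alpha$ is fixed as $N\to\infty$ ($N\ge\alpha$). Let $Q$ be a probability distribution on the real line with expectation $0$, variance $1$ and finite fourth moment $b$ (i.e. $b=\int x^4\,dQ(x)<\infty$). For $n\ge m$, let $X=X(n,m)$ be the $n\times m$ random matrix whose entries are i.i.d. real random variables with distribution $Q$, and let $X^T$ be its transpose. The $m\times m$ matrix $X(n,m)^TX(n,m)$ is the unrescaled real sample covariance matrix. For $\mu,\nu\in\mathbb{C}$, $$ f(n,m;\mu,\nu):=\mathbb{E}\big(\det(X(n,m)^TX(n,m)-\mu)\,\det(X(n,m)^TX(n,m)-\nu)\big), $$ where $\mu,\nu$ inside the determinants stand for $\mu I_m,\nu I_m$. With $J_\alpha$ the Bessel function of the first kind of order $\alpha$, the ``differentiated'' Bessel kernel is $$ \widetilde{\mathbb{J}}_\alpha(x,y):=\frac{(x+y)\big(J_\alpha(\sqrt{x})\,\sqrt{y}\,J_\alpha'(\sqrt{y})-\sqrt{x}\,J_\alpha'(\sqrt{x})\,J_\alpha(\sqrt{y})\big)}{2(x-y)^3}-\frac{(x+y-2\alpha^2)\,J_\alpha(\sqrt{x})\,J_\alpha(\sqrt{y})+2\sqrt{xy}\,J_\alpha'(\sqrt{x})\,J_\alpha'(\sqrt{y})}{4(x-y)^2},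 $$ understood for $x=y$ as its continuous extension. *)

theory Defs
  imports "HOL-Probability.Probability" "Jordan_Normal_Form.Determinant"
begin

text \<open>Rectangular matrices of varying size are the \<open>mat\<close> type of \<open>Jordan_Normal_Form\<close>,
  with indices starting at \<open>0\<close>; the names \<open>det\<close> etc. are qualified to avoid the homonyms of
  \<open>HOL-Analysis\<close>.\<close>

definition iid_random_matrix ::
  "'a measure \<Rightarrow> real measure \<Rightarrow> nat \<Rightarrow> nat \<Rightarrow> ('a \<Rightarrow> real mat) \<Rightarrow> bool" where
  "iid_random_matrix M Q n m X \<longleftrightarrow>
     prob_space M \<and>
     (\<forall>\<omega>\<in>space M. X \<omega> \<in> carrier_mat n m) \<and>
     prob_space.indep_vars M (\<lambda>_. borel) (\<lambda>ij \<omega>. X \<omega> $$ ij) ({..<n} \<times> {..<m}) \<and>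
     (\<forall>ij \<in> {..<n} \<times> {..<m}. distr M borel (\<lambda>\<omega>. X \<omega> $$ ij) = Q)"

definition sample_cov :: "real mat \<Rightarrow> real mat" where
  "sample_cov A = transpose_mat A * A"

definition char_det :: "real mat \<Rightarrow> complex \<Rightarrow> complex" where
  "char_det A z = Determinant.det
     (map_mat complex_of_real (sample_cov A) - z \<cdot>\<^sub>m 1\<^sub>m (dim_col A))"

definition corr_fun ::
  "(nat \<Rightarrow> nat \<Rightarrow> 'a measure) \<Rightarrow> (nat \<Rightarrow> nat \<Rightarrow> 'a \<Rightarrow> real mat) \<Rightarrow>
   nat \<Rightarrow> nat \<Rightarrow> complex \<Rightarrow> complex \<Rightarrow> complex" where
  "corr_fun M X n m \<mu> \<nu> =
     (\<integral>\<omega>. char_det (X n m \<omega>) \<mu> * char_det (X n m \<omega>) \<nu> \<partial>M n m)"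

text \<open>Bessel function of the first kind, of nonnegative integer order, by its power series.\<close>

definition bessel_J :: "nat \<Rightarrow> real \<Rightarrow> real" where
  "bessel_J \<alpha> x = (\<Sum>k. (- 1) ^ k / (fact k * fact (k + \<alpha>)) * (x / 2) ^ (2 * k + \<alpha>))"

definition diff_bessel_kernel_offdiag :: "nat \<Rightarrow> real \<Rightarrow> real \<Rightarrow> real" where
  "diff_bessel_kernel_offdiag \<alpha> x y =
     (x + y) * (bessel_J \<alpha> (sqrt x) * sqrt y * deriv (bessel_J \<alpha>) (sqrt y)
                - sqrt x * deriv (bessel_J \<alpha>) (sqrt x) * bessel_J \<alpha> (sqrt y))
       / (2 * (x - y) ^ 3)
     - ((x + y - 2 * real \<alpha> ^ 2) * bessel_J \<alpha> (sqrt x) * bessel_J \<alpha> (sqrt y)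
        + 2 * sqrt (x * y) * deriv (bessel_J \<alpha>) (sqrt x) * deriv (bessel_J \<alpha>) (sqrt y))
       / (4 * (x - y) ^ 2)"

text \<open>On the diagonal the value is the joint limit \<open>(u, v) \<rightarrow> (x, x)\<close> through pairs of distinct
  positive reals. The kernel is only meant for positive arguments.\<close>

definition diff_bessel_kernel :: "nat \<Rightarrow> real \<Rightarrow> real \<Rightarrow> real" where
  "diff_bessel_kernel \<alpha> x y =
     (if x \<noteq> y then diff_bessel_kernel_offdiag \<alpha> x y
      else Lim (at (x, x) within {(u, v). 0 < u \<and> 0 < v \<and> u \<noteq> v})
             (\<lambda>(u, v). diff_bessel_kernel_offdiag \<alpha> u v))"

definition Z_factor :: "nat \<Rightarrow> nat \<Rightarrow> real \<Rightarrow> real \<Rightarrow> real" where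
  "Z_factor \<alpha> N \<mu> \<nu> = (\<mu> * \<nu> / real N ^ 2) powr (real \<alpha> / 2)"

end

theory Submission
  imports Defs
begin

text \<open>
  Adding a row \<open>u\<close> to \<open>X\<close> changes \<open>X\<^sup>T X\<close> by the rank one matrix \<open>u u\<^sup>T\<close>. Taking the expectation over \<open>u\<close>
  involves only second and fourth moments, and expresses \<open>f(n + 1, m)\<close> as \<open>D f(n, m) + b\<^sup>* m f(n, m - 1)\<close> with the
  differential operator \<open>D = (1 - \<partial>\<^sub>x) (1 - \<partial>\<^sub>y) - 2 / (x - y) (\<partial>\<^sub>x - \<partial>\<^sub>y)\<close>. The term with \<open>b\<^sup>*\<close> commutes with
  \<open>D\<close>, so that \<open>f(n, m) / (n! m!)\<close> is the sum over \<open>t\<close> of \<open>b\<^sup>*\<^sup>t / t!\<close> times the same quotient at \<open>(n - t, m - t)\<close>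
  for Gaussian entries, which is the source of the factor \<open>exp b\<^sup>*\<close>. In the Gaussian case \<open>f = D\<^sup>n (x y)\<^sup>m\<close>,
  and \<open>D\<close> is intertwined with \<open>(1 - \<partial>\<^sub>x) (1 - \<partial>\<^sub>y)\<close> by an operator that sends
  \<open>x\<^sup>m\<^sup>+\<^sup>2 y\<^sup>m\<^sup>+\<^sup>1 - x\<^sup>m\<^sup>+\<^sup>1 y\<^sup>m\<^sup>+\<^sup>2\<close> to a multiple of \<open>(x y)\<^sup>m\<close>. Hence \<open>f\<close> is a differentiated Christoffel-Darboux kernel of
  Laguerre type polynomials with explicit coefficients. The coefficients converge with a uniform bound to those of Bessel
  functions of orders \<open>\<alpha> - 2\<close> and \<open>\<alpha> - 1\<close>, and the recurrences reduce these to \<open>J\<^sub>\<alpha>\<close> and its derivative.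
\<close>

subsection \<open>Determinants indexed by finite sets\<close>

text \<open>By det(A + u u^T) = det A + u^T adj(A) u, a product of two characteristic polynomials
  has degree four in the new row. Pairing the two entries inside one factor gives tr adj, minus the
  derivative in the spectral parameter; this yields (1 - d/dx)(1 - d/dy). Both pairings across the
  factors give the trace of a product of two adjugates, which the resolvent identity turns into a
  difference quotient: hence 2 / (x - y). Coincidence of all four entries carries the fourth
  cumulant b - 3 and deletes the same index from both factors. Determinants are indexed by finite
  sets so that such a deletion only shrinks the index set. The polynomial (1 - d/dx)^n x^k is (-1)^k
  k! times the Laguerre polynomial of degree k and parameter n - k; for k = m + 2 and k = m + 1 the
  parameter is \<alpha> - 2 and \<alpha> - 1, whence the two Bessel orders, negative for small
  \<alpha>. The persistent obstacle is the division by x - y: the recursion is solved for x \<noteq>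
  y only, and the case \<mu> = \<nu> is reached through polynomial or power series forms of the
  kernel, which are continuous across the diagonal.\<close>

definition set_det :: "'i set \<Rightarrow> ('i \<Rightarrow> 'i \<Rightarrow> 'a::comm_ring_1) \<Rightarrow> 'a" where
  "set_det S a = (\<Sum>\<pi>\<in>{\<pi>. \<pi> permutes S}. of_int (sign \<pi>) * (\<Prod>i\<in>S. a i (\<pi> i)))"

lemma set_det_cong:
  assumes "\<And>i j. i \<in> S \<Longrightarrow> j \<in> S \<Longrightarrow> a i j = b i j"
  shows "set_det S a = set_det S b"
  unfolding set_det_def
  by (intro sum.cong refl arg_cong2[where f = times] prod.cong assms)
     (auto simp: permutes_in_image)

lemma set_det_row_linear:
  assumes "finite S" "i \<in> S"
  shows "set_det S (a(i := (\<lambda>j. \<Sum>k\<in>K. c k * r k j))) = (\<Sum>k\<in>K. c k * set_det S (a(i := r k)))"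
proof -
  have P: "(\<Prod>l\<in>S. (a(i := x)) l (\<pi> l)) = x (\<pi> i) * (\<Prod>l\<in>S - {i}. a l (\<pi> l))" for x \<pi>
    by (subst prod.remove[OF assms]) (auto intro!: prod.cong)
  show ?thesis
    unfolding set_det_def P sum_distrib_left sum_distrib_right
    by (subst sum.swap) (simp add: mult_ac)
qed

lemma set_det_row_add:
  assumes "finite S" "i \<in> S"
  shows "set_det S (a(i := (\<lambda>j. x j + c * y j))) = set_det S (a(i := x)) + c * set_det S (a(i := y))"
proof -
  have "set_det S (a(i := (\<lambda>j. \<Sum>k\<in>UNIV. (if k then 1 else c) * (if k then x else y) j)))
     = (\<Sum>k\<in>UNIV. (if k then 1 else c) * set_det S (a(i := (if k then x else y))))"
    by (rule set_det_row_linear[OF assms])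
  then show ?thesis by (simp add: UNIV_bool add.commute)
qed

lemma set_det_expand_row:
  assumes "finite S" "i \<in> S"
  shows "set_det S (a(i := v)) = (\<Sum>j\<in>S. v j * set_det S (a(i := (\<lambda>l. of_bool (l = j)))))"
proof -
  have "set_det S (a(i := v)) = set_det S (a(i := (\<lambda>l. \<Sum>j\<in>S. v j * of_bool (l = j))))"
    by (rule set_det_cong) (use assms in \<open>auto simp: if_distrib cong: if_cong\<close>)
  then show ?thesis by (simp only: set_det_row_linear[OF assms])
qed

text \<open>Composing with the transposition of the two rows flips every sign and keeps every
  product, so the determinant is its own negative. Cancelling the factor 2 is what the sort
  constraint is for.\<close>

lemma set_det_equal_rows:
  fixes a :: "'i \<Rightarrow> 'i \<Rightarrow> 'a::{comm_ring_1,ring_char_0,idom}"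
  assumes "finite S" "i \<in> S" "l \<in> S" "i \<noteq> l" "a i = a l"
  shows "set_det S a = 0"
proof -
  let ?t = "Transposition.transpose i l"
  have t: "?t permutes S" using assms by (simp add: permutes_swap_id)
  have "set_det S a = (\<Sum>\<pi>\<in>{\<pi>. \<pi> permutes S}. of_int (sign (\<pi> \<circ> ?t)) * (\<Prod>k\<in>S. a k ((\<pi> \<circ> ?t) k)))"
    unfolding set_det_def by (rule sum_permutations_compose_right[OF t])
  also have "\<dots> = (\<Sum>\<pi>\<in>{\<pi>. \<pi> permutes S}. - (of_int (sign \<pi>) * (\<Prod>k\<in>S. a k (\<pi> k))))"
  proof (rule sum.cong[OF refl])
    fix \<pi> assume "\<pi> \<in> {\<pi>. \<pi> permutes S}"
    then have p: "\<pi> permutes S" by simp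
    have "sign (\<pi> \<circ> ?t) = - sign \<pi>"
      using p assms by (subst sign_compose) (auto simp: sign_swap_id intro: permutation_swap_id permutes_imp_permutation)
    moreover have "(\<Prod>k\<in>S. a k ((\<pi> \<circ> ?t) k)) = (\<Prod>k\<in>S. a (?t k) ((\<pi> \<circ> ?t) k))"
      by (rule prod.cong) (use assms in \<open>auto simp: Transposition.transpose_def\<close>)
    moreover have "\<dots> = (\<Prod>k\<in>S. a k (\<pi> k))"
      using prod.permute[OF t, of "\<lambda>k. a k (\<pi> k)"] by (simp add: o_def)
    ultimately show "of_int (sign (\<pi> \<circ> ?t)) * (\<Prod>k\<in>S. a k ((\<pi> \<circ> ?t) k))
       = - (of_int (sign \<pi>) * (\<Prod>k\<in>S. a k (\<pi> k)))" by simp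
  qed
  also have "\<dots> = - set_det S a" unfolding set_det_def by (rule sum_negf)
  finally have "2 * set_det S a = 0" by simp
  then show ?thesis by simp
qed

text \<open>The matrix determinant lemma in a form free of inverses. The rows are updated one at a
  time, and terms with two rows replaced by \<open>v\<close> vanish.\<close>

lemma set_det_rank_one_update:
  fixes a :: "'i \<Rightarrow> 'i \<Rightarrow> 'a::{comm_ring_1,ring_char_0,idom}"
  assumes "finite S"
  shows "set_det S (\<lambda>i j. a i j + u i * v j) = set_det S a + (\<Sum>i\<in>S. u i * set_det S (a(i := v)))"
proof -
  define b where "b T = (\<lambda>i j. a i j + (if i \<in> T then u i * v j else 0))" for T
  \<comment> \<open>Once row \<open>i\<close> is \<open>v\<close>, adding multiples of
    \<open>v\<close> to other rows changes nothing.\<close>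
  have row: "set_det S ((b T)(i := v)) = set_det S (a(i := v))"
    if "T \<subseteq> S" "i \<in> S" "i \<notin> T" for T i
    using finite_subset[OF that(1) assms] that
  proof (induction T rule: finite_induct)
    case empty
    then show ?case by (simp add: b_def)
  next
    case (insert l T)
    have "(b (insert l T))(i := v) = ((b T)(i := v))(l := (\<lambda>j. b T l j + u l * v j))"
      using insert by (auto simp: b_def fun_eq_iff)
    moreover have "set_det S ((((b T)(i := v)))(l := v)) = 0"
      by (rule set_det_equal_rows[of _ i l]) (use insert assms in auto)
    moreover have "((b T)(i := v))(l := b T l) = (b T)(i := v)"
      using insert by auto
    ultimately show ?case
      using insert set_det_row_add[of S l "(b T)(i := v)" "b T l" "u l" v] assms by (simp del: fun_upd_apply)
  qed
  have "set_det S (b T) = set_det S a + (\<Sum>i\<in>T. u i * set_det S (a(i := v)))" if "T \<subseteq> S" for T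
    using finite_subset[OF that assms] that
  proof (induction T rule: finite_induct)
    case empty
    then show ?case by (simp add: b_def)
  next
    case (insert l T)
    have "b (insert l T) = (b T)(l := (\<lambda>j. b T l j + u l * v j))"
      using insert by (auto simp: b_def fun_eq_iff)
    then show ?case
      using insert row[of T l] set_det_row_add[of S l "b T" "b T l" "u l" v] assms
      by (simp del: fun_upd_apply)
  qed
  from this[of S] have "set_det S (b S) = set_det S a + (\<Sum>i\<in>S. u i * set_det S (a(i := v)))" by simp
  moreover have "set_det S (b S) = set_det S (\<lambda>i j. a i j + u i * v j)"
    by (rule set_det_cong) (simp add: b_def)
  ultimately show ?thesis by simp
qed

section \<open>Cofactors, adjugates and principal minors\<close>

text \<open>Row \<open>i\<close> is replaced by a unit vector instead of being deleted: the sign is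
  built in, and the index set stays \<open>S\<close>.\<close>

definition set_cof :: "'i set \<Rightarrow> ('i \<Rightarrow> 'i \<Rightarrow> 'a::comm_ring_1) \<Rightarrow> 'i \<Rightarrow> 'i \<Rightarrow> 'a" where
  "set_cof S a i j = set_det S (a(i := (\<lambda>l. of_bool (l = j))))"

text \<open>The sum expands the determinant in which row \<open>i\<close> is overwritten by row
  \<open>l\<close>; for \<open>l \<noteq> i\<close> two rows agree.\<close>

lemma set_cof_adjugate:
  fixes a :: "'i \<Rightarrow> 'i \<Rightarrow> 'a::{comm_ring_1,ring_char_0,idom}"
  assumes "finite S" "i \<in> S" "l \<in> S"
  shows "(\<Sum>j\<in>S. set_cof S a i j * a l j) = of_bool (l = i) * set_det S a"
proof -
  have "(\<Sum>j\<in>S. set_cof S a i j * a l j) = set_det S (a(i := a l))"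
    unfolding set_det_expand_row[OF assms(1,2), of a "a l"] set_cof_def by (simp add: mult.commute)
  also have "\<dots> = of_bool (l = i) * set_det S a"
  proof (cases "l = i")
    case False
    then show ?thesis using assms by (simp add: set_det_equal_rows[of _ i l])
  qed simp
  finally show ?thesis .
qed

text \<open>Passing to inverse permutations transposes the matrix and moves the unit vector from row
  \<open>i\<close> to row \<open>j\<close>.\<close>

lemma set_cof_symmetric:
  fixes a :: "'i \<Rightarrow> 'i \<Rightarrow> 'a::comm_ring_1"
  assumes "finite S" "i \<in> S" "j \<in> S" "\<And>i j. a i j = a j i"
  shows "set_cof S a i j = set_cof S a j i"
proof -
  have P: "(\<Prod>l\<in>S. (a(i := (\<lambda>l. of_bool (l = j)))) l (\<pi> l))
     = of_bool (\<pi> i = j) * (\<Prod>l\<in>S - {i}. a l (\<pi> l))" if "i \<in> S" for \<pi> i j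
    by (subst prod.remove[OF assms(1) that]) (auto intro!: prod.cong)
  have "set_cof S a i j = (\<Sum>\<pi>\<in>{\<pi>. \<pi> permutes S}. of_int (sign (Hilbert_Choice.inv \<pi>)) *
      (of_bool (Hilbert_Choice.inv \<pi> i = j) * (\<Prod>l\<in>S - {i}. a l (Hilbert_Choice.inv \<pi> l))))"
    unfolding set_cof_def set_det_def P[OF assms(2)] by (rule sum_permutations_inverse)
  also have "\<dots> = (\<Sum>\<pi>\<in>{\<pi>. \<pi> permutes S}. of_int (sign \<pi>) *
      (of_bool (\<pi> j = i) * (\<Prod>l\<in>S - {j}. a l (\<pi> l))))"
  proof (rule sum.cong[OF refl])
    fix \<pi> assume "\<pi> \<in> {\<pi>. \<pi> permutes S}"
    then have p: "\<pi> permutes S" by simp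
    have s: "sign (Hilbert_Choice.inv \<pi>) = sign \<pi>"
      using p assms(1) by (intro sign_inverse) (rule permutes_imp_permutation)
    have e: "Hilbert_Choice.inv \<pi> i = j \<longleftrightarrow> \<pi> j = i"
      using permutes_inv_eq[OF p] by auto
    show "of_int (sign (Hilbert_Choice.inv \<pi>)) * (of_bool (Hilbert_Choice.inv \<pi> i = j) * (\<Prod>l\<in>S - {i}. a l (Hilbert_Choice.inv \<pi> l)))
       = of_int (sign \<pi>) * (of_bool (\<pi> j = i) * (\<Prod>l\<in>S - {j}. a l (\<pi> l)))"
    proof (cases "\<pi> j = i")
      case True
      have "bij_betw \<pi> (S - {j}) (S - {i})"
        using permutes_imp_bij[OF p] True bij_betw_DiffI[of \<pi> S S "{j}" "{i}"] assms by (auto simp: bij_betw_singletonI)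
      then have "(\<Prod>l\<in>S - {i}. a l (Hilbert_Choice.inv \<pi> l)) = (\<Prod>l\<in>S - {j}. a (\<pi> l) (Hilbert_Choice.inv \<pi> (\<pi> l)))"
        by (rule prod.reindex_bij_betw[symmetric])
      also have "\<dots> = (\<Prod>l\<in>S - {j}. a l (\<pi> l))"
        using assms(4) permutes_inverses(2)[OF p] by simp
      finally show ?thesis using s e by simp
    qed (use s e in simp)
  qed
  also have "\<dots> = set_cof S a j i"
    unfolding set_cof_def set_det_def P[OF assms(3)] ..
  finally show ?thesis .
qed

lemma permutes_subset_fixing:
  assumes "U \<subseteq> S"
  shows "{\<pi>. \<pi> permutes S \<and> (\<forall>i\<in>S - U. \<pi> i = i)} = {\<pi>. \<pi> permutes U}"
proof (rule Set.set_eqI, rule iffI)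
  fix \<pi> assume "\<pi> \<in> {\<pi>. \<pi> permutes S \<and> (\<forall>i\<in>S - U. \<pi> i = i)}"
  then have "\<pi> permutes S" "\<forall>i\<in>S - U. \<pi> i = i" by auto
  then show "\<pi> \<in> {\<pi>. \<pi> permutes U}" by (auto intro: permutes_superset)
next
  fix \<pi> assume "\<pi> \<in> {\<pi>. \<pi> permutes U}"
  then have "\<pi> permutes U" by simp
  then show "\<pi> \<in> {\<pi>. \<pi> permutes S \<and> (\<forall>i\<in>S - U. \<pi> i = i)}"
    using assms by (auto intro: permutes_subset simp: permutes_def)
qed

text \<open>Each row contributes its entry of \<open>a\<close> or its diagonal term. If the rows
  outside \<open>U\<close> contribute the latter, only permutations fixing them count, and these are
  the permutations of \<open>U\<close>.\<close>

lemma set_det_shift_expand: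
  fixes a :: "'i \<Rightarrow> 'i \<Rightarrow> 'a::comm_ring_1"
  assumes "finite S"
  shows "set_det S (\<lambda>i j. a i j - z * of_bool (i = j))
       = (\<Sum>U\<in>Pow S. (- z) ^ card (S - U) * set_det U a)"
proof -
  have "set_det S (\<lambda>i j. a i j - z * of_bool (i = j))
     = (\<Sum>\<pi>\<in>{\<pi>. \<pi> permutes S}. \<Sum>U\<in>Pow S. of_int (sign \<pi>) *
         ((\<Prod>i\<in>U. a i (\<pi> i)) * (\<Prod>i\<in>S - U. - z * of_bool (i = \<pi> i))))"
    unfolding set_det_def
  proof (rule sum.cong[OF refl])
    fix \<pi>
    have "(\<Prod>i\<in>S. a i (\<pi> i) - z * of_bool (i = \<pi> i)) = (\<Prod>i\<in>S. a i (\<pi> i) + - z * of_bool (i = \<pi> i))"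
      by simp
    also have "\<dots> = (\<Sum>U\<in>Pow S. (\<Prod>i\<in>U. a i (\<pi> i)) * (\<Prod>i\<in>S - U. - z * of_bool (i = \<pi> i)))"
      by (rule prod_add[OF assms])
    finally show "of_int (sign \<pi>) * (\<Prod>i\<in>S. a i (\<pi> i) - z * of_bool (i = \<pi> i)) =
       (\<Sum>U\<in>Pow S. of_int (sign \<pi>) * ((\<Prod>i\<in>U. a i (\<pi> i)) * (\<Prod>i\<in>S - U. - z * of_bool (i = \<pi> i))))"
      by (simp add: sum_distrib_left)
  qed
  also have "\<dots> = (\<Sum>U\<in>Pow S. \<Sum>\<pi>\<in>{\<pi>. \<pi> permutes S}. of_int (sign \<pi>) *
         ((\<Prod>i\<in>U. a i (\<pi> i)) * (\<Prod>i\<in>S - U. - z * of_bool (i = \<pi> i))))"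
    by (rule sum.swap)
  also have "\<dots> = (\<Sum>U\<in>Pow S. (- z) ^ card (S - U) * set_det U a)"
  proof (rule sum.cong[OF refl])
    fix U assume "U \<in> Pow S"
    then have U: "U \<subseteq> S" by simp
    have z: "(\<Prod>i\<in>S - U. - z * of_bool (i = \<pi> i)) = (- z) ^ card (S - U) * of_bool (\<forall>i\<in>S - U. \<pi> i = i)" for \<pi>
    proof (cases "\<forall>i\<in>S - U. \<pi> i = i")
      case True
      then have "(\<Prod>i\<in>S - U. - z * of_bool (i = \<pi> i)) = (\<Prod>i\<in>S - U. - z)"
        by (intro prod.cong) auto
      then show ?thesis using True by simp
    next
      case False
      then obtain i where "i \<in> S - U" "\<pi> i \<noteq> i" by auto
      then have "(\<Prod>i\<in>S - U. - z * of_bool (i = \<pi> i)) = 0"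
        using assms by (intro prod_zero) (auto intro!: bexI[of _ i])
      moreover have "of_bool (\<forall>i\<in>S - U. \<pi> i = i) = (0 :: 'a)" using False by (simp only: of_bool_eq)
      ultimately show ?thesis by (simp only: mult_zero_right)
    qed
    have "(\<Sum>\<pi>\<in>{\<pi>. \<pi> permutes S}. of_int (sign \<pi>) *
         ((\<Prod>i\<in>U. a i (\<pi> i)) * (\<Prod>i\<in>S - U. - z * of_bool (i = \<pi> i))))
       = (\<Sum>\<pi>\<in>{\<pi>. \<pi> permutes S}. if \<forall>i\<in>S - U. \<pi> i = i then (- z) ^ card (S - U) *
           (of_int (sign \<pi>) * (\<Prod>i\<in>U. a i (\<pi> i))) else 0)"
      unfolding z by (intro sum.cong) (auto simp: mult_ac)
    also have "\<dots> = (\<Sum>\<pi>\<in>{\<pi>. \<pi> permutes S \<and> (\<forall>i\<in>S - U. \<pi> i = i)}. (- z) ^ card (S - U) *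
           (of_int (sign \<pi>) * (\<Prod>i\<in>U. a i (\<pi> i))))"
      by (subst sum.inter_filter[symmetric]) (auto simp: finite_permutations[OF assms])
    finally show "(\<Sum>\<pi>\<in>{\<pi>. \<pi> permutes S}. of_int (sign \<pi>) *
         ((\<Prod>i\<in>U. a i (\<pi> i)) * (\<Prod>i\<in>S - U. - z * of_bool (i = \<pi> i))))
        = (- z) ^ card (S - U) * set_det U a"
      unfolding permutes_subset_fixing[OF U] set_det_def by (simp add: sum_distrib_left)
  qed
  finally show ?thesis .
qed

lemma set_cof_diagonal:
  fixes a :: "'i \<Rightarrow> 'i \<Rightarrow> 'a::comm_ring_1"
  assumes "finite S" "i \<in> S"
  shows "set_cof S a i i = set_det (S - {i}) a"
proof -
  have P: "(\<Prod>l\<in>S. (a(i := (\<lambda>l. of_bool (l = i)))) l (\<pi> l))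
     = of_bool (\<pi> i = i) * (\<Prod>l\<in>S - {i}. a l (\<pi> l))" for \<pi>
    by (subst prod.remove[OF assms]) (auto intro!: prod.cong)
  have "set_cof S a i i = (\<Sum>\<pi>\<in>{\<pi>. \<pi> permutes S}. if \<pi> i = i then of_int (sign \<pi>) * (\<Prod>l\<in>S - {i}. a l (\<pi> l)) else 0)"
    unfolding set_cof_def set_det_def P by (intro sum.cong) auto
  also have "\<dots> = (\<Sum>\<pi>\<in>{\<pi>. \<pi> permutes S \<and> \<pi> i = i}. of_int (sign \<pi>) * (\<Prod>l\<in>S - {i}. a l (\<pi> l)))"
    by (subst sum.inter_filter[symmetric]) (auto simp: finite_permutations[OF assms(1)])
  also have "{\<pi>. \<pi> permutes S \<and> \<pi> i = i} = {\<pi>. \<pi> permutes S - {i}}"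
    using permutes_subset_fixing[of "S - {i}" S] assms by (simp add: Diff_Diff_Int)
  finally show ?thesis unfolding set_det_def .
qed

lemma set_det_rank_one_cof:
  fixes a :: "'i \<Rightarrow> 'i \<Rightarrow> 'a::{comm_ring_1,ring_char_0,idom}"
  assumes "finite S"
  shows "set_det S (\<lambda>i j. a i j + u i * v j) = set_det S a + (\<Sum>i\<in>S. \<Sum>j\<in>S. set_cof S a i j * (u i * v j))"
  unfolding set_det_rank_one_update[OF assms] set_cof_def
  by (simp add: set_det_expand_row[OF assms, of _ _ v] sum_distrib_left mult_ac)

text \<open>The trace of the resolvent identity, with adjugates for inverses: \<open>C - B\<close>
  is \<open>x - y\<close> times the identity, and adj(B) (C - B) adj(C) = det(C) adj(B) - det(B)
  adj(C).\<close>

lemma set_cof_resolvent: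
  fixes a :: "'i \<Rightarrow> 'i \<Rightarrow> 'a::{comm_ring_1,ring_char_0,idom}"
  assumes "finite S" "\<And>i j. a i j = a j i"
    and B: "B = (\<lambda>i j. a i j - x * of_bool (i = j))" and C: "C = (\<lambda>i j. a i j - y * of_bool (i = j))"
  shows "(x - y) * (\<Sum>i\<in>S. \<Sum>j\<in>S. set_cof S B i j * set_cof S C i j)
    = set_det S C * (\<Sum>i\<in>S. set_cof S B i i) - set_det S B * (\<Sum>i\<in>S. set_cof S C i i)"
proof -
  have sym: "B i j = B j i" for i j using assms(2)[of i j] unfolding B by auto
  have "(x - y) * (\<Sum>i\<in>S. \<Sum>j\<in>S. set_cof S B i j * set_cof S C i j)
     = (\<Sum>i\<in>S. \<Sum>j\<in>S. \<Sum>l\<in>S. set_cof S B i j * (C j l - B j l) * set_cof S C i l)"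
  proof -
    have "(\<Sum>l\<in>S. set_cof S B i j * (C j l - B j l) * set_cof S C i l)
       = (x - y) * (set_cof S B i j * set_cof S C i j)" if "j \<in> S" for i j
    proof -
      have "(\<Sum>l\<in>S. set_cof S B i j * (C j l - B j l) * set_cof S C i l)
         = (\<Sum>l\<in>S. if l = j then (x - y) * (set_cof S B i j * set_cof S C i j) else 0)"
        by (rule sum.cong) (auto simp: B C algebra_simps)
      then show ?thesis using that assms(1) by simp
    qed
    then show ?thesis by (simp add: sum_distrib_left)
  qed
  also have "\<dots> = (\<Sum>i\<in>S. \<Sum>j\<in>S. set_cof S B i j * (\<Sum>l\<in>S. set_cof S C i l * C j l))
      - (\<Sum>i\<in>S. \<Sum>l\<in>S. set_cof S C i l * (\<Sum>j\<in>S. set_cof S B i j * B l j))"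
  proof -
    have "(\<Sum>j\<in>S. \<Sum>l\<in>S. set_cof S B i j * (C j l - B j l) * set_cof S C i l)
      = (\<Sum>j\<in>S. set_cof S B i j * (\<Sum>l\<in>S. set_cof S C i l * C j l))
        - (\<Sum>l\<in>S. set_cof S C i l * (\<Sum>j\<in>S. set_cof S B i j * B l j))" for i
      unfolding sum_distrib_left
      by (subst (3) sum.swap) (simp add: sum_subtractf[symmetric] algebra_simps sym[of _ i] sym)
    then show ?thesis by (simp add: sum_subtractf)
  qed
  also have "\<dots> = (\<Sum>i\<in>S. \<Sum>j\<in>S. set_cof S B i j * (of_bool (j = i) * set_det S C))
      - (\<Sum>i\<in>S. \<Sum>l\<in>S. set_cof S C i l * (of_bool (l = i) * set_det S B))"
    using assms(1) by (intro arg_cong2[where f = "(-)"] sum.cong refl) (simp_all add: set_cof_adjugate)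
  also have "\<dots> = set_det S C * (\<Sum>i\<in>S. set_cof S B i i) - set_det S B * (\<Sum>i\<in>S. set_cof S C i i)"
  proof -
    have "(\<Sum>j\<in>S. f j * (of_bool (j = i) * c)) = c * f i" if "i \<in> S" for f and c :: 'a and i
    proof -
      have "(\<Sum>j\<in>S. f j * (of_bool (j = i) * c)) = (\<Sum>j\<in>S. if j = i then c * f j else 0)"
        by (rule sum.cong) auto
      then show ?thesis using that assms(1) by simp
    qed
    then show ?thesis by (simp add: sum_distrib_left)
  qed
  finally show ?thesis .
qed

subsection \<open>The recursion in the number of rows\<close>

definition gram :: "(nat \<times> nat \<Rightarrow> real) \<Rightarrow> nat \<Rightarrow> nat \<Rightarrow> nat \<Rightarrow> real" where
  "gram v k i j = (\<Sum>r<k. v (r, i) * v (r, j))"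

lemma gram_sym: "gram v k i j = gram v k j i"
  by (simp add: gram_def mult.commute)

lemma gram_Suc: "gram v (Suc k) i j = gram v k i j + v (k, i) * v (k, j)"
  by (simp add: gram_def)

section \<open>Bounds for minors of a Gram matrix\<close>

text \<open>The majorant is a product over all columns because, by independence, the expectation of
  such a product factorises.\<close>

lemma abs_mult_le_prod_one_plus_square:
  fixes f :: "nat \<Rightarrow> real"
  assumes "i < m" "j < m"
  shows "\<bar>f i * f j\<bar> \<le> (\<Prod>c<m. 1 + (f c)\<^sup>2)"
proof -
  have *: "(f l)\<^sup>2 \<le> (\<Prod>c<m. 1 + (f c)\<^sup>2)" if "l < m" for l
  proof -
    have "1 \<le> (\<Prod>c\<in>{..<m} - {l}. 1 + (f c)\<^sup>2)" by (rule prod_ge_1) simp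
    then have "(1 + (f l)\<^sup>2) * 1 \<le> (1 + (f l)\<^sup>2) * (\<Prod>c\<in>{..<m} - {l}. 1 + (f c)\<^sup>2)"
      by (intro mult_left_mono) auto
    also have "\<dots> = (\<Prod>c<m. 1 + (f c)\<^sup>2)"
      using that by (subst (2) prod.remove[of _ l]) auto
    finally show ?thesis by simp
  qed
  have "2 * \<bar>f i * f j\<bar> \<le> (f i)\<^sup>2 + (f j)\<^sup>2"
    using sum_squares_bound[of "\<bar>f i\<bar>" "\<bar>f j\<bar>"] by (simp add: abs_mult)
  with *[OF assms(1)] *[OF assms(2)] show ?thesis by linarith
qed

text \<open>The weights \<open>w\<close> keep the class of matrices closed under replacing a row by a unit vector,
  which is what a cofactor is.\<close>

lemma set_det_gram_bound:
  assumes "S \<subseteq> {..<m}"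
  shows "\<exists>K\<ge>0. \<forall>v. \<bar>set_det S (\<lambda>i j. C i j + w i * gram v k i j)\<bar>
     \<le> K * (\<Prod>r<k. \<Prod>c<m. 1 + (v (r, c))\<^sup>2)"
proof (induction k arbitrary: C w)
  case 0
  show ?case by (rule exI[of _ "\<bar>set_det S C\<bar>"]) (simp add: gram_def)
next
  case (Suc k)
  have fin: "finite S" using assms finite_subset by blast
  let ?P = "\<lambda>v :: nat \<times> nat \<Rightarrow> real. \<Prod>r<k. \<Prod>c<m. 1 + (v (r, c))\<^sup>2"
  let ?R = "\<lambda>v :: nat \<times> nat \<Rightarrow> real. \<Prod>c<m. 1 + (v (k, c))\<^sup>2"
  let ?a = "\<lambda>v i j. C i j + w i * gram v k i j"
  obtain K where K: "K \<ge> 0" "\<And>v. \<bar>set_det S (?a v)\<bar> \<le> K * ?P v"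
    using Suc.IH[of C w] by blast
  have "\<exists>L\<ge>0. \<forall>v. \<bar>set_cof S (?a v) i j\<bar> \<le> L * ?P v" for i j
  proof -
    have "set_cof S (?a v) i j = set_det S (\<lambda>i' j'. (C(i := (\<lambda>l. of_bool (l = j)))) i' j' + (w(i := 0)) i' * gram v k i' j')" for v
      unfolding set_cof_def by (rule set_det_cong) auto
    then show ?thesis using Suc.IH by presburger
  qed
  note cof_bound = this
  \<comment> \<open>The constants must not depend on \<open>v\<close>, so they are chosen for each
    \<open>(i, j)\<close> before \<open>v\<close> is introduced.\<close>
  define L where "L i j = (SOME L. L \<ge> 0 \<and> (\<forall>v. \<bar>set_cof S (?a v) i j\<bar> \<le> L * ?P v))" for i j
  have L: "L i j \<ge> 0" "\<bar>set_cof S (?a v) i j\<bar> \<le> L i j * ?P v" for i j v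
    using someI_ex[OF cof_bound[of i j]] unfolding L_def by blast+
  let ?K = "K + (\<Sum>i\<in>S. \<Sum>j\<in>S. L i j * \<bar>w i\<bar>)"
  have "\<bar>set_det S (\<lambda>i j. C i j + w i * gram v (Suc k) i j)\<bar> \<le> ?K * (?P v * ?R v)" for v
  proof -
    have P0: "?P v \<ge> 0" and R1: "?R v \<ge> 1"
      by (auto intro!: prod_nonneg prod_ge_1)
    have "set_det S (\<lambda>i j. C i j + w i * gram v (Suc k) i j)
        = set_det S (\<lambda>i j. ?a v i j + (w i * v (k, i)) * v (k, j))"
      by (rule set_det_cong) (simp add: gram_Suc algebra_simps)
    also have "\<dots> = set_det S (?a v) + (\<Sum>i\<in>S. \<Sum>j\<in>S. set_cof S (?a v) i j * (w i * v (k, i) * v (k, j)))"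
      by (rule set_det_rank_one_cof[OF fin])
    finally have "\<bar>set_det S (\<lambda>i j. C i j + w i * gram v (Suc k) i j)\<bar>
        \<le> \<bar>set_det S (?a v)\<bar> + (\<Sum>i\<in>S. \<Sum>j\<in>S. \<bar>set_cof S (?a v) i j * (w i * v (k, i) * v (k, j))\<bar>)"
      by (auto intro!: order_trans[OF abs_triangle_ineq] order_trans[OF sum_abs] sum_mono)
    also have "\<dots> \<le> K * (?P v * ?R v) + (\<Sum>i\<in>S. \<Sum>j\<in>S. (L i j * \<bar>w i\<bar>) * (?P v * ?R v))"
    proof (intro add_mono sum_mono)
      have "K * ?P v * 1 \<le> K * ?P v * ?R v" using K(1) P0 R1 by (intro mult_left_mono) auto
      then show "\<bar>set_det S (?a v)\<bar> \<le> K * (?P v * ?R v)"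
        using K(2)[of v] by (simp add: mult.assoc)
      fix i j assume "i \<in> S" "j \<in> S"
      then have "\<bar>v (k, i) * v (k, j)\<bar> \<le> ?R v"
        using abs_mult_le_prod_one_plus_square[of i m j "\<lambda>c. v (k, c)"] assms by auto
      then have "\<bar>set_cof S (?a v) i j\<bar> * (\<bar>w i\<bar> * \<bar>v (k, i) * v (k, j)\<bar>) \<le> (L i j * ?P v) * (\<bar>w i\<bar> * ?R v)"
        using L P0 by (intro mult_mono) auto
      then show "\<bar>set_cof S (?a v) i j * (w i * v (k, i) * v (k, j))\<bar> \<le> (L i j * \<bar>w i\<bar>) * (?P v * ?R v)"
        by (simp add: abs_mult mult_ac)
    qed
    also have "\<dots> = ?K * (?P v * ?R v)" by (simp add: sum_distrib_right distrib_right)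
    finally show ?thesis .
  qed
  moreover have "?K \<ge> 0" using K L by (auto intro!: add_nonneg_nonneg sum_nonneg)
  ultimately show ?case by (intro exI[of _ ?K]) simp
qed

lemma borel_measurable_set_det:
  fixes a :: "'b \<Rightarrow> 'i \<Rightarrow> 'i \<Rightarrow> real"
  assumes "\<And>i j. i \<in> S \<Longrightarrow> j \<in> S \<Longrightarrow> (\<lambda>x. a x i j) \<in> borel_measurable N"
  shows "(\<lambda>x. set_det S (a x)) \<in> borel_measurable N"
  unfolding set_det_def
  by (intro borel_measurable_sum borel_measurable_times borel_measurable_prod borel_measurable_const assms)
     (auto simp: permutes_in_image)

definition char_minor :: "nat set \<Rightarrow> nat \<Rightarrow> (nat \<times> nat \<Rightarrow> real) \<Rightarrow> real \<Rightarrow> real" where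
  "char_minor S k v z = set_det S (\<lambda>i j. gram v k i j - z * of_bool (i = j))"

definition char_cof :: "nat set \<Rightarrow> nat \<Rightarrow> (nat \<times> nat \<Rightarrow> real) \<Rightarrow> real \<Rightarrow> nat \<Rightarrow> nat \<Rightarrow> real" where
  "char_cof S k v z = set_cof S (\<lambda>i j. gram v k i j - z * of_bool (i = j))"

lemma char_minor_bound:
  assumes "S \<subseteq> {..<m}"
  shows "\<exists>K\<ge>0. \<forall>v. \<bar>char_minor S k v z\<bar> \<le> K * (\<Prod>r<k. \<Prod>c<m. 1 + (v (r, c))\<^sup>2)"
  using set_det_gram_bound[OF assms, of "\<lambda>i j. - z * of_bool (i = j)" "\<lambda>_. 1" k]
  unfolding char_minor_def by simp

lemma char_cof_bound:
  assumes "S \<subseteq> {..<m}"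
  shows "\<exists>K\<ge>0. \<forall>v. \<bar>char_cof S k v z i j\<bar> \<le> K * (\<Prod>r<k. \<Prod>c<m. 1 + (v (r, c))\<^sup>2)"
proof -
  have "char_cof S k v z i j = set_det S (\<lambda>i' j'. ((\<lambda>i j. - z * of_bool (i = j))(i := (\<lambda>l. of_bool (l = j)))) i' j'
      + ((\<lambda>_. 1)(i := 0)) i' * gram v k i' j')" for v
    unfolding char_cof_def set_cof_def by (rule set_det_cong) auto
  then show ?thesis using set_det_gram_bound[OF assms] by presburger
qed

section \<open>Moments of a row and independence of rows\<close>

locale iid_array = prob_space M for M :: "'a measure" +
  fixes Y :: "nat \<times> nat \<Rightarrow> 'a \<Rightarrow> real" and n m :: nat and b :: real
  assumes indep: "indep_vars (\<lambda>_. borel) Y ({..<n} \<times> {..<m})"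
    and integrable_fourth: "p \<in> {..<n} \<times> {..<m} \<Longrightarrow> integrable M (\<lambda>\<omega>. Y p \<omega> ^ 4)"
    and first_moment: "p \<in> {..<n} \<times> {..<m} \<Longrightarrow> expectation (Y p) = 0"
    and second_moment: "p \<in> {..<n} \<times> {..<m} \<Longrightarrow> expectation (\<lambda>\<omega>. (Y p \<omega>)\<^sup>2) = 1"
    and fourth_moment: "p \<in> {..<n} \<times> {..<m} \<Longrightarrow> expectation (\<lambda>\<omega>. Y p \<omega> ^ 4) = b"
begin

lemma Y_measurable: "p \<in> {..<n} \<times> {..<m} \<Longrightarrow> Y p \<in> borel_measurable M"
  using indep unfolding indep_vars_def by auto

lemma integrable_power:
  assumes "p \<in> {..<n} \<times> {..<m}" "e \<le> 4"
  shows "integrable M (\<lambda>\<omega>. Y p \<omega> ^ e)"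
proof (rule Bochner_Integration.integrable_bound)
  show "integrable M (\<lambda>\<omega>. 1 + Y p \<omega> ^ 4)" using integrable_fourth[OF assms(1)] by simp
  show "(\<lambda>\<omega>. Y p \<omega> ^ e) \<in> borel_measurable M" using Y_measurable[OF assms(1)] by simp
  have "\<bar>y ^ e\<bar> \<le> 1 + y ^ 4" for y :: real
  proof (cases "\<bar>y\<bar> \<le> 1")
    case True
    then have "\<bar>y\<bar> ^ e \<le> 1" by (simp add: power_le_one)
    moreover have "0 \<le> y ^ 4" by simp
    ultimately show ?thesis unfolding power_abs by linarith
  next
    case False
    then have "\<bar>y\<bar> ^ e \<le> \<bar>y\<bar> ^ 4" using assms(2) by (intro power_increasing) auto
    then show ?thesis by (simp add: power_abs)
  qed
  then show "AE \<omega> in M. norm (Y p \<omega> ^ e) \<le> norm (1 + Y p \<omega> ^ 4)" by (auto intro: order_trans[OF _ abs_ge_self])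
qed

lemma expectation_row_monomial:
  assumes "k < n" "\<And>c. c < m \<Longrightarrow> e c \<le> 4"
  shows "expectation (\<lambda>\<omega>. \<Prod>c<m. Y (k, c) \<omega> ^ e c) = (\<Prod>c<m. expectation (\<lambda>\<omega>. Y (k, c) \<omega> ^ e c))"
    and "integrable M (\<lambda>\<omega>. \<Prod>c<m. Y (k, c) \<omega> ^ e c)"
proof -
  let ?I = "(\<lambda>c. (k, c)) ` {..<m}"
  have "indep_vars (\<lambda>_. borel) Y ?I"
    by (rule indep_vars_subset[OF indep]) (use assms in auto)
  then have ind: "indep_vars (\<lambda>_. borel) (\<lambda>p \<omega>. Y p \<omega> ^ e (snd p)) ?I"
    by (rule indep_vars_compose2) simp
  have int: "integrable M (\<lambda>\<omega>. Y p \<omega> ^ e (snd p))" if "p \<in> ?I" for p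
    by (rule integrable_power) (use that assms in auto)
  have reindex: "(\<Prod>c<m. f (k, c)) = (\<Prod>p\<in>?I. f p)" for f :: "nat \<times> nat \<Rightarrow> real"
    by (subst prod.reindex) (auto simp: inj_on_def)
  have "expectation (\<lambda>\<omega>. \<Prod>p\<in>?I. Y p \<omega> ^ e (snd p)) = (\<Prod>p\<in>?I. expectation (\<lambda>\<omega>. Y p \<omega> ^ e (snd p)))"
    by (rule indep_vars_lebesgue_integral[OF _ ind int]) auto
  then show "expectation (\<lambda>\<omega>. \<Prod>c<m. Y (k, c) \<omega> ^ e c) = (\<Prod>c<m. expectation (\<lambda>\<omega>. Y (k, c) \<omega> ^ e c))"
    unfolding reindex[symmetric] by simp
  have "integrable M (\<lambda>\<omega>. \<Prod>p\<in>?I. Y p \<omega> ^ e (snd p))"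
    by (rule indep_vars_integrable[OF _ ind int]) auto
  then show "integrable M (\<lambda>\<omega>. \<Prod>c<m. Y (k, c) \<omega> ^ e c)"
    unfolding reindex[symmetric] by simp
qed

lemma prod_power_of_bool:
  fixes f :: "nat \<Rightarrow> real"
  assumes "i < m"
  shows "(\<Prod>c<m. f c ^ of_bool (c = i)) = f i"
proof -
  have "(\<Prod>c<m. f c ^ of_bool (c = i)) = (\<Prod>c<m. if c = i then f c else 1)"
    by (rule prod.cong) auto
  then show ?thesis using assms by simp
qed

lemma row_quadratic:
  assumes "k < n" "i < m" "j < m"
  shows "expectation (\<lambda>\<omega>. Y (k, i) \<omega> * Y (k, j) \<omega>) = of_bool (i = j)"
    and "integrable M (\<lambda>\<omega>. Y (k, i) \<omega> * Y (k, j) \<omega>)"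
proof -
  \<comment> \<open>\<open>e c\<close> counts the occurrences of column \<open>c\<close>, which
    turns the product into a monomial whose expectation factorises.\<close>
  define e :: "nat \<Rightarrow> nat" where "e c = of_bool (c = i) + of_bool (c = j)" for c
  have e4: "e c \<le> 4" for c by (simp add: e_def of_bool_def)
  have eq: "(\<Prod>c<m. Y (k, c) \<omega> ^ e c) = Y (k, i) \<omega> * Y (k, j) \<omega>" for \<omega>
    unfolding e_def power_add prod.distrib using assms by (simp only: prod_power_of_bool)
  have m: "expectation (\<lambda>\<omega>. Y (k, c) \<omega>) = 0" "expectation (\<lambda>\<omega>. (Y (k, c) \<omega>)\<^sup>2) = 1" if "c < m" for c
    using first_moment[of "(k, c)"] second_moment[of "(k, c)"] that assms by auto
  have "(\<Prod>c<m. expectation (\<lambda>\<omega>. Y (k, c) \<omega> ^ e c)) = (\<Prod>c\<in>{i, j}. expectation (\<lambda>\<omega>. Y (k, c) \<omega> ^ e c))"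
    by (rule prod.mono_neutral_right) (use assms in \<open>auto simp: e_def prob_space\<close>)
  also have "\<dots> = of_bool (i = j)"
    using m assms by (cases "i = j") (simp_all add: e_def numeral_eq_Suc)
  finally show "expectation (\<lambda>\<omega>. Y (k, i) \<omega> * Y (k, j) \<omega>) = of_bool (i = j)"
    using expectation_row_monomial(1)[of k e, OF assms(1) e4] unfolding eq by simp
  show "integrable M (\<lambda>\<omega>. Y (k, i) \<omega> * Y (k, j) \<omega>)"
    using expectation_row_monomial(2)[of k e, OF assms(1) e4] unfolding eq .
qed

text \<open>Wick's formula with a fourth cumulant: if all four indices agree, the three pairings
  account for 3 of the value \<open>b\<close>. Third moments, about which nothing is assumed, only
  occur next to a factor of mean zero.\<close>

lemma row_quartic:
  assumes "k < n" "i < m" "j < m" "l < m" "h < m"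
  shows "expectation (\<lambda>\<omega>. Y (k, i) \<omega> * Y (k, j) \<omega> * (Y (k, l) \<omega> * Y (k, h) \<omega>))
     = of_bool (i = j) * of_bool (l = h) + of_bool (i = l) * of_bool (j = h)
       + of_bool (i = h) * of_bool (j = l) + (b - 3) * of_bool (i = j \<and> i = l \<and> i = h)" (is "?E = ?D")
    and "integrable M (\<lambda>\<omega>. Y (k, i) \<omega> * Y (k, j) \<omega> * (Y (k, l) \<omega> * Y (k, h) \<omega>))"
proof -
  define e :: "nat \<Rightarrow> nat" where
    "e c = of_bool (c = i) + of_bool (c = j) + (of_bool (c = l) + of_bool (c = h))" for c
  have e4: "e c \<le> 4" for c by (simp add: e_def of_bool_def)
  have eq: "(\<Prod>c<m. Y (k, c) \<omega> ^ e c) = Y (k, i) \<omega> * Y (k, j) \<omega> * (Y (k, l) \<omega> * Y (k, h) \<omega>)" for \<omega>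
    unfolding e_def power_add prod.distrib using assms by (simp only: prod_power_of_bool)
  define \<mu> where "\<mu> c q = expectation (\<lambda>\<omega>. Y (k, c) \<omega> ^ q)" for c q
  have m: "\<mu> c (Suc 0) = 0" "\<mu> c (Suc (Suc 0)) = 1" "\<mu> c (Suc (Suc (Suc (Suc 0)))) = b" "\<mu> c 2 = 1" "\<mu> c 4 = b"
    if "c < m" for c
    using first_moment[of "(k, c)"] second_moment[of "(k, c)"] fourth_moment[of "(k, c)"] that assms
    by (auto simp: \<mu>_def numeral_eq_Suc)
  have dup: "{x, y, x} = {x, y}" for x y :: nat by auto
  have "(\<Prod>c<m. \<mu> c (e c)) = (\<Prod>c\<in>{i, j, l, h}. \<mu> c (e c))"
    by (rule prod.mono_neutral_right) (use assms in \<open>auto simp: e_def \<mu>_def prob_space\<close>)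
  also have "\<dots> = ?D"
  proof (cases "i = j")
    case True
    then show ?thesis using m assms
      by (cases "l = h"; cases "i = l"; cases "i = h") (simp_all add: e_def dup)
  next
    case ij: False
    show ?thesis
    proof (cases "i = l")
      case True
      then show ?thesis using ij m assms by (cases "j = h"; cases "i = h") (simp_all add: e_def dup)
    next
      case il: False
      show ?thesis
      proof (cases "i = h")
        case True
        then show ?thesis using ij il m assms by (cases "j = l") (simp_all add: e_def dup)
      next
        case False
        then have "\<mu> i (e i) = 0" using ij il m assms by (simp add: e_def)
        then have "(\<Prod>c\<in>{i, j, l, h}. \<mu> c (e c)) = 0" by (intro prod_zero) auto
        then show ?thesis using ij il False by simp
      qed
    qed
  qed
  finally show "?E = ?D"
    using expectation_row_monomial(1)[of k e, OF assms(1) e4] unfolding eq \<mu>_def by simp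
  show "integrable M (\<lambda>\<omega>. Y (k, i) \<omega> * Y (k, j) \<omega> * (Y (k, l) \<omega> * Y (k, h) \<omega>))"
    using expectation_row_monomial(2)[of k e, OF assms(1) e4] unfolding eq .
qed

text \<open>That \<open>g\<close> sees only the rows before \<open>k\<close>, and \<open>h\<close>
  only row \<open>k\<close>, is expressed by invariance under \<open>restrict\<close>; both remain
  functions of the whole array.\<close>

lemma expectation_row_factor:
  fixes g h :: "(nat \<times> nat \<Rightarrow> real) \<Rightarrow> real"
  assumes "k < n"
    and g: "g \<in> borel_measurable (PiM ({..<k} \<times> {..<m}) (\<lambda>_. borel))"
      "\<And>v. g (restrict v ({..<k} \<times> {..<m})) = g v" "integrable M (\<lambda>\<omega>. g (\<lambda>p. Y p \<omega>))"
    and h: "h \<in> borel_measurable (PiM ({k} \<times> {..<m}) (\<lambda>_. borel))"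
      "\<And>v. h (restrict v ({k} \<times> {..<m})) = h v" "integrable M (\<lambda>\<omega>. h (\<lambda>p. Y p \<omega>))"
  shows "expectation (\<lambda>\<omega>. g (\<lambda>p. Y p \<omega>) * h (\<lambda>p. Y p \<omega>))
     = expectation (\<lambda>\<omega>. g (\<lambda>p. Y p \<omega>)) * expectation (\<lambda>\<omega>. h (\<lambda>p. Y p \<omega>))"
    and "integrable M (\<lambda>\<omega>. g (\<lambda>p. Y p \<omega>) * h (\<lambda>p. Y p \<omega>))"
proof -
  have "indep_var borel (g \<circ> (\<lambda>\<omega>. restrict (\<lambda>p. Y p \<omega>) ({..<k} \<times> {..<m})))
     borel (h \<circ> (\<lambda>\<omega>. restrict (\<lambda>p. Y p \<omega>) ({k} \<times> {..<m})))"
    by (rule indep_var_compose[OF indep_var_restrict[OF indep] g(1) h(1)]) (use assms(1) in auto)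
  then have ind: "indep_var borel (\<lambda>\<omega>. g (\<lambda>p. Y p \<omega>)) borel (\<lambda>\<omega>. h (\<lambda>p. Y p \<omega>))"
    unfolding o_def g(2) h(2) .
  show "expectation (\<lambda>\<omega>. g (\<lambda>p. Y p \<omega>) * h (\<lambda>p. Y p \<omega>))
     = expectation (\<lambda>\<omega>. g (\<lambda>p. Y p \<omega>)) * expectation (\<lambda>\<omega>. h (\<lambda>p. Y p \<omega>))"
    by (rule indep_var_lebesgue_integral[OF ind g(3) h(3)])
  show "integrable M (\<lambda>\<omega>. g (\<lambda>p. Y p \<omega>) * h (\<lambda>p. Y p \<omega>))"
    by (rule indep_var_integrable[OF ind g(3) h(3)])
qed

text \<open>The product is dominated by a product of \<open>(1 + y^2)^2\<close> over the entries
  \<open>y\<close>. Each factor is integrable by the fourth moment, and independence makes their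
  product integrable.\<close>

lemma integrable_of_row_bounds:
  assumes "k \<le> n"
    and meas: "g \<in> borel_measurable (PiM ({..<k} \<times> {..<m}) (\<lambda>_. borel))"
      "h \<in> borel_measurable (PiM ({..<k} \<times> {..<m}) (\<lambda>_. borel))"
    and restr: "\<And>v. g (restrict v ({..<k} \<times> {..<m})) = g v" "\<And>v. h (restrict v ({..<k} \<times> {..<m})) = h v"
    and bnd: "\<exists>K\<ge>0. \<forall>v. \<bar>g v\<bar> \<le> K * (\<Prod>r<k. \<Prod>c<m. 1 + (v (r, c))\<^sup>2)"
      "\<exists>K\<ge>0. \<forall>v. \<bar>h v\<bar> \<le> K * (\<Prod>r<k. \<Prod>c<m. 1 + (v (r, c))\<^sup>2)"
  shows "integrable M (\<lambda>\<omega>. g (\<lambda>p. Y p \<omega>) * h (\<lambda>p. Y p \<omega>))"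
proof -
  let ?I = "{..<k} \<times> {..<m}"
  obtain K L where K: "\<And>v. \<bar>g v\<bar> \<le> K * (\<Prod>r<k. \<Prod>c<m. 1 + (v (r, c))\<^sup>2)" "K \<ge> 0"
    and L: "\<And>v. \<bar>h v\<bar> \<le> L * (\<Prod>r<k. \<Prod>c<m. 1 + (v (r, c))\<^sup>2)" "L \<ge> 0"
    using bnd by blast
  have "indep_vars (\<lambda>_. borel) Y ?I"
    by (rule indep_vars_subset[OF indep]) (use assms(1) in auto)
  then have ind: "indep_vars (\<lambda>_. borel) (\<lambda>p \<omega>. (1 + (Y p \<omega>)\<^sup>2)\<^sup>2) ?I"
    by (rule indep_vars_compose2) simp
  have "integrable M (\<lambda>\<omega>. (1 + (Y p \<omega>)\<^sup>2)\<^sup>2)" if "p \<in> ?I" for p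
  proof -
    have p: "p \<in> {..<n} \<times> {..<m}" using that assms(1) by auto
    have "(\<lambda>\<omega>. (1 + (Y p \<omega>)\<^sup>2)\<^sup>2) = (\<lambda>\<omega>. 1 + 2 * (Y p \<omega>)\<^sup>2 + Y p \<omega> ^ 4)"
      by (auto simp: power2_eq_square algebra_simps power4_eq_xxxx)
    then show ?thesis using integrable_power[OF p, of 2] integrable_fourth[OF p] by simp
  qed
  then have int: "integrable M (\<lambda>\<omega>. \<Prod>p\<in>?I. (1 + (Y p \<omega>)\<^sup>2)\<^sup>2)"
    by (intro indep_vars_integrable[OF _ ind]) auto
  have "(\<lambda>\<omega>. \<lambda>p\<in>?I. Y p \<omega>) \<in> measurable M (PiM ?I (\<lambda>_. borel))"
    by (rule measurable_restrict) (use assms(1) Y_measurable in auto)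
  note ms = this
  have mg: "(\<lambda>\<omega>. g (\<lambda>p. Y p \<omega>)) \<in> borel_measurable M" "(\<lambda>\<omega>. h (\<lambda>p. Y p \<omega>)) \<in> borel_measurable M"
    using measurable_compose[OF ms meas(1)] measurable_compose[OF ms meas(2)] unfolding restr .
  show ?thesis
  proof (rule Bochner_Integration.integrable_bound)
    show "integrable M (\<lambda>\<omega>. (K * L) * (\<Prod>p\<in>?I. (1 + (Y p \<omega>)\<^sup>2)\<^sup>2))" using int by simp
    show "(\<lambda>\<omega>. g (\<lambda>p. Y p \<omega>) * h (\<lambda>p. Y p \<omega>)) \<in> borel_measurable M" using mg by simp
    have "\<bar>g v * h v\<bar> \<le> (K * L) * (\<Prod>p\<in>?I. (1 + (v p)\<^sup>2)\<^sup>2)" for v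
    proof -
      have P: "(\<Prod>r<k. \<Prod>c<m. 1 + (v (r, c))\<^sup>2) = (\<Prod>p\<in>?I. 1 + (v p)\<^sup>2)"
        by (subst prod.cartesian_product) (auto intro!: prod.cong)
      have "\<bar>g v\<bar> * \<bar>h v\<bar> \<le> (K * (\<Prod>p\<in>?I. 1 + (v p)\<^sup>2)) * (L * (\<Prod>p\<in>?I. 1 + (v p)\<^sup>2))"
        using K L(1)[of v] unfolding P[symmetric]
        by (intro mult_mono) (auto intro!: mult_nonneg_nonneg prod_nonneg)
      also have "\<dots> = (K * L) * (\<Prod>p\<in>?I. (1 + (v p)\<^sup>2)\<^sup>2)"
        by (simp only: prod_power_distrib[symmetric]) (simp add: power2_eq_square mult_ac)
      finally show ?thesis by (simp add: abs_mult)
    qed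
    then show "AE \<omega> in M. norm (g (\<lambda>p. Y p \<omega>) * h (\<lambda>p. Y p \<omega>))
        \<le> norm ((K * L) * (\<Prod>p\<in>?I. (1 + (Y p \<omega>)\<^sup>2)\<^sup>2))"
      by (auto intro: order_trans[OF _ abs_ge_self])
  qed
qed

end

lemma char_minor_expand:
  assumes "finite S"
  shows "char_minor S k v z = (\<Sum>U\<in>Pow S. (- z) ^ card (S - U) * set_det U (gram v k))"
  unfolding char_minor_def by (rule set_det_shift_expand[OF assms])

text \<open>Contraction of a four-index array with the quartic moment of a row: three pairings and
  the full coincidence.\<close>

lemma sum_delta_kronecker:
  fixes q :: "'i \<Rightarrow> 'i \<Rightarrow> 'i \<Rightarrow> 'i \<Rightarrow> real"
  assumes "finite S"
  shows "(\<Sum>i\<in>S. \<Sum>j\<in>S. \<Sum>l\<in>S. \<Sum>h\<in>S. q i j l h * (of_bool (i = j) * of_bool (l = h) + of_bool (i = l) * of_bool (j = h)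
       + of_bool (i = h) * of_bool (j = l) + c * of_bool (i = j \<and> i = l \<and> i = h)))
   = (\<Sum>i\<in>S. \<Sum>l\<in>S. q i i l l) + (\<Sum>i\<in>S. \<Sum>j\<in>S. q i j i j) + (\<Sum>i\<in>S. \<Sum>j\<in>S. q i j j i)
     + c * (\<Sum>i\<in>S. q i i i i)"
proof -
  have delta: "(\<Sum>j\<in>S. f j * of_bool (i = j)) = f i" "(\<Sum>j\<in>S. of_bool (i = j) * f j) = f i"
    if "i \<in> S" for i and f :: "'i \<Rightarrow> real"
  proof -
    have "(\<Sum>j\<in>S. f j * of_bool (i = j)) = (\<Sum>j\<in>S. if i = j then f j else 0)"
      by (rule sum.cong) auto
    then show "(\<Sum>j\<in>S. f j * of_bool (i = j)) = f i" using that assms by simp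
    then show "(\<Sum>j\<in>S. of_bool (i = j) * f j) = f i" by (simp add: mult.commute)
  qed
  have "(\<Sum>j\<in>S. \<Sum>l\<in>S. \<Sum>h\<in>S. q i j l h * (of_bool (i = j) * of_bool (l = h) + of_bool (i = l) * of_bool (j = h)
       + of_bool (i = h) * of_bool (j = l) + c * of_bool (i = j \<and> i = l \<and> i = h)))
    = (\<Sum>l\<in>S. q i i l l) + (\<Sum>j\<in>S. q i j i j) + (\<Sum>j\<in>S. q i j j i) + c * q i i i i" if i: "i \<in> S" for i
  proof -
    have "(\<Sum>j\<in>S. \<Sum>l\<in>S. \<Sum>h\<in>S. q i j l h * (of_bool (i = j) * of_bool (l = h)))
        = (\<Sum>j\<in>S. (\<Sum>l\<in>S. q i j l l) * of_bool (i = j))"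
      unfolding sum_distrib_right
      by (intro sum.cong refl, subst mult.left_commute, subst sum_distrib_left[symmetric])
         (simp add: delta mult.commute)
    then have 1: "(\<Sum>j\<in>S. \<Sum>l\<in>S. \<Sum>h\<in>S. q i j l h * (of_bool (i = j) * of_bool (l = h))) = (\<Sum>l\<in>S. q i i l l)"
      using i by (simp add: delta)
    have 2: "(\<Sum>j\<in>S. \<Sum>l\<in>S. \<Sum>h\<in>S. q i j l h * (of_bool (i = l) * of_bool (j = h))) = (\<Sum>j\<in>S. q i j i j)"
    proof (rule sum.cong[OF refl])
      fix j assume j: "j \<in> S"
      have "(\<Sum>l\<in>S. \<Sum>h\<in>S. q i j l h * (of_bool (i = l) * of_bool (j = h))) = (\<Sum>l\<in>S. q i j l j * of_bool (i = l))"
        by (intro sum.cong refl, subst mult.left_commute, subst sum_distrib_left[symmetric])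
           (use j in \<open>simp add: delta mult.commute\<close>)
      then show "(\<Sum>l\<in>S. \<Sum>h\<in>S. q i j l h * (of_bool (i = l) * of_bool (j = h))) = q i j i j"
        using i by (simp add: delta)
    qed
    have 3: "(\<Sum>j\<in>S. \<Sum>l\<in>S. \<Sum>h\<in>S. q i j l h * (of_bool (i = h) * of_bool (j = l))) = (\<Sum>j\<in>S. q i j j i)"
    proof (rule sum.cong[OF refl])
      fix j assume j: "j \<in> S"
      have "(\<Sum>l\<in>S. \<Sum>h\<in>S. q i j l h * (of_bool (i = h) * of_bool (j = l))) = (\<Sum>l\<in>S. q i j l i * of_bool (j = l))"
        using i by (intro sum.cong refl) (simp add: delta mult.assoc[symmetric] sum_distrib_right[symmetric])
      then show "(\<Sum>l\<in>S. \<Sum>h\<in>S. q i j l h * (of_bool (i = h) * of_bool (j = l))) = q i j j i"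
        using j by (simp add: delta)
    qed
    have 4: "(\<Sum>j\<in>S. \<Sum>l\<in>S. \<Sum>h\<in>S. q i j l h * (c * of_bool (i = j \<and> i = l \<and> i = h))) = c * q i i i i"
    proof -
      have "(\<Sum>j\<in>S. \<Sum>l\<in>S. \<Sum>h\<in>S. q i j l h * (c * of_bool (i = j \<and> i = l \<and> i = h)))
         = (\<Sum>j\<in>S. \<Sum>l\<in>S. \<Sum>h\<in>S. ((c * q i j l h) * of_bool (i = j) * of_bool (i = l)) * of_bool (i = h))"
        by (intro sum.cong refl) auto
      then show ?thesis using i by (simp add: delta)
    qed
    show ?thesis
      unfolding distrib_left sum.distrib 1 2 3 4 ..
  qed
  then show ?thesis by (simp add: sum.distrib sum_distrib_left)
qed

section \<open>The effect of one more row on correlations of minors\<close>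

context iid_array
begin

abbreviation "minor S k z \<omega> \<equiv> char_minor S k (\<lambda>p. Y p \<omega>) z"
abbreviation "cofac S k z i j \<omega> \<equiv> char_cof S k (\<lambda>p. Y p \<omega>) z i j"

text \<open>Two index sets are kept apart, since a derivative in \<open>x\<close> or in
  \<open>y\<close> deletes indices from one factor only.\<close>

definition minor_corr :: "nat \<Rightarrow> nat set \<Rightarrow> nat set \<Rightarrow> real \<Rightarrow> real \<Rightarrow> real" where
  "minor_corr k S T x y = expectation (\<lambda>\<omega>. minor S k x \<omega> * minor T k y \<omega>)"

definition gram_minor_corr :: "nat \<Rightarrow> nat set \<Rightarrow> nat set \<Rightarrow> real" where
  "gram_minor_corr k U V = expectation (\<lambda>\<omega>. set_det U (gram (\<lambda>p. Y p \<omega>) k) * set_det V (gram (\<lambda>p. Y p \<omega>) k))"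

lemma gram_measurable:
  assumes "i < m" "j < m"
  shows "(\<lambda>v. gram v k i j) \<in> borel_measurable (PiM ({..<k} \<times> {..<m}) (\<lambda>_. borel))"
  unfolding gram_def
  by (intro borel_measurable_sum borel_measurable_times measurable_component_singleton) (use assms in auto)

lemma gram_restrict:
  assumes "i < m" "j < m"
  shows "gram (restrict v ({..<k} \<times> {..<m})) k i j = gram v k i j"
  unfolding gram_def using assms by (intro sum.cong) auto

lemma char_minor_measurable:
  assumes "S \<subseteq> {..<m}"
  shows "(\<lambda>v. char_minor S k v z) \<in> borel_measurable (PiM ({..<k} \<times> {..<m}) (\<lambda>_. borel))"
  unfolding char_minor_def
  by (intro borel_measurable_set_det borel_measurable_diff gram_measurable borel_measurable_const) (use assms in auto)

lemma char_minor_restrict: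
  assumes "S \<subseteq> {..<m}"
  shows "char_minor S k (restrict v ({..<k} \<times> {..<m})) z = char_minor S k v z"
proof -
  have "gram (restrict v ({..<k} \<times> {..<m})) k i j = gram v k i j" if "i \<in> S" "j \<in> S" for i j
    by (rule gram_restrict) (use that assms in auto)
  then show ?thesis unfolding char_minor_def by (intro set_det_cong) auto
qed

lemma char_cof_measurable:
  assumes "S \<subseteq> {..<m}"
  shows "(\<lambda>v. char_cof S k v z i j) \<in> borel_measurable (PiM ({..<k} \<times> {..<m}) (\<lambda>_. borel))"
  unfolding char_cof_def set_cof_def
proof (rule borel_measurable_set_det)
  fix i' j' assume "i' \<in> S" "j' \<in> S"
  then have "i' < m" "j' < m" using assms by auto
  then show "(\<lambda>v. ((\<lambda>i j. gram v k i j - z * of_bool (i = j))(i := \<lambda>l. of_bool (l = j))) i' j')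
        \<in> borel_measurable (PiM ({..<k} \<times> {..<m}) (\<lambda>_. borel))"
    by (cases "i' = i", simp, simp only: fun_upd_apply if_False)
       (intro borel_measurable_diff gram_measurable borel_measurable_const)
qed

lemma char_cof_restrict:
  assumes "S \<subseteq> {..<m}"
  shows "char_cof S k (restrict v ({..<k} \<times> {..<m})) z i j = char_cof S k v z i j"
proof -
  have "gram (restrict v ({..<k} \<times> {..<m})) k i j = gram v k i j" if "i \<in> S" "j \<in> S" for i j
    by (rule gram_restrict) (use that assms in auto)
  then show ?thesis unfolding char_cof_def set_cof_def by (intro set_det_cong) auto
qed

lemma row_quadratic_measurable:
  assumes "i < m" "j < m"
  shows "(\<lambda>v :: nat \<times> nat \<Rightarrow> real. v (k, i) * v (k, j)) \<in> borel_measurable (PiM ({k} \<times> {..<m}) (\<lambda>_. borel))"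
  by (intro borel_measurable_times measurable_component_singleton) (use assms in auto)

lemma row_quartic_measurable:
  assumes "i < m" "j < m" "l < m" "h < m"
  shows "(\<lambda>v :: nat \<times> nat \<Rightarrow> real. v (k, i) * v (k, j) * (v (k, l) * v (k, h))) \<in> borel_measurable (PiM ({k} \<times> {..<m}) (\<lambda>_. borel))"
  by (intro borel_measurable_times measurable_component_singleton) (use assms in auto)

lemma minor_minor_integrable:
  assumes "k \<le> n" "S \<subseteq> {..<m}" "T \<subseteq> {..<m}"
  shows "integrable M (\<lambda>\<omega>. minor S k x \<omega> * minor T k y \<omega>)"
  by (rule integrable_of_row_bounds[OF assms(1) char_minor_measurable[OF assms(2)] char_minor_measurable[OF assms(3)]
        char_minor_restrict[OF assms(2)] char_minor_restrict[OF assms(3)]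
        char_minor_bound[OF assms(2)] char_minor_bound[OF assms(3)]])

lemma cofac_minor_integrable:
  assumes "k \<le> n" "S \<subseteq> {..<m}" "T \<subseteq> {..<m}"
  shows "integrable M (\<lambda>\<omega>. cofac S k x i j \<omega> * minor T k y \<omega>)"
  by (rule integrable_of_row_bounds[OF assms(1) char_cof_measurable[OF assms(2)] char_minor_measurable[OF assms(3)]
        char_cof_restrict[OF assms(2)] char_minor_restrict[OF assms(3)]
        char_cof_bound[OF assms(2)] char_minor_bound[OF assms(3)]])

lemma cofac_cofac_integrable:
  assumes "k \<le> n" "S \<subseteq> {..<m}" "T \<subseteq> {..<m}"
  shows "integrable M (\<lambda>\<omega>. cofac S k x i j \<omega> * cofac T k y l h \<omega>)"
  by (rule integrable_of_row_bounds[OF assms(1) char_cof_measurable[OF assms(2)] char_cof_measurable[OF assms(3)]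
        char_cof_restrict[OF assms(2)] char_cof_restrict[OF assms(3)]
        char_cof_bound[OF assms(2)] char_cof_bound[OF assms(3)]])

lemma expectation_quadratic_factor:
  assumes "k < n" "i < m" "j < m" "S \<subseteq> {..<m}"
  shows "expectation (\<lambda>\<omega>. (cofac S k x i j \<omega> * minor S k y \<omega>) * (Y (k, i) \<omega> * Y (k, j) \<omega>))
     = expectation (\<lambda>\<omega>. cofac S k x i j \<omega> * minor S k y \<omega>) * of_bool (i = j)"
    and "integrable M (\<lambda>\<omega>. (cofac S k x i j \<omega> * minor S k y \<omega>) * (Y (k, i) \<omega> * Y (k, j) \<omega>))"
proof -
  have g: "(\<lambda>v. char_cof S k v x i j * char_minor S k v y) \<in> borel_measurable (PiM ({..<k} \<times> {..<m}) (\<lambda>_. borel))"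
    by (intro borel_measurable_times char_cof_measurable char_minor_measurable assms)
  have r: "char_cof S k (restrict v ({..<k} \<times> {..<m})) x i j * char_minor S k (restrict v ({..<k} \<times> {..<m})) y
     = char_cof S k v x i j * char_minor S k v y" for v
    by (simp only: char_cof_restrict[OF assms(4)] char_minor_restrict[OF assms(4)])
  have h: "restrict v ({k} \<times> {..<m}) (k, i) * restrict v ({k} \<times> {..<m}) (k, j) = v (k, i) * v (k, j)" for v :: "nat \<times> nat \<Rightarrow> real"
    using assms by simp
  note f = expectation_row_factor[OF assms(1) g r cofac_minor_integrable[OF _ assms(4,4)]
      row_quadratic_measurable[OF assms(2,3)] h row_quadratic(2)[OF assms(1-3)]]
  show "expectation (\<lambda>\<omega>. (cofac S k x i j \<omega> * minor S k y \<omega>) * (Y (k, i) \<omega> * Y (k, j) \<omega>))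
     = expectation (\<lambda>\<omega>. cofac S k x i j \<omega> * minor S k y \<omega>) * of_bool (i = j)"
    using f(1) row_quadratic(1)[OF assms(1-3)] assms(1) by simp
  show "integrable M (\<lambda>\<omega>. (cofac S k x i j \<omega> * minor S k y \<omega>) * (Y (k, i) \<omega> * Y (k, j) \<omega>))"
    using f(2) assms(1) by simp
qed

lemma expectation_quartic_factor:
  assumes "k < n" "i < m" "j < m" "l < m" "h < m" "S \<subseteq> {..<m}"
  shows "expectation (\<lambda>\<omega>. (cofac S k x i j \<omega> * cofac S k y l h \<omega>) *
       (Y (k, i) \<omega> * Y (k, j) \<omega> * (Y (k, l) \<omega> * Y (k, h) \<omega>)))
     = expectation (\<lambda>\<omega>. cofac S k x i j \<omega> * cofac S k y l h \<omega>) *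
       (of_bool (i = j) * of_bool (l = h) + of_bool (i = l) * of_bool (j = h)
       + of_bool (i = h) * of_bool (j = l) + (b - 3) * of_bool (i = j \<and> i = l \<and> i = h))"
    and "integrable M (\<lambda>\<omega>. (cofac S k x i j \<omega> * cofac S k y l h \<omega>) *
       (Y (k, i) \<omega> * Y (k, j) \<omega> * (Y (k, l) \<omega> * Y (k, h) \<omega>)))"
proof -
  have g: "(\<lambda>v. char_cof S k v x i j * char_cof S k v y l h) \<in> borel_measurable (PiM ({..<k} \<times> {..<m}) (\<lambda>_. borel))"
    by (intro borel_measurable_times char_cof_measurable assms)
  have r: "char_cof S k (restrict v ({..<k} \<times> {..<m})) x i j * char_cof S k (restrict v ({..<k} \<times> {..<m})) y l h
     = char_cof S k v x i j * char_cof S k v y l h" for v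
    by (simp only: char_cof_restrict[OF assms(6)])
  have h: "restrict v ({k} \<times> {..<m}) (k, i) * restrict v ({k} \<times> {..<m}) (k, j) *
      (restrict v ({k} \<times> {..<m}) (k, l) * restrict v ({k} \<times> {..<m}) (k, h))
      = v (k, i) * v (k, j) * (v (k, l) * v (k, h))" for v :: "nat \<times> nat \<Rightarrow> real"
    using assms by simp
  note f = expectation_row_factor[OF assms(1) g r cofac_cofac_integrable[OF _ assms(6,6)]
      row_quartic_measurable[OF assms(2-5)] h row_quartic(2)[OF assms(1-5)]]
  show "expectation (\<lambda>\<omega>. (cofac S k x i j \<omega> * cofac S k y l h \<omega>) *
       (Y (k, i) \<omega> * Y (k, j) \<omega> * (Y (k, l) \<omega> * Y (k, h) \<omega>)))
     = expectation (\<lambda>\<omega>. cofac S k x i j \<omega> * cofac S k y l h \<omega>) *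
       (of_bool (i = j) * of_bool (l = h) + of_bool (i = l) * of_bool (j = h)
       + of_bool (i = h) * of_bool (j = l) + (b - 3) * of_bool (i = j \<and> i = l \<and> i = h))"
    using f(1) row_quartic(1)[OF assms(1-5)] assms(1) by simp
  show "integrable M (\<lambda>\<omega>. (cofac S k x i j \<omega> * cofac S k y l h \<omega>) *
       (Y (k, i) \<omega> * Y (k, j) \<omega> * (Y (k, l) \<omega> * Y (k, h) \<omega>)))"
    using f(2) assms(1) by simp
qed

lemma minor_Suc:
  assumes "S \<subseteq> {..<m}"
  shows "minor S (Suc k) z \<omega> = minor S k z \<omega> + (\<Sum>i\<in>S. \<Sum>j\<in>S. cofac S k z i j \<omega> * (Y (k, i) \<omega> * Y (k, j) \<omega>))"
proof -
  have "minor S (Suc k) z \<omega> = set_det S (\<lambda>i j. (gram (\<lambda>p. Y p \<omega>) k i j - z * of_bool (i = j)) + Y (k, i) \<omega> * Y (k, j) \<omega>)"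
    unfolding char_minor_def by (rule set_det_cong) (simp add: gram_Suc)
  then show ?thesis
    unfolding char_minor_def char_cof_def using set_det_rank_one_cof[OF finite_subset[OF assms]] by simp
qed

lemma cofac_diagonal:
  assumes "S \<subseteq> {..<m}" "i \<in> S"
  shows "cofac S k z i i \<omega> = minor (S - {i}) k z \<omega>"
  unfolding char_cof_def char_minor_def by (rule set_cof_diagonal) (use assms finite_subset in auto)

lemma cofac_sym:
  assumes "S \<subseteq> {..<m}" "i \<in> S" "j \<in> S"
  shows "cofac S k z i j \<omega> = cofac S k z j i \<omega>"
  unfolding char_cof_def
  by (rule set_cof_symmetric) (use assms finite_subset in \<open>auto simp: gram_sym[of _ _ _ i]\<close>, subst gram_sym, auto)

text \<open>Pairings within a factor contract a cofactor matrix to its trace, a sum of minors with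
  one index deleted. The two crossed pairings agree because cofactors are symmetric, which gives the
  coefficient 2.\<close>

lemma minor_corr_row_step:
  assumes "k < n" "S \<subseteq> {..<m}" "x \<noteq> y"
  shows "minor_corr (Suc k) S S x y = minor_corr k S S x y
     + (\<Sum>i\<in>S. minor_corr k (S - {i}) S x y) + (\<Sum>i\<in>S. minor_corr k S (S - {i}) x y)
     + (\<Sum>i\<in>S. \<Sum>j\<in>S. minor_corr k (S - {i}) (S - {j}) x y)
     + 2 / (x - y) * ((\<Sum>i\<in>S. minor_corr k (S - {i}) S x y) - (\<Sum>i\<in>S. minor_corr k S (S - {i}) x y))
     + (b - 3) * (\<Sum>i\<in>S. minor_corr k (S - {i}) (S - {i}) x y)"
proof -
  have fin: "finite S" using assms finite_subset by blast
  have k: "k \<le> n" using assms by simp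
  have S: "i < m" if "i \<in> S" for i using that assms by auto
  have delta: "(\<Sum>j\<in>S. f j * of_bool (i = j)) = f i" if "i \<in> S" for i and f :: "nat \<Rightarrow> real"
  proof -
    have "(\<Sum>j\<in>S. f j * of_bool (i = j)) = (\<Sum>j\<in>S. if i = j then f j else 0)"
      by (rule sum.cong) auto
    then show ?thesis using that fin by simp
  qed
  let ?A = "\<lambda>\<omega>. minor S k x \<omega> * minor S k y \<omega>"
  let ?B = "\<lambda>i j \<omega>. (cofac S k x i j \<omega> * minor S k y \<omega>) * (Y (k, i) \<omega> * Y (k, j) \<omega>)"
  let ?C = "\<lambda>i j \<omega>. (cofac S k y i j \<omega> * minor S k x \<omega>) * (Y (k, i) \<omega> * Y (k, j) \<omega>)"
  let ?D = "\<lambda>i j l h \<omega>. (cofac S k x i j \<omega> * cofac S k y l h \<omega>) *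
       (Y (k, i) \<omega> * Y (k, j) \<omega> * (Y (k, l) \<omega> * Y (k, h) \<omega>))"
  have expand: "minor S (Suc k) x \<omega> * minor S (Suc k) y \<omega> = ?A \<omega> + (\<Sum>i\<in>S. \<Sum>j\<in>S. ?B i j \<omega>)
     + (\<Sum>i\<in>S. \<Sum>j\<in>S. ?C i j \<omega>) + (\<Sum>i\<in>S. \<Sum>j\<in>S. \<Sum>l\<in>S. \<Sum>h\<in>S. ?D i j l h \<omega>)" for \<omega>
  proof -
    have "(\<Sum>i\<in>S. \<Sum>j\<in>S. cofac S k x i j \<omega> * (Y (k, i) \<omega> * Y (k, j) \<omega>)) *
        (\<Sum>l\<in>S. \<Sum>h\<in>S. cofac S k y l h \<omega> * (Y (k, l) \<omega> * Y (k, h) \<omega>))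
        = (\<Sum>i\<in>S. \<Sum>j\<in>S. \<Sum>l\<in>S. \<Sum>h\<in>S. ?D i j l h \<omega>)"
      unfolding sum_distrib_right unfolding sum_distrib_left by (intro sum.cong refl) simp
    then show ?thesis
      unfolding minor_Suc[OF assms(2)] by (simp add: algebra_simps sum_distrib_left)
  qed
  have iA: "integrable M ?A" by (rule minor_minor_integrable[OF k assms(2,2)])
  have iB: "integrable M (?B i j)" "expectation (?B i j) = expectation (\<lambda>\<omega>. cofac S k x i j \<omega> * minor S k y \<omega>) * of_bool (i = j)"
    and iC: "integrable M (?C i j)" "expectation (?C i j) = expectation (\<lambda>\<omega>. cofac S k y i j \<omega> * minor S k x \<omega>) * of_bool (i = j)"
    if "i \<in> S" "j \<in> S" for i j
    using expectation_quadratic_factor[OF assms(1) S[OF that(1)] S[OF that(2)] assms(2)] by auto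
  have iD: "integrable M (?D i j l h)" "expectation (?D i j l h) = expectation (\<lambda>\<omega>. cofac S k x i j \<omega> * cofac S k y l h \<omega>) *
       (of_bool (i = j) * of_bool (l = h) + of_bool (i = l) * of_bool (j = h)
       + of_bool (i = h) * of_bool (j = l) + (b - 3) * of_bool (i = j \<and> i = l \<and> i = h))"
    if "i \<in> S" "j \<in> S" "l \<in> S" "h \<in> S" for i j l h
    using expectation_quartic_factor[OF assms(1) S[OF that(1)] S[OF that(2)] S[OF that(3)] S[OF that(4)] assms(2)] by auto
  let ?q = "\<lambda>i j l h. expectation (\<lambda>\<omega>. cofac S k x i j \<omega> * cofac S k y l h \<omega>)"
  have "minor_corr (Suc k) S S x y = expectation ?A + (\<Sum>i\<in>S. \<Sum>j\<in>S. expectation (?B i j))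
     + (\<Sum>i\<in>S. \<Sum>j\<in>S. expectation (?C i j)) + (\<Sum>i\<in>S. \<Sum>j\<in>S. \<Sum>l\<in>S. \<Sum>h\<in>S. expectation (?D i j l h))"
    unfolding minor_corr_def expand
    using iA iB(1) iC(1) iD(1)
    by (simp add: Bochner_Integration.integral_add Bochner_Integration.integral_sum Bochner_Integration.integrable_sum
        Bochner_Integration.integrable_add)
  also have "(\<Sum>i\<in>S. \<Sum>j\<in>S. expectation (?B i j)) = (\<Sum>i\<in>S. minor_corr k (S - {i}) S x y)"
    by (rule sum.cong[OF refl]) (simp add: iB(2) delta minor_corr_def cofac_diagonal[OF assms(2)] del: of_bool_eq_iff)
  also have "(\<Sum>i\<in>S. \<Sum>j\<in>S. expectation (?C i j)) = (\<Sum>i\<in>S. minor_corr k S (S - {i}) x y)"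
  proof (rule sum.cong[OF refl])
    fix i assume i: "i \<in> S"
    then have "(\<Sum>j\<in>S. expectation (?C i j)) = expectation (\<lambda>\<omega>. cofac S k y i i \<omega> * minor S k x \<omega>)"
      by (simp add: iC(2) delta)
    also have "\<dots> = minor_corr k S (S - {i}) x y"
      using i by (simp add: minor_corr_def cofac_diagonal[OF assms(2)] mult.commute)
    finally show "(\<Sum>j\<in>S. expectation (?C i j)) = minor_corr k S (S - {i}) x y" .
  qed
  also have "(\<Sum>i\<in>S. \<Sum>j\<in>S. \<Sum>l\<in>S. \<Sum>h\<in>S. expectation (?D i j l h))
     = (\<Sum>i\<in>S. \<Sum>j\<in>S. \<Sum>l\<in>S. \<Sum>h\<in>S. ?q i j l h * (of_bool (i = j) * of_bool (l = h) + of_bool (i = l) * of_bool (j = h)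
       + of_bool (i = h) * of_bool (j = l) + (b - 3) * of_bool (i = j \<and> i = l \<and> i = h)))"
    by (intro sum.cong refl iD(2))
  also have "\<dots> = (\<Sum>i\<in>S. \<Sum>l\<in>S. ?q i i l l) + (\<Sum>i\<in>S. \<Sum>j\<in>S. ?q i j i j) + (\<Sum>i\<in>S. \<Sum>j\<in>S. ?q i j j i)
     + (b - 3) * (\<Sum>i\<in>S. ?q i i i i)"
    by (rule sum_delta_kronecker[OF fin])
  also have "(\<Sum>i\<in>S. \<Sum>j\<in>S. ?q i j j i) = (\<Sum>i\<in>S. \<Sum>j\<in>S. ?q i j i j)"
    by (intro sum.cong refl) (simp add: cofac_sym[OF assms(2)])
  also have "(\<Sum>i\<in>S. \<Sum>l\<in>S. ?q i i l l) = (\<Sum>i\<in>S. \<Sum>j\<in>S. minor_corr k (S - {i}) (S - {j}) x y)"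
    by (intro sum.cong refl) (simp add: minor_corr_def cofac_diagonal[OF assms(2)])
  also have "(\<Sum>i\<in>S. ?q i i i i) = (\<Sum>i\<in>S. minor_corr k (S - {i}) (S - {i}) x y)"
    by (intro sum.cong refl) (simp add: minor_corr_def cofac_diagonal[OF assms(2)])
  also have "(\<Sum>i\<in>S. \<Sum>j\<in>S. ?q i j i j)
     = ((\<Sum>i\<in>S. minor_corr k (S - {i}) S x y) - (\<Sum>i\<in>S. minor_corr k S (S - {i}) x y)) / (x - y)"
  proof -
    \<comment> \<open>The resolvent identity is used pointwise in this product form; the division by
      \<open>x - y\<close> happens only after taking expectations.\<close>
    have res: "(x - y) * (\<Sum>i\<in>S. \<Sum>j\<in>S. cofac S k x i j \<omega> * cofac S k y i j \<omega>)
       = (\<Sum>i\<in>S. minor (S - {i}) k x \<omega> * minor S k y \<omega>) - (\<Sum>i\<in>S. minor S k x \<omega> * minor (S - {i}) k y \<omega>)" for \<omega>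
      using set_cof_resolvent[OF fin, of "gram (\<lambda>p. Y p \<omega>) k", OF gram_sym refl refl, of x y]
      by (simp add: char_cof_def[symmetric] char_minor_def[symmetric] cofac_diagonal[OF assms(2)]
          sum_distrib_left mult_ac)
    have "(x - y) * (\<Sum>i\<in>S. \<Sum>j\<in>S. ?q i j i j)
       = expectation (\<lambda>\<omega>. (x - y) * (\<Sum>i\<in>S. \<Sum>j\<in>S. cofac S k x i j \<omega> * cofac S k y i j \<omega>))"
      using cofac_cofac_integrable[OF k assms(2,2)]
      by (simp add: Bochner_Integration.integral_sum Bochner_Integration.integrable_sum)
    also have "\<dots> = (\<Sum>i\<in>S. minor_corr k (S - {i}) S x y) - (\<Sum>i\<in>S. minor_corr k S (S - {i}) x y)"
    proof -
      have d: "S - {i} \<subseteq> {..<m}" for i using assms(2) by auto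
      show ?thesis
        unfolding res minor_corr_def
        using minor_minor_integrable[OF k d assms(2)] minor_minor_integrable[OF k assms(2) d]
        by (simp add: Bochner_Integration.integral_sum Bochner_Integration.integrable_sum Bochner_Integration.integral_diff)
    qed
    finally show ?thesis using assms(3) by (simp add: field_simps)
  qed
  also have "expectation ?A = minor_corr k S S x y" by (simp add: minor_corr_def)
  finally show ?thesis by (simp add: algebra_simps diff_divide_distrib)
qed

section \<open>Spectral derivatives of correlations\<close>

text \<open>As a polynomial in \<open>x\<close> and \<open>y\<close> with expectations as
  coefficients, the correlation can be differentiated without interchanging derivative and
  expectation.\<close>

lemma minor_corr_expand:
  assumes "k \<le> n" "S \<subseteq> {..<m}" "T \<subseteq> {..<m}"
  shows "minor_corr k S T x y
    = (\<Sum>U\<in>Pow S. \<Sum>V\<in>Pow T. (- x) ^ card (S - U) * ((- y) ^ card (T - V) * gram_minor_corr k U V))"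
proof -
  have fin: "finite S" "finite T" using assms finite_subset by blast+
  have int: "integrable M (\<lambda>\<omega>. set_det U (gram (\<lambda>p. Y p \<omega>) k) * set_det V (gram (\<lambda>p. Y p \<omega>) k))"
    if "U \<in> Pow S" "V \<in> Pow T" for U V
    using minor_minor_integrable[OF assms(1), of U V 0 0] that assms by (auto simp: char_minor_def)
  have "minor_corr k S T x y = expectation (\<lambda>\<omega>. \<Sum>U\<in>Pow S. \<Sum>V\<in>Pow T. (- x) ^ card (S - U) * ((- y) ^ card (T - V) *
     (set_det U (gram (\<lambda>p. Y p \<omega>) k) * set_det V (gram (\<lambda>p. Y p \<omega>) k))))"
    unfolding minor_corr_def char_minor_expand[OF fin(1)] char_minor_expand[OF fin(2)]
    by (simp add: sum_product mult_ac)
  also have "\<dots> = (\<Sum>U\<in>Pow S. expectation (\<lambda>\<omega>. \<Sum>V\<in>Pow T. (- x) ^ card (S - U) * ((- y) ^ card (T - V) *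
     (set_det U (gram (\<lambda>p. Y p \<omega>) k) * set_det V (gram (\<lambda>p. Y p \<omega>) k)))))"
    by (intro Bochner_Integration.integral_sum Bochner_Integration.integrable_sum integrable_mult_right int)
  also have "\<dots> = (\<Sum>U\<in>Pow S. \<Sum>V\<in>Pow T. (- x) ^ card (S - U) * ((- y) ^ card (T - V) * gram_minor_corr k U V))"
  proof (rule sum.cong[OF refl])
    fix U assume U: "U \<in> Pow S"
    have "expectation (\<lambda>\<omega>. \<Sum>V\<in>Pow T. (- x) ^ card (S - U) * ((- y) ^ card (T - V) *
         (set_det U (gram (\<lambda>p. Y p \<omega>) k) * set_det V (gram (\<lambda>p. Y p \<omega>) k))))
       = (\<Sum>V\<in>Pow T. expectation (\<lambda>\<omega>. (- x) ^ card (S - U) * ((- y) ^ card (T - V) *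
         (set_det U (gram (\<lambda>p. Y p \<omega>) k) * set_det V (gram (\<lambda>p. Y p \<omega>) k)))))"
      by (intro Bochner_Integration.integral_sum integrable_mult_right int U)
    then show "expectation (\<lambda>\<omega>. \<Sum>V\<in>Pow T. (- x) ^ card (S - U) * ((- y) ^ card (T - V) *
         (set_det U (gram (\<lambda>p. Y p \<omega>) k) * set_det V (gram (\<lambda>p. Y p \<omega>) k))))
       = (\<Sum>V\<in>Pow T. (- x) ^ card (S - U) * ((- y) ^ card (T - V) * gram_minor_corr k U V))"
      by (simp add: gram_minor_corr_def)
  qed
  finally show ?thesis .
qed

text \<open>Double counting: \<open>U\<close> survives the deletion of \<open>i\<close> exactly if
  \<open>i\<close> lies in \<open>S - U\<close>. This matches the power rule for
  \<open>(- x) ^ card (S - U)\<close>, so that deleting indices is differentiation up to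
  sign.\<close>

lemma sum_Pow_remove:
  fixes c :: "nat set \<Rightarrow> real"
  assumes "finite S"
  shows "(\<Sum>i\<in>S. \<Sum>U\<in>Pow (S - {i}). (- x) ^ card (S - {i} - U) * c U)
    = (\<Sum>U\<in>Pow S. real (card (S - U)) * (- x) ^ (card (S - U) - 1) * c U)"
proof -
  have "(\<Sum>i\<in>S. \<Sum>U\<in>Pow (S - {i}). (- x) ^ card (S - {i} - U) * c U)
      = (\<Sum>i\<in>S. \<Sum>U | U \<in> Pow S \<and> i \<notin> U. (- x) ^ (card (S - U) - 1) * c U)"
  proof (intro sum.cong refl)
    fix i U assume iU: "i \<in> S" "U \<in> {U. U \<in> Pow S \<and> i \<notin> U}"
    have "S - {i} - U = (S - U) - {i}" by auto
    then show "(- x) ^ card (S - {i} - U) * c U = (- x) ^ (card (S - U) - 1) * c U"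
      using iU assms by (simp add: card_Diff_singleton)
  qed auto
  also have "\<dots> = (\<Sum>U\<in>Pow S. \<Sum>i | i \<in> S \<and> i \<notin> U. (- x) ^ (card (S - U) - 1) * c U)"
    using assms by (intro sum.swap_restrict) auto
  also have "\<dots> = (\<Sum>U\<in>Pow S. real (card (S - U)) * (- x) ^ (card (S - U) - 1) * c U)"
    by (intro sum.cong refl) (simp add: set_diff_eq)
  finally show ?thesis .
qed

lemma minor_corr_has_dx:
  assumes "k \<le> n" "S \<subseteq> {..<m}" "T \<subseteq> {..<m}"
  shows "((\<lambda>x. minor_corr k S T x y) has_real_derivative - (\<Sum>i\<in>S. minor_corr k (S - {i}) T x y)) (at x)"
proof -
  have fin: "finite S" "finite T" using assms finite_subset by blast+
  have d: "S - {i} \<subseteq> {..<m}" for i using assms(2) by auto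
  define c where "c U = (\<Sum>V\<in>Pow T. (- y) ^ card (T - V) * gram_minor_corr k U V)" for U
  have e: "minor_corr k S T x y = (\<Sum>U\<in>Pow S. (- x) ^ card (S - U) * c U)" for x
    unfolding minor_corr_expand[OF assms] c_def sum_distrib_left ..
  have e': "(\<Sum>i\<in>S. minor_corr k (S - {i}) T x y) = (\<Sum>U\<in>Pow S. real (card (S - U)) * (- x) ^ (card (S - U) - 1) * c U)"
    unfolding sum_Pow_remove[OF fin(1), of x c, symmetric]
    unfolding minor_corr_expand[OF assms(1) d assms(3)] c_def sum_distrib_left ..
  show ?thesis
    unfolding e e' by (auto intro!: derivative_eq_intros sum.cong simp: sum_negf[symmetric])
qed

lemma minor_corr_has_dy:
  assumes "k \<le> n" "S \<subseteq> {..<m}" "T \<subseteq> {..<m}"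
  shows "((\<lambda>y. minor_corr k S T x y) has_real_derivative - (\<Sum>i\<in>T. minor_corr k S (T - {i}) x y)) (at y)"
proof -
  have "minor_corr k S T x y = minor_corr k T S y x" for S T x y
    by (simp add: minor_corr_def mult.commute)
  then show ?thesis using minor_corr_has_dx[OF assms(1,3,2)] by simp
qed

end

subsection \<open>The differentiated Christoffel-Darboux kernel\<close>

text \<open>\<open>alt_kernel p q\<close> is the result of applying the operator \<open>(\<partial>\<^sub>x - \<partial>\<^sub>y) / (x - y)\<close> to
  \<open>(p(x) q(y) - q(x) p(y)) / (x - y)\<close>.\<close>

definition alt_kernel :: "real poly \<Rightarrow> real poly \<Rightarrow> real \<Rightarrow> real \<Rightarrow> real" where
  "alt_kernel p q x y =
     (poly (pderiv p) x * poly q y - poly p x * poly (pderiv q) y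
      - poly (pderiv q) x * poly p y + poly q x * poly (pderiv p) y) / (x - y) ^ 2
     - 2 * (poly p x * poly q y - poly q x * poly p y) / (x - y) ^ 3"

definition alt_kernel_dx :: "real poly \<Rightarrow> real poly \<Rightarrow> real \<Rightarrow> real \<Rightarrow> real" where
  "alt_kernel_dx p q x y =
     (poly (pderiv (pderiv p)) x * poly q y - poly (pderiv p) x * poly (pderiv q) y
      - poly (pderiv (pderiv q)) x * poly p y + poly (pderiv q) x * poly (pderiv p) y) / (x - y) ^ 2
     - 2 * (poly (pderiv p) x * poly q y - poly p x * poly (pderiv q) y
      - poly (pderiv q) x * poly p y + poly q x * poly (pderiv p) y) / (x - y) ^ 3
     - 2 * (poly (pderiv p) x * poly q y - poly (pderiv q) x * poly p y) / (x - y) ^ 3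
     + 6 * (poly p x * poly q y - poly q x * poly p y) / (x - y) ^ 4"

definition alt_kernel_dxy :: "real poly \<Rightarrow> real poly \<Rightarrow> real \<Rightarrow> real \<Rightarrow> real" where
  "alt_kernel_dxy p q x y =
     (poly (pderiv (pderiv p)) x * poly (pderiv q) y - poly (pderiv p) x * poly (pderiv (pderiv q)) y
      - poly (pderiv (pderiv q)) x * poly (pderiv p) y + poly (pderiv q) x * poly (pderiv (pderiv p)) y) / (x - y) ^ 2
     + 2 * (poly (pderiv (pderiv p)) x * poly q y - poly (pderiv p) x * poly (pderiv q) y
      - poly (pderiv (pderiv q)) x * poly p y + poly (pderiv q) x * poly (pderiv p) y) / (x - y) ^ 3
     - 2 * (poly (pderiv p) x * poly (pderiv q) y - poly p x * poly (pderiv (pderiv q)) y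
      - poly (pderiv q) x * poly (pderiv p) y + poly q x * poly (pderiv (pderiv p)) y) / (x - y) ^ 3
     - 6 * (poly (pderiv p) x * poly q y - poly p x * poly (pderiv q) y
      - poly (pderiv q) x * poly p y + poly q x * poly (pderiv p) y) / (x - y) ^ 4
     - 2 * (poly (pderiv p) x * poly (pderiv q) y - poly (pderiv q) x * poly (pderiv p) y) / (x - y) ^ 3
     - 6 * (poly (pderiv p) x * poly q y - poly (pderiv q) x * poly p y) / (x - y) ^ 4
     + 6 * (poly p x * poly (pderiv q) y - poly q x * poly (pderiv p) y) / (x - y) ^ 4
     + 24 * (poly p x * poly q y - poly q x * poly p y) / (x - y) ^ 5"

lemma DERIV_divide_diff_power_left:
  fixes x y :: real
  assumes "x \<noteq> y" and that: "(N has_real_derivative N') (at x)"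
  shows "((\<lambda>x. N x / (x - y) ^ Suc n) has_real_derivative
     N' / (x - y) ^ Suc n - real (Suc n) * N x / (x - y) ^ Suc (Suc n)) (at x)"
proof -
  have "x - y \<noteq> 0" using assms by simp
  then have "((\<lambda>x. inverse (x - y)) has_real_derivative - (inverse (x - y))\<^sup>2) (at x)"
    by (auto intro!: derivative_eq_intros simp: power2_eq_square)
  from DERIV_mult[OF that DERIV_power_Suc[OF this, of n]]
  have "((\<lambda>x. N x * inverse (x - y) ^ Suc n) has_real_derivative
      N' * inverse (x - y) ^ Suc n - real (Suc n) * N x * inverse (x - y) ^ Suc (Suc n)) (at x)"
    by (rule DERIV_cong) (simp add: power2_eq_square algebra_simps)
  then show ?thesis by (simp only: divide_inverse power_inverse)
qed

lemma alt_kernel_has_dx: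
  assumes "x \<noteq> y"
  shows "((\<lambda>x. alt_kernel p q x y) has_real_derivative alt_kernel_dx p q x y) (at x)"
proof -
  have d2: "((\<lambda>x. N x / (x - y) ^ 2) has_real_derivative N' / (x - y) ^ 2 - 2 * N x / (x - y) ^ 3) (at x)"
    and d3: "((\<lambda>x. N x / (x - y) ^ 3) has_real_derivative N' / (x - y) ^ 3 - 3 * N x / (x - y) ^ 4) (at x)"
    if "(N has_real_derivative N') (at x)" for N N'
    using DERIV_divide_diff_power_left[OF assms that, of 1] DERIV_divide_diff_power_left[OF assms that, of 2]
    by (simp_all add: numeral_eq_Suc)
  show ?thesis
    unfolding alt_kernel_def
    by (rule derivative_eq_intros d2 d3 poly_DERIV refl)+
       (simp add: alt_kernel_dx_def diff_divide_distrib add_divide_distrib algebra_simps)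
qed

lemma DERIV_divide_diff_power_right:
  fixes x y :: real
  assumes "x \<noteq> y" and that: "(N has_real_derivative N') (at y)"
  shows "((\<lambda>y. N y / (x - y) ^ Suc n) has_real_derivative
     N' / (x - y) ^ Suc n + real (Suc n) * N y / (x - y) ^ Suc (Suc n)) (at y)"
proof -
  have "x - y \<noteq> 0" using assms by simp
  then have "((\<lambda>y. inverse (x - y)) has_real_derivative  (inverse (x - y))\<^sup>2) (at y)"
    by (auto intro!: derivative_eq_intros simp: power2_eq_square)
  from DERIV_mult[OF that DERIV_power_Suc[OF this, of n]]
  have "((\<lambda>y. N y * inverse (x - y) ^ Suc n) has_real_derivative
      N' * inverse (x - y) ^ Suc n + real (Suc n) * N y * inverse (x - y) ^ Suc (Suc n)) (at y)"
    by (rule DERIV_cong) (simp add: power2_eq_square algebra_simps)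
  then show ?thesis by (simp only: divide_inverse power_inverse)
qed

lemma alt_kernel_has_dxy:
  assumes "x \<noteq> y"
  shows "((\<lambda>y. alt_kernel_dx p q x y) has_real_derivative alt_kernel_dxy p q x y) (at y)"
proof -
  have d2: "((\<lambda>y. N y / (x - y) ^ 2) has_real_derivative N' / (x - y) ^ 2 + 2 * N y / (x - y) ^ 3) (at y)"
    and d3: "((\<lambda>y. N y / (x - y) ^ 3) has_real_derivative N' / (x - y) ^ 3 + 3 * N y / (x - y) ^ 4) (at y)"
    and d4: "((\<lambda>y. N y / (x - y) ^ 4) has_real_derivative N' / (x - y) ^ 4 + 4 * N y / (x - y) ^ 5) (at y)"
    if "(N has_real_derivative N') (at y)" for N N'
    using DERIV_divide_diff_power_right[OF assms that, of 1] DERIV_divide_diff_power_right[OF assms that, of 2]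
      DERIV_divide_diff_power_right[OF assms that, of 3]
    by (simp_all add: numeral_eq_Suc)
  show ?thesis
    unfolding alt_kernel_dx_def
    by (rule derivative_eq_intros d2 d3 d4 poly_DERIV refl)+
       (simp add: alt_kernel_dxy_def diff_divide_distrib add_divide_distrib algebra_simps)
qed

text \<open>The transition operator of the recursion in the number of rows is intertwined with
  \<open>(1 - \<partial>\<^sub>x) (1 - \<partial>\<^sub>y)\<close>; in the variable \<open>x - y\<close> this is the reduction of the radial Laplacian in
  dimension five to the second derivative in dimension one.\<close>

lemma alt_kernel_step:
  assumes "x \<noteq> y"
  shows "alt_kernel p q x y - alt_kernel_dx p q x y - alt_kernel_dx p q y x + alt_kernel_dxy p q x y
     - 2 / (x - y) * (alt_kernel_dx p q x y - alt_kernel_dx p q y x)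
     = alt_kernel (p - pderiv p) (q - pderiv q) x y"
proof -
  define d where "d = x - y"
  have d: "d \<noteq> 0" "x - y = d" "y - x = - d" using assms by (auto simp: d_def)
  show ?thesis
    unfolding alt_kernel_def alt_kernel_dx_def alt_kernel_dxy_def d poly_diff pderiv_diff
    using d(1) by (simp add: field_simps power_numeral_reduce)
qed

section \<open>Laguerre type polynomials and the Gaussian solution\<close>

primrec shift_poly :: "nat \<Rightarrow> nat \<Rightarrow> real poly" where
  "shift_poly 0 k = monom 1 k"
| "shift_poly (Suc n) k = shift_poly n k - pderiv (shift_poly n k)"

text \<open>The binomial expansion of the \<open>n\<close>-th power of 1 - d/dx, proved through
  Pascal's rule.\<close>

lemma coeff_shift_poly:
  "coeff (shift_poly n k) j =
     (if j \<le> k then real (n choose (k - j)) * (- 1) ^ (k - j) * fact k / fact j else 0)"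
proof (induction n arbitrary: j)
  case 0
  then show ?case by (auto simp: binomial_eq_0)
next
  case (Suc n)
  show ?case
  proof (cases "j < k")
    case True
    then obtain r where r: "k - j = Suc r" "k - Suc j = r" "Suc j \<le> k" "j \<le> k" by (metis Suc_diff_Suc Suc_leI less_imp_le)
    show ?thesis
    proof -
      have f: "real (Suc j) * (c / fact (Suc j)) = c / fact j" for c
        by (simp del: of_nat_Suc)
      have "coeff (shift_poly (Suc n) k) j = real (n choose Suc r) * (- 1) ^ Suc r * fact k / fact j
         - real (Suc j) * (real (n choose r) * (- 1) ^ r * fact k / fact (Suc j))"
        unfolding shift_poly.simps coeff_diff coeff_pderiv Suc.IH using r by simp
      also have "\<dots> = real (Suc n choose Suc r) * (- 1) ^ Suc r * fact k / fact j"
        unfolding f by (simp add: algebra_simps diff_divide_distrib add_divide_distrib)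
      finally show ?thesis using r by simp
    qed
  next
    case False
    then show ?thesis
      unfolding shift_poly.simps coeff_diff coeff_pderiv Suc.IH by auto
  qed
qed

lemma degree_shift_poly: "degree (shift_poly n k) \<le> k"
  by (rule degree_le) (auto simp: coeff_shift_poly)

text \<open>For \<open>n = 0\<close> the antisymmetric polynomial divided by \<open>x - y\<close> is
  \<open>(x * y) ^ (m + 1)\<close>, which (d/dx - d/dy) / (x - y) sends to
  \<open>- (m + 1) * (x * y) ^ m\<close>: hence the sign and the denominator.\<close>

definition gauss_corr :: "nat \<Rightarrow> nat \<Rightarrow> real \<Rightarrow> real \<Rightarrow> real" where
  "gauss_corr n m x y = - alt_kernel (shift_poly n (m + 2)) (shift_poly n (m + 1)) x y / real (m + 1)"

lemma gauss_corr_0: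
  assumes "x \<noteq> y"
  shows "gauss_corr 0 m x y = (x * y) ^ m"
proof -
  define d where "d = x - y"
  have d: "d \<noteq> 0" "x = y + d" "x - y = d" using assms by (auto simp: d_def)
  have "real (m + 1) * gauss_corr 0 m x y = real (m + 1) * (x * y) ^ m"
  proof -
    have "- alt_kernel (shift_poly 0 (m + 2)) (shift_poly 0 (m + 1)) x y = real (m + 1) * (x * y) ^ m"
      unfolding alt_kernel_def d(3) using d(1)
      by (simp add: pderiv_monom poly_monom power_mult_distrib divide_simps power2_eq_square power3_eq_cube)
         (simp add: d(2) algebra_simps)
    then show ?thesis by (simp add: gauss_corr_def)
  qed
  then show ?thesis by simp
qed

text \<open>Polynomial forms of \<open>(x\<^sup>p y\<^sup>q - x\<^sup>q y\<^sup>p) / (x - y)\<close> and of the kernel of two monomials, which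
  make sense on the diagonal \<open>x = y\<close> as well.\<close>

fun alt_quot :: "real \<Rightarrow> real \<Rightarrow> nat \<Rightarrow> nat \<Rightarrow> real" where
  "alt_quot x y 0 0 = 0"
| "alt_quot x y (Suc 0) 0 = 1"
| "alt_quot x y (Suc (Suc p)) 0 = (x + y) * alt_quot x y (Suc p) 0 - x * y * alt_quot x y p 0"
| "alt_quot x y 0 (Suc q) = - alt_quot x y (Suc q) 0"
| "alt_quot x y (Suc p) (Suc q) = x * y * alt_quot x y p q"

fun alt_mono :: "real \<Rightarrow> real \<Rightarrow> nat \<Rightarrow> nat \<Rightarrow> real" where
  "alt_mono x y 0 0 = 0"
| "alt_mono x y (Suc 0) 0 = 0"
| "alt_mono x y (Suc (Suc p)) 0 = (x + y) * alt_mono x y (Suc p) 0 - x * y * alt_mono x y p 0 + alt_quot x y p 0"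
| "alt_mono x y 0 (Suc q) = - alt_mono x y (Suc q) 0"
| "alt_mono x y (Suc p) (Suc q) = x * y * alt_mono x y p q - alt_quot x y p q"

lemma alt_induct [case_names zero one step flip diag]:
  assumes "P 0 0" "P (Suc 0) 0"
    and "\<And>p. P (Suc p) 0 \<Longrightarrow> P p 0 \<Longrightarrow> P (Suc (Suc p)) 0"
    and "\<And>q. P (Suc q) 0 \<Longrightarrow> P 0 (Suc q)"
    and "\<And>p q. P p q \<Longrightarrow> P (Suc p) (Suc q)"
  shows "P p q"
  using assms by (rule alt_quot.induct[where P = "\<lambda>_ _. P"])

text \<open>The three-term recursion expresses that \<open>x\<close> and \<open>y\<close> are the
  roots of t^2 - (x + y) t + x y.\<close>

lemma alt_quot_eq:
  assumes "x \<noteq> y"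
  shows "alt_quot x y p q = (x ^ p * y ^ q - x ^ q * y ^ p) / (x - y)"
proof (induction p q rule: alt_induct)
  case (step p)
  show ?case unfolding alt_quot.simps step using assms by (simp add: divide_simps) (simp add: algebra_simps)
next
  case (diag p q)
  show ?case unfolding alt_quot.simps diag by (simp add: algebra_simps)
qed (use assms in \<open>simp_all add: divide_simps\<close>)

text \<open>The degrees are \<open>p + q - 1\<close> and \<open>p + q - 3\<close>. The power of
  \<open>N\<close> stands on the left so that no truncated exponent arises for small
  \<open>p + q\<close>.\<close>

lemma alt_mono_homogeneous:
  assumes "N \<noteq> 0"
  shows "N ^ (p + q) * alt_quot (x / N) (y / N) p q = N * alt_quot x y p q"
    and "N ^ (p + q) * alt_mono (x / N) (y / N) p q = N ^ 3 * alt_mono x y p q"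
proof -
  show quot: "N ^ (p + q) * alt_quot (x / N) (y / N) p q = N * alt_quot x y p q" for p q
  proof (induction p q rule: alt_induct)
    case (step p)
    have "N ^ (Suc (Suc p) + 0) * alt_quot (x / N) (y / N) (Suc (Suc p)) 0
      = (x + y) * (N ^ (Suc p + 0) * alt_quot (x / N) (y / N) (Suc p) 0) - x * y * (N ^ (p + 0) * alt_quot (x / N) (y / N) p 0)"
      using assms by (simp add: field_simps)
    then show ?case unfolding alt_quot.simps step by (simp add: algebra_simps)
  next
    case (diag p q)
    have "N ^ (Suc p + Suc q) * alt_quot (x / N) (y / N) (Suc p) (Suc q)
      = x * y * (N ^ (p + q) * alt_quot (x / N) (y / N) p q)"
      using assms by (simp add: field_simps)
    then show ?case unfolding alt_quot.simps diag by simp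
  qed simp_all
  show "N ^ (p + q) * alt_mono (x / N) (y / N) p q = N ^ 3 * alt_mono x y p q"
  proof (induction p q rule: alt_induct)
    case (step p)
    have "N ^ (Suc (Suc p) + 0) * alt_mono (x / N) (y / N) (Suc (Suc p)) 0
      = (x + y) * (N ^ (Suc p + 0) * alt_mono (x / N) (y / N) (Suc p) 0) - x * y * (N ^ (p + 0) * alt_mono (x / N) (y / N) p 0)
        + N ^ 2 * (N ^ (p + 0) * alt_quot (x / N) (y / N) p 0)"
      using assms by (simp add: field_simps power2_eq_square)
    then show ?case unfolding alt_mono.simps step quot by (simp add: algebra_simps power2_eq_square power3_eq_cube)
  next
    case (diag p q)
    have "N ^ (Suc p + Suc q) * alt_mono (x / N) (y / N) (Suc p) (Suc q)
      = x * y * (N ^ (p + q) * alt_mono (x / N) (y / N) p q) - N ^ 2 * (N ^ (p + q) * alt_quot (x / N) (y / N) p q)"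
      using assms by (simp add: field_simps power2_eq_square)
    then show ?case unfolding alt_mono.simps diag quot by (simp add: algebra_simps power2_eq_square power3_eq_cube)
  qed simp_all
qed

lemma alt_mono_bounds:
  assumes "\<bar>x\<bar> \<le> R" "\<bar>y\<bar> \<le> R" "1 \<le> R"
  shows "\<bar>alt_quot x y p q\<bar> \<le> (4 * R) ^ (p + q)" and "\<bar>alt_mono x y p q\<bar> \<le> (4 * R) ^ (p + q)"
proof -
  let ?W = "4 * R"
  have s: "\<bar>x + y\<bar> \<le> ?W / 2" using assms by linarith
  have xy: "\<bar>x * y\<bar> \<le> ?W\<^sup>2 / 16"
    using mult_mono[of "\<bar>x\<bar>" R "\<bar>y\<bar>" R] assms by (simp add: abs_mult power2_eq_square)
  have W: "4 \<le> ?W" "0 \<le> ?W" using assms by auto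
  have W2: "16 \<le> ?W\<^sup>2" using power_mono[OF W(1), of 2] by simp
  \<comment> \<open>The three terms take at most 1/2, 1/16 and 1/16 of
    \<open>?W\<^sup>2 * ?W ^ r\<close>; this is why the base is \<open>4 * R\<close>.\<close>
  have three: "\<bar>(x + y) * a - x * y * c + d\<bar> \<le> ?W ^ (r + 2)"
    if "\<bar>a\<bar> \<le> ?W ^ (r + 1)" "\<bar>c\<bar> \<le> ?W ^ r" "\<bar>d\<bar> \<le> ?W ^ r" for a c d r
  proof -
    have p: "0 \<le> ?W ^ r" using W by simp
    have "\<bar>(x + y) * a\<bar> \<le> ?W / 2 * ?W ^ (r + 1)" unfolding abs_mult
      by (rule mult_mono) (use s that W in auto)
    moreover have "\<bar>x * y * c\<bar> \<le> ?W\<^sup>2 / 16 * ?W ^ r" unfolding abs_mult[of "x * y"]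
      by (rule mult_mono) (use xy that W in auto)
    moreover have "16 * ?W ^ r \<le> ?W\<^sup>2 * ?W ^ r" using W2 p by (rule mult_right_mono)
    moreover have "?W ^ (r + 2) = ?W\<^sup>2 * ?W ^ r" "?W / 2 * ?W ^ (r + 1) = ?W\<^sup>2 * ?W ^ r / 2"
      by (simp_all add: power2_eq_square)
    moreover have "0 \<le> ?W\<^sup>2 * ?W ^ r" using p by simp
    ultimately show ?thesis using that by linarith
  qed
  have two: "\<bar>x * y * c + d\<bar> \<le> ?W ^ (r + 2)" if "\<bar>c\<bar> \<le> ?W ^ r" "\<bar>d\<bar> \<le> ?W ^ r" for c d r
    using three[of 0 r "- c" d] that W by simp
  show quot: "\<bar>alt_quot x y p q\<bar> \<le> ?W ^ (p + q)" for p q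
  proof (induction p q rule: alt_induct)
    case (step p)
    then show ?case using three[of "alt_quot x y (Suc p) 0" p "alt_quot x y p 0" 0] W by simp
  next
    case (diag p q)
    then show ?case using two[of "alt_quot x y p q" "p + q" 0] W by simp
  qed (use assms in simp_all)
  show "\<bar>alt_mono x y p q\<bar> \<le> ?W ^ (p + q)"
  proof (induction p q rule: alt_induct)
    case (step p)
    then show ?case using three[of "alt_mono x y (Suc p) 0" p "alt_mono x y p 0" "alt_quot x y p 0"]
      quot[of p 0] by simp
  next
    case (diag p q)
    then show ?case using two[of "alt_mono x y p q" "p + q" "- alt_quot x y p q"] quot[of p q] by simp
  qed (use assms in simp_all)
qed

lemma poly_pderiv_monom_Suc:
  "poly (pderiv (monom (1::real) (Suc p))) x = x ^ p + x * poly (pderiv (monom 1 p)) x"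
  by (cases p) (simp_all add: pderiv_monom poly_monom algebra_simps)

text \<open>The operator (d/dx - d/dy) / (x - y) is a derivation that kills \<open>x + y\<close> and
  sends \<open>x * y\<close> to -1. Applied to the recursion of \<open>alt_quot\<close>, it yields
  that of \<open>alt_mono\<close> with its additional \<open>alt_quot\<close> terms.\<close>

lemma alt_mono_eq:
  assumes "x \<noteq> y"
  shows "alt_mono x y p q = alt_kernel (monom 1 p) (monom 1 q) x y"
proof (induction p q rule: alt_induct)
  case (step p)
  define d where "d = x - y"
  have d: "d \<noteq> 0" "x = y + d" "x - y = d" using assms by (auto simp: d_def)
  define X X' Y Y' where "X = x ^ p" and "X' = poly (pderiv (monom 1 p)) x"
    and "Y = y ^ p" and "Y' = poly (pderiv (monom 1 p)) y"
  note defs = X_def[symmetric] X'_def[symmetric] Y_def[symmetric] Y'_def[symmetric]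
  show ?case
    unfolding alt_mono.simps step alt_quot_eq[OF assms] alt_kernel_def
      poly_pderiv_monom_Suc poly_monom mult_1 power_Suc defs d(3)
    using d(1) by (simp add: pderiv_monom field_simps power2_eq_square power3_eq_cube)
      (simp add: d(2) algebra_simps)
next
  case (diag p q)
  define d where "d = x - y"
  have d: "d \<noteq> 0" "x = y + d" "x - y = d" using assms by (auto simp: d_def)
  define X X' Y Y' where "X = x ^ p" and "X' = poly (pderiv (monom 1 p)) x"
    and "Y = y ^ p" and "Y' = poly (pderiv (monom 1 p)) y"
  define P P' R R' where "P = x ^ q" and "P' = poly (pderiv (monom 1 q)) x"
    and "R = y ^ q" and "R' = poly (pderiv (monom 1 q)) y"
  note defs = X_def[symmetric] X'_def[symmetric] Y_def[symmetric] Y'_def[symmetric]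
    P_def[symmetric] P'_def[symmetric] R_def[symmetric] R'_def[symmetric]
  show ?case
    unfolding alt_mono.simps diag alt_quot_eq[OF assms] alt_kernel_def
      poly_pderiv_monom_Suc poly_monom mult_1 power_Suc defs d(3)
    using d(1) by (simp add: field_simps power2_eq_square power3_eq_cube)
      (simp add: d(2) algebra_simps)
next
  case (flip q)
  show ?case unfolding alt_mono.simps flip
    by (simp add: alt_kernel_def poly_monom diff_divide_distrib add_divide_distrib algebra_simps)
next
  case one
  have "2 / d\<^sup>2 = 2 * d / d ^ 3" if "d \<noteq> 0" for d :: real
    using that by (simp add: power2_eq_square power3_eq_cube)
  from this[of "x - y"] show ?case using assms
    by (simp add: alt_kernel_def pderiv_monom poly_monom)
qed (simp_all add: alt_kernel_def pderiv_monom poly_monom)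

lemma tendsto_alt_mono:
  assumes "(f \<longlongrightarrow> x) F" "(g \<longlongrightarrow> y) F"
  shows "((\<lambda>i. alt_quot (f i) (g i) p q) \<longlongrightarrow> alt_quot x y p q) F"
    and "((\<lambda>i. alt_mono (f i) (g i) p q) \<longlongrightarrow> alt_mono x y p q) F"
proof -
  show quot: "((\<lambda>i. alt_quot (f i) (g i) p q) \<longlongrightarrow> alt_quot x y p q) F" for p q
    using assms by (induction p q rule: alt_induct) (auto intro!: tendsto_intros)
  show "((\<lambda>i. alt_mono (f i) (g i) p q) \<longlongrightarrow> alt_mono x y p q) F"
    using quot assms by (induction p q rule: alt_induct) (auto intro!: tendsto_intros)
qed

subsection \<open>Solution of the recursion\<close>

definition gauss_corr_dx :: "nat \<Rightarrow> nat \<Rightarrow> real \<Rightarrow> real \<Rightarrow> real" where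
  "gauss_corr_dx n m x y = - alt_kernel_dx (shift_poly n (m + 2)) (shift_poly n (m + 1)) x y / real (m + 1)"

definition gauss_corr_dxy :: "nat \<Rightarrow> nat \<Rightarrow> real \<Rightarrow> real \<Rightarrow> real" where
  "gauss_corr_dxy n m x y = - alt_kernel_dxy (shift_poly n (m + 2)) (shift_poly n (m + 1)) x y / real (m + 1)"

lemma gauss_corr_has_dx:
  "x \<noteq> y \<Longrightarrow> ((\<lambda>x. gauss_corr n m x y) has_real_derivative gauss_corr_dx n m x y) (at x)"
  unfolding gauss_corr_def gauss_corr_dx_def
  by (intro DERIV_cdivide DERIV_minus alt_kernel_has_dx)

lemma gauss_corr_dx_has_dy:
  "x \<noteq> y \<Longrightarrow> ((\<lambda>y. gauss_corr_dx n m x y) has_real_derivative gauss_corr_dxy n m x y) (at y)"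
  unfolding gauss_corr_dxy_def gauss_corr_dx_def
  by (intro DERIV_cdivide DERIV_minus alt_kernel_has_dxy)

text \<open>The kernel is symmetric, so its derivative in the second variable is
  \<open>gauss_corr_dx n m y x\<close>.\<close>

lemma gauss_corr_Suc:
  assumes "x \<noteq> y"
  shows "gauss_corr (Suc n) m x y = gauss_corr n m x y - gauss_corr_dx n m x y - gauss_corr_dx n m y x
     + gauss_corr_dxy n m x y - 2 / (x - y) * (gauss_corr_dx n m x y - gauss_corr_dx n m y x)"
  unfolding gauss_corr_def gauss_corr_dx_def gauss_corr_dxy_def shift_poly.simps
  by (subst alt_kernel_step[OF assms, symmetric]) (simp add: diff_divide_distrib add_divide_distrib algebra_simps)

section \<open>Combinatorics of the fourth cumulant\<close>

text \<open>Counts the matchings of \<open>t\<close> of the \<open>k\<close> rows with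
  \<open>t\<close> of the \<open>s\<close> columns, with weight \<open>c\<close> for each matched
  pair.\<close>

definition corr_coeff :: "real \<Rightarrow> nat \<Rightarrow> nat \<Rightarrow> nat \<Rightarrow> real" where
  "corr_coeff c k s t = real (k choose t) * real (s choose t) * fact t * c ^ t"

text \<open>The new row is unmatched, or it is matched with one of the \<open>s\<close> columns,
  which is then used up.\<close>

lemma corr_coeff_Suc:
  "corr_coeff c (Suc k) s (Suc t) = corr_coeff c k s (Suc t) + c * real s * corr_coeff c k (s - 1) t"
proof (cases s)
  case (Suc r)
  have "real (Suc t) * real (s choose Suc t) = real s * real (r choose t)"
    using Suc_times_binomial_eq[of r t] unfolding Suc of_nat_mult[symmetric] by (simp only: mult.commute)
  then have "real (s choose Suc t) * fact (Suc t) = real s * real (r choose t) * fact t"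
    by (simp del: of_nat_Suc add: mult_ac)
  then have "real (k choose t) * c ^ Suc t * (real (s choose Suc t) * fact (Suc t))
      = real (k choose t) * c ^ Suc t * (real s * real (r choose t) * fact t)" by simp
  then show ?thesis unfolding corr_coeff_def Suc binomial_Suc_Suc of_nat_add
    by (simp add: algebra_simps)
qed (simp add: corr_coeff_def)

definition corr_sum :: "real \<Rightarrow> nat \<Rightarrow> nat \<Rightarrow> real \<Rightarrow> real \<Rightarrow> real" where
  "corr_sum c k s x y = (\<Sum>t\<le>k. corr_coeff c k s t * gauss_corr (k - t) (s - t) x y)"

text \<open>The same split for correlations: in the first sum each Gaussian term gains a row, in the
  second a column is lost at the price of \<open>c\<close>. These are the two parts of the row
  recursion.\<close>

lemma corr_sum_Suc:
  "corr_sum c (Suc k) s x y = (\<Sum>t\<le>k. corr_coeff c k s t * gauss_corr (Suc (k - t)) (s - t) x y)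
     + c * real s * corr_sum c k (s - 1) x y"
proof -
  let ?g = "\<lambda>t. gauss_corr (Suc k - t) (s - t) x y"
  have "(\<Sum>t\<le>k. corr_coeff c k s t * gauss_corr (Suc (k - t)) (s - t) x y) = (\<Sum>t\<le>Suc k. corr_coeff c k s t * ?g t)"
    by (simp add: corr_coeff_def[of _ _ _ "Suc k"] Suc_diff_le)
  also have "\<dots> = corr_coeff c k s 0 * ?g 0 + (\<Sum>t\<le>k. corr_coeff c k s (Suc t) * ?g (Suc t))"
    by (simp only: sum.atMost_Suc_shift)
  finally have left: "(\<Sum>t\<le>k. corr_coeff c k s t * gauss_corr (Suc (k - t)) (s - t) x y)
     = corr_coeff c k s 0 * ?g 0 + (\<Sum>t\<le>k. corr_coeff c k s (Suc t) * ?g (Suc t))" .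
  have "corr_sum c (Suc k) s x y = corr_coeff c (Suc k) s 0 * ?g 0 + (\<Sum>t\<le>k. corr_coeff c (Suc k) s (Suc t) * ?g (Suc t))"
    unfolding corr_sum_def by (simp only: sum.atMost_Suc_shift)
  also have "\<dots> = corr_coeff c k s 0 * ?g 0 + (\<Sum>t\<le>k. corr_coeff c k s (Suc t) * ?g (Suc t))
      + c * real s * corr_sum c k (s - 1) x y"
    unfolding corr_coeff_Suc corr_sum_def distrib_right sum.distrib sum_distrib_left
    by (simp add: corr_coeff_def[of _ _ _ 0] mult_ac)
  finally show ?thesis unfolding left .
qed

context iid_array
begin

text \<open>The induction hypothesis covers equal index sets only. The sums over minors with an
  index deleted from one factor, or independently from both, are recovered from it by uniqueness of
  derivatives.\<close>

lemma minor_corr_eq_corr_sum: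
  assumes "k \<le> n" "S \<subseteq> {..<m}" "x \<noteq> y"
  shows "minor_corr k S S x y = corr_sum (b - 3) k (card S) x y"
  using assms
proof (induction k arbitrary: S x y)
  case 0
  have fin: "finite S" using 0 finite_subset by blast
  \<comment> \<open>Without rows the Gram matrix is zero, and only the empty principal minor
    contributes.\<close>
  have "char_minor S 0 v z = (- z) ^ card S" for v z
  proof -
    have "set_det U (gram v 0) = of_bool (U = {})" if "U \<in> Pow S" for U
    proof (cases "U = {}")
      case False
      then obtain u where "u \<in> U" by auto
      moreover have "finite U" using that fin finite_subset by auto
      ultimately show ?thesis using False unfolding set_det_def gram_def
        by (auto intro!: sum.neutral prod_zero)
    qed (simp add: set_det_def)
    then have "char_minor S 0 v z = (\<Sum>U\<in>Pow S. if U = {} then (- z) ^ card S else 0)"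
      unfolding char_minor_expand[OF fin] by (intro sum.cong) auto
    then show ?thesis using fin by simp
  qed
  then show ?case
    using gauss_corr_0[OF 0(3), of "card S"] unfolding minor_corr_def corr_sum_def
    by (simp add: prob_space corr_coeff_def power_mult_distrib[symmetric])
next
  case (Suc k)
  let ?c = "b - 3" and ?s = "card S"
  have k: "k < n" "k \<le> n" using Suc.prems by auto
  have fin: "finite S" using Suc.prems finite_subset by blast
  define f1 where "f1 x y = (\<Sum>t\<le>k. corr_coeff ?c k ?s t * gauss_corr_dx (k - t) (?s - t) x y)" for x y
  define f2 where "f2 x y = (\<Sum>t\<le>k. corr_coeff ?c k ?s t * gauss_corr_dxy (k - t) (?s - t) x y)" for x y
  note IH = Suc.IH[OF k(2)]
  have sub: "S - {i} \<subseteq> {..<m}" for i using Suc.prems by auto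
  have dx: "(\<Sum>i\<in>S. minor_corr k (S - {i}) S x y) = - f1 x y" if "x \<noteq> y" for x y
  proof -
    have "((\<lambda>x. corr_sum ?c k ?s x y) has_real_derivative f1 x y) (at x)"
      unfolding corr_sum_def f1_def
      by (intro DERIV_sum DERIV_cmult gauss_corr_has_dx that)
    \<comment> \<open>The identification is available off the diagonal only; the complement of
      \<open>{y}\<close> is open, which suffices for a derivative at \<open>x\<close>.\<close>
    then have "((\<lambda>x. minor_corr k S S x y) has_real_derivative f1 x y) (at x)"
      by (rule has_field_derivative_transform_within_open[of _ _ _ "- {y}"])
         (use that IH[OF Suc.prems(2)] in auto)
    from DERIV_unique[OF this minor_corr_has_dx[OF k(2) Suc.prems(2,2)]] show ?thesis by simp
  qed
  have sym: "minor_corr k S T x y = minor_corr k T S y x" for S T x y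
    by (simp add: minor_corr_def mult.commute)
  have dy: "(\<Sum>i\<in>S. minor_corr k S (S - {i}) x y) = - f1 y x"
    using dx[of y x] Suc.prems(3) by (simp add: sym[of S])
  have dxy: "(\<Sum>i\<in>S. \<Sum>j\<in>S. minor_corr k (S - {i}) (S - {j}) x y) = f2 x y"
  proof -
    have "((\<lambda>y. - f1 x y) has_real_derivative - f2 x y) (at y)"
      unfolding f1_def f2_def
      by (intro DERIV_minus DERIV_sum DERIV_cmult gauss_corr_dx_has_dy Suc.prems(3))
    then have 1: "((\<lambda>y. \<Sum>i\<in>S. minor_corr k (S - {i}) S x y) has_real_derivative - f2 x y) (at y)"
      by (rule has_field_derivative_transform_within_open[of _ _ _ "- {x}"])
         (use Suc.prems(3) dx in auto)
    have 2: "((\<lambda>y. \<Sum>i\<in>S. minor_corr k (S - {i}) S x y) has_real_derivative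
        (\<Sum>i\<in>S. - (\<Sum>j\<in>S. minor_corr k (S - {i}) (S - {j}) x y))) (at y)"
      by (intro DERIV_sum minor_corr_has_dy k sub Suc.prems)
    show ?thesis using DERIV_unique[OF 1 2] by (simp add: sum_negf)
  qed
  have "minor_corr (Suc k) S S x y = corr_sum ?c k ?s x y - f1 x y - f1 y x + f2 x y
      - 2 / (x - y) * (f1 x y - f1 y x) + ?c * (\<Sum>i\<in>S. corr_sum ?c k (?s - 1) x y)"
  proof -
    have "(\<Sum>i\<in>S. minor_corr k (S - {i}) (S - {i}) x y) = (\<Sum>i\<in>S. corr_sum ?c k (?s - 1) x y)"
      using IH[OF sub Suc.prems(3)] fin by (intro sum.cong refl) (simp add: card_Diff_singleton)
    then show ?thesis
      unfolding minor_corr_row_step[OF k(1) Suc.prems(2,3)] dx[OF Suc.prems(3)] dy dxy IH[OF Suc.prems(2,3)]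
      by (simp add: algebra_simps diff_divide_distrib)
  qed
  also have "corr_sum ?c k ?s x y - f1 x y - f1 y x + f2 x y - 2 / (x - y) * (f1 x y - f1 y x)
     = (\<Sum>t\<le>k. corr_coeff ?c k ?s t * gauss_corr (Suc (k - t)) (?s - t) x y)"
    unfolding corr_sum_def f1_def f2_def gauss_corr_Suc[OF Suc.prems(3)] right_diff_distrib distrib_left
      sum_subtractf sum.distrib sum_distrib_left
    by (simp add: mult_ac)
  finally show ?case unfolding corr_sum_Suc by (simp add: mult_ac)
qed

end

subsection \<open>Bessel functions\<close>

lemma tendsto_suminf_dominated:
  fixes a :: "nat \<Rightarrow> 'b \<Rightarrow> real"
  assumes "\<And>k. ((\<lambda>n. a k n) \<longlongrightarrow> b k) F" "eventually (\<lambda>n. \<forall>k. \<bar>a k n\<bar> \<le> M k) F" "summable M" "F \<noteq> bot"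
  shows "((\<lambda>n. \<Sum>k. a k n) \<longlongrightarrow> (\<Sum>k. b k)) F"
proof -
  have "eventually (\<lambda>(k, n). norm (a k n) \<le> M k) (at_top \<times>\<^sub>F F)"
    unfolding eventually_prod_filter
    by (rule exI[of _ "\<lambda>_. True"], rule exI[of _ "\<lambda>n. \<forall>k. \<bar>a k n\<bar> \<le> M k"]) (use assms(2) in auto)
  from tannerys_theorem[OF assms(1) this assms(3,4)] show ?thesis by blast
qed

lemma abs_suminf_le:
  fixes f g :: "nat \<Rightarrow> real"
  assumes "\<And>k. \<bar>f k\<bar> \<le> g k" "summable g"
  shows "\<bar>\<Sum>k. f k\<bar> \<le> (\<Sum>k. g k)"
proof -
  have s: "summable (\<lambda>k. \<bar>f k\<bar>)"
    by (rule summable_comparison_test'[OF assms(2)]) (simp add: assms(1))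
  show ?thesis using summable_rabs[OF s] suminf_le[OF assms(1) s assms(2)] by linarith
qed

lemma abs_double_suminf_le:
  fixes a :: "nat \<Rightarrow> nat \<Rightarrow> real"
  assumes "\<And>p q. \<bar>a p q\<bar> \<le> v p * z q" "summable v" "summable z"
  shows "\<bar>\<Sum>p. \<Sum>q. a p q\<bar> \<le> (\<Sum>p. v p) * (\<Sum>q. z q)"
proof -
  have "\<bar>\<Sum>q. a p q\<bar> \<le> v p * (\<Sum>q. z q)" for p
    using abs_suminf_le[OF assms(1) summable_mult[OF assms(3)]] by (simp add: suminf_mult[OF assms(3)])
  from abs_suminf_le[OF this summable_mult2[OF assms(2)]] show ?thesis
    by (simp add: suminf_mult2[OF assms(2)])
qed

text \<open>Tannery's theorem twice; the product form of the majorant makes the inner sums summably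
  dominated in the outer index.\<close>

lemma tendsto_double_suminf_dominated:
  fixes a :: "nat \<Rightarrow> nat \<Rightarrow> 'b \<Rightarrow> real"
  assumes "\<And>p q. ((\<lambda>n. a p q n) \<longlongrightarrow> b p q) F"
    "eventually (\<lambda>n. \<forall>p q. \<bar>a p q n\<bar> \<le> v p * z q) F" "summable v" "summable z" "F \<noteq> bot"
  shows "((\<lambda>n. \<Sum>p. \<Sum>q. a p q n) \<longlongrightarrow> (\<Sum>p. \<Sum>q. b p q)) F"
proof (rule tendsto_suminf_dominated[where M = "\<lambda>p. v p * (\<Sum>q. z q)"])
  show "((\<lambda>n. \<Sum>q. a p q n) \<longlongrightarrow> (\<Sum>q. b p q)) F" for p
    by (rule tendsto_suminf_dominated[where M = "\<lambda>q. v p * z q"])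
       (use assms in \<open>auto elim: eventually_mono intro: summable_mult\<close>)
  show "eventually (\<lambda>n. \<forall>p. \<bar>\<Sum>q. a p q n\<bar> \<le> v p * (\<Sum>q. z q)) F"
    using assms(2)
  proof eventually_elim
    case (elim n)
    show ?case
    proof
      fix p
      have "\<bar>\<Sum>q. a p q n\<bar> \<le> (\<Sum>q. v p * z q)"
        using elim assms(4) by (intro abs_suminf_le summable_mult) auto
      then show "\<bar>\<Sum>q. a p q n\<bar> \<le> v p * (\<Sum>q. z q)" by (simp add: suminf_mult[OF assms(4)])
    qed
  qed
qed (use assms in \<open>auto intro: summable_mult2\<close>)

text \<open>With \<open>\<nu> = \<alpha> - j\<close>, the power series with these coefficients takes the value \<open>(z / 2)\<^sup>-\<^sup>\<nu> J\<^sub>\<nu>(z)\<close> at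
  \<open>z\<^sup>2 / 4\<close>. The order \<open>\<nu>\<close> may be negative; the coefficients at the poles of the Gamma function
  are then zero.\<close>

definition bessel_coeff :: "nat \<Rightarrow> nat \<Rightarrow> nat \<Rightarrow> real" where
  "bessel_coeff \<alpha> j p = (if j \<le> \<alpha> + p then (- 1) ^ p / (fact p * fact (\<alpha> + p - j)) else 0)"

definition bessel_fun :: "nat \<Rightarrow> nat \<Rightarrow> real \<Rightarrow> real" where
  "bessel_fun \<alpha> j x = (\<Sum>p. bessel_coeff \<alpha> j p * x ^ p)"

lemma abs_bessel_coeff_le: "\<bar>bessel_coeff \<alpha> j p\<bar> \<le> 1 / fact p"
proof (cases "j \<le> \<alpha> + p")
  case True
  have "(fact p :: real) \<le> fact p * fact (\<alpha> + p - j)"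
    using fact_ge_1[of "\<alpha> + p - j"] by (simp add: mult_left_le[of "fact p :: real"] mult_le_cancel_left1)
  then show ?thesis using True by (simp add: bessel_coeff_def abs_mult power_abs frac_le)
qed (simp add: bessel_coeff_def)

lemma summable_power_over_fact: "summable (\<lambda>p. x ^ p / fact p :: real)"
  using summable_exp[of x] by (simp add: field_simps)

lemma summable_bessel: "summable (\<lambda>p. bessel_coeff \<alpha> j p * x ^ p)"
proof (rule summable_comparison_test'[of "\<lambda>p. \<bar>x\<bar> ^ p / fact p"])
  fix p :: nat
  show "norm (bessel_coeff \<alpha> j p * x ^ p) \<le> \<bar>x\<bar> ^ p / fact p"
    using mult_right_mono[OF abs_bessel_coeff_le[of \<alpha> j p], of "\<bar>x\<bar> ^ p"] by (simp add: abs_mult power_abs)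
qed (rule summable_power_over_fact)

text \<open>Differentiation raises the order by one, that is, it lowers \<open>j\<close>, and
  changes the sign.\<close>

lemma diffs_bessel_coeff: "diffs (bessel_coeff \<alpha> (Suc j)) p = - bessel_coeff \<alpha> j p"
  by (auto simp: diffs_def bessel_coeff_def field_simps simp del: of_nat_Suc)

lemma bessel_fun_has_derivative:
  "(bessel_fun \<alpha> j has_real_derivative (\<Sum>p. diffs (bessel_coeff \<alpha> j) p * x ^ p)) (at x)"
  unfolding bessel_fun_def
  by (rule termdiffs_strong_converges_everywhere) (rule summable_bessel)

lemma summable_diffs_bessel: "summable (\<lambda>p. diffs (bessel_coeff \<alpha> j) p * x ^ p)"
  by (rule termdiff_converges_all) (rule summable_bessel)

lemma bessel_fun_derivative_Suc: "(\<Sum>p. diffs (bessel_coeff \<alpha> (Suc j)) p * x ^ p) = - bessel_fun \<alpha> j x"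
  unfolding diffs_bessel_coeff bessel_fun_def
  using suminf_minus[OF summable_bessel[of \<alpha> j x]] by simp

text \<open>Indexed by the exponent of the monomial before differentiation, in line with
  \<open>alt_mono\<close>; the term at \<open>p = 0\<close> vanishes.\<close>

lemma sums_derivative_monomials:
  "(\<lambda>p. bessel_coeff \<alpha> j p * poly (pderiv (monom 1 p)) x) sums (\<Sum>p. diffs (bessel_coeff \<alpha> j) p * x ^ p)"
proof -
  have "(\<lambda>p. bessel_coeff \<alpha> j (Suc p) * poly (pderiv (monom 1 (Suc p))) x) sums (\<Sum>p. diffs (bessel_coeff \<alpha> j) p * x ^ p)"
    using summable_sums[OF summable_diffs_bessel[of \<alpha> j x]]
    by (simp add: pderiv_monom poly_monom diffs_def mult_ac)
  then show ?thesis by (subst (asm) sums_Suc_iff) (simp add: pderiv_monom)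
qed

text \<open>The operator x d/dx + (\<alpha> - j) lowers the order: it multiplies
  \<open>x ^ p\<close> by \<alpha> + p - j, the ratio of the coefficients. For
  \<open>j = \<alpha> + p\<close> this factor is zero, in accordance with the convention at the
  poles.\<close>

lemma bessel_fun_recurrence:
  "bessel_fun \<alpha> (Suc j) x = x * (\<Sum>p. diffs (bessel_coeff \<alpha> j) p * x ^ p) + (real \<alpha> - real j) * bessel_fun \<alpha> j x"
proof -
  have c: "bessel_coeff \<alpha> (Suc j) p = (real \<alpha> + real p - real j) * bessel_coeff \<alpha> j p" for p
  proof -
    consider "Suc j \<le> \<alpha> + p" | "j = \<alpha> + p" | "j > \<alpha> + p" by linarith
    then show ?thesis
    proof cases
      case 1
      then obtain r where r: "\<alpha> + p - j = Suc r" "\<alpha> + p - Suc j = r" "j \<le> \<alpha> + p"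
        by (metis Suc_diff_Suc Suc_le_lessD less_imp_le)
      then have "real \<alpha> + real p - real j = real (Suc r)" by linarith
      then show ?thesis using 1 r by (simp add: bessel_coeff_def field_simps del: of_nat_Suc)
    qed (auto simp: bessel_coeff_def)
  qed
  have m: "x * poly (pderiv (monom 1 p)) x = real p * x ^ p" for p
    by (cases p) (simp_all add: pderiv_monom poly_monom)
  have "(\<lambda>p. x * (bessel_coeff \<alpha> j p * poly (pderiv (monom 1 p)) x) + (real \<alpha> - real j) * (bessel_coeff \<alpha> j p * x ^ p))
     sums (x * (\<Sum>p. diffs (bessel_coeff \<alpha> j) p * x ^ p) + (real \<alpha> - real j) * bessel_fun \<alpha> j x)"
    unfolding bessel_fun_def by (intro sums_add sums_mult sums_derivative_monomials summable_sums summable_bessel)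
  moreover have "x * (bessel_coeff \<alpha> j p * poly (pderiv (monom 1 p)) x) + (real \<alpha> - real j) * (bessel_coeff \<alpha> j p * x ^ p)
      = bessel_coeff \<alpha> (Suc j) p * x ^ p" for p
    using m[of p] unfolding c by (simp add: algebra_simps)
  ultimately show ?thesis by (simp add: bessel_fun_def sums_iff)
qed

lemma bessel_J_eq: "bessel_J \<alpha> z = (z / 2) ^ \<alpha> * bessel_fun \<alpha> 0 (z\<^sup>2 / 4)"
proof -
  have e: "(- 1) ^ k / (fact k * fact (k + \<alpha>)) * (z / 2) ^ (2 * k + \<alpha>)
      = (z / 2) ^ \<alpha> * (bessel_coeff \<alpha> 0 k * (z\<^sup>2 / 4) ^ k)" for k
  proof -
    have "(z / 2) ^ (2 * k) = (z\<^sup>2 / 4) ^ k" by (simp add: power_mult power_divide)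
    then show ?thesis by (simp add: bessel_coeff_def power_add add.commute)
  qed
  show ?thesis unfolding bessel_J_def e bessel_fun_def by (rule suminf_mult[OF summable_bessel])
qed

text \<open>The classical z J' = z J_(\<alpha>-1) - \<alpha> J. The factor \<open>z\<close> absorbs
  the truncated exponent \<open>\<alpha> - 1\<close>, so that \<alpha> = 0 needs no separate
  statement.\<close>

lemma bessel_J_deriv:
  "z * deriv (bessel_J \<alpha>) z = (z / 2) ^ \<alpha> * (2 * bessel_fun \<alpha> 1 (z\<^sup>2 / 4) - real \<alpha> * bessel_fun \<alpha> 0 (z\<^sup>2 / 4))"
proof -
  let ?D = "\<Sum>p. diffs (bessel_coeff \<alpha> 0) p * (z\<^sup>2 / 4) ^ p"
  have "((\<lambda>z. bessel_fun \<alpha> 0 (z\<^sup>2 / 4)) has_real_derivative ?D * (z / 2)) (at z)"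
    by (rule DERIV_chain2[OF bessel_fun_has_derivative]) (auto intro!: derivative_eq_intros)
  moreover have "((\<lambda>z. (z / 2) ^ \<alpha>) has_real_derivative real \<alpha> * (z / 2) ^ (\<alpha> - 1) * (1 / 2)) (at z)"
    by (auto intro!: derivative_eq_intros)
  ultimately have "(bessel_J \<alpha> has_real_derivative
      real \<alpha> * (z / 2) ^ (\<alpha> - 1) * (1 / 2) * bessel_fun \<alpha> 0 (z\<^sup>2 / 4) + ?D * (z / 2) * (z / 2) ^ \<alpha>) (at z)"
    unfolding bessel_J_eq[abs_def] by (intro DERIV_mult)
  then have "z * deriv (bessel_J \<alpha>) z = z * (real \<alpha> * (z / 2) ^ (\<alpha> - 1) * (1 / 2)) * bessel_fun \<alpha> 0 (z\<^sup>2 / 4)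
      + 2 * (z\<^sup>2 / 4 * ?D) * (z / 2) ^ \<alpha>"
    by (simp add: DERIV_imp_deriv algebra_simps power2_eq_square)
  also have "z * (real \<alpha> * (z / 2) ^ (\<alpha> - 1) * (1 / 2)) = real \<alpha> * (z / 2) ^ \<alpha>"
    by (cases \<alpha>) simp_all
  also have "z\<^sup>2 / 4 * ?D = bessel_fun \<alpha> 1 (z\<^sup>2 / 4) - real \<alpha> * bessel_fun \<alpha> 0 (z\<^sup>2 / 4)"
    using bessel_fun_recurrence[of \<alpha> 0 "z\<^sup>2 / 4"] by simp
  finally show ?thesis by (simp add: algebra_simps)
qed

section \<open>The limit kernel as a double power series\<close>

definition kernel_series :: "nat \<Rightarrow> real \<Rightarrow> real \<Rightarrow> real" where
  "kernel_series \<alpha> x y = (\<Sum>p. \<Sum>q. bessel_coeff \<alpha> 2 p * bessel_coeff \<alpha> 1 q * alt_mono x y p q)"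

text \<open>This is the differentiated kernel of the series with \<open>j = 2\<close> and
  \<open>j = 1\<close>. Their derivatives are minus the series with \<open>j = 1\<close> and
  \<open>j = 0\<close>, so three Bessel functions suffice.\<close>

lemma kernel_series_offdiag:
  assumes "x \<noteq> y"
  shows "kernel_series \<alpha> x y = (bessel_fun \<alpha> 2 x * bessel_fun \<alpha> 0 y + bessel_fun \<alpha> 0 x * bessel_fun \<alpha> 2 y
      - 2 * bessel_fun \<alpha> 1 x * bessel_fun \<alpha> 1 y) / (x - y) ^ 2
     - 2 * (bessel_fun \<alpha> 2 x * bessel_fun \<alpha> 1 y - bessel_fun \<alpha> 1 x * bessel_fun \<alpha> 2 y) / (x - y) ^ 3"
proof -
  let ?A = "bessel_coeff \<alpha> 2" and ?B = "bessel_coeff \<alpha> 1"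
  let ?d = "\<lambda>p x. poly (pderiv (monom (1::real) p)) x"
  have A: "(\<lambda>p. ?A p * x ^ p) sums bessel_fun \<alpha> 2 x" and B: "(\<lambda>p. ?B p * x ^ p) sums bessel_fun \<alpha> 1 x" for x
    unfolding bessel_fun_def by (intro summable_sums summable_bessel)+
  have A': "(\<lambda>p. ?A p * ?d p x) sums (- bessel_fun \<alpha> 1 x)" and B': "(\<lambda>p. ?B p * ?d p x) sums (- bessel_fun \<alpha> 0 x)" for x
    using sums_derivative_monomials[of \<alpha> 2 x] sums_derivative_monomials[of \<alpha> 1 x]
      bessel_fun_derivative_Suc[of \<alpha> 1 x] bessel_fun_derivative_Suc[of \<alpha> 0 x]
    by (simp_all add: numeral_2_eq_2)
  have "(\<lambda>q. ?A p * ((?d p x * (?B q * y ^ q) - x ^ p * (?B q * ?d q y) - (?B q * ?d q x) * y ^ p + (?B q * x ^ q) * ?d p y) / (x - y) ^ 2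
       - 2 * (x ^ p * (?B q * y ^ q) - (?B q * x ^ q) * y ^ p) / (x - y) ^ 3))
     sums (?A p * ((?d p x * bessel_fun \<alpha> 1 y - x ^ p * (- bessel_fun \<alpha> 0 y) - (- bessel_fun \<alpha> 0 x) * y ^ p + bessel_fun \<alpha> 1 x * ?d p y) / (x - y) ^ 2
       - 2 * (x ^ p * bessel_fun \<alpha> 1 y - bessel_fun \<alpha> 1 x * y ^ p) / (x - y) ^ 3))" for p
    by (intro sums_mult sums_mult2 sums_add sums_diff sums_divide B B')
  moreover have "?A p * ((?d p x * (?B q * y ^ q) - x ^ p * (?B q * ?d q y) - (?B q * ?d q x) * y ^ p + (?B q * x ^ q) * ?d p y) / (x - y) ^ 2
       - 2 * (x ^ p * (?B q * y ^ q) - (?B q * x ^ q) * y ^ p) / (x - y) ^ 3) = ?A p * ?B q * alt_mono x y p q" for p q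
    unfolding alt_mono_eq[OF assms] alt_kernel_def poly_monom
    by (simp add: algebra_simps diff_divide_distrib add_divide_distrib)
  ultimately have inner: "(\<Sum>q. ?A p * ?B q * alt_mono x y p q) = ((?A p * ?d p x) * bessel_fun \<alpha> 1 y - (?A p * x ^ p) * (- bessel_fun \<alpha> 0 y)
       - (- bessel_fun \<alpha> 0 x) * (?A p * y ^ p) + bessel_fun \<alpha> 1 x * (?A p * ?d p y)) / (x - y) ^ 2
       - 2 * ((?A p * x ^ p) * bessel_fun \<alpha> 1 y - bessel_fun \<alpha> 1 x * (?A p * y ^ p)) / (x - y) ^ 3" for p
    by (simp add: sums_iff algebra_simps diff_divide_distrib add_divide_distrib)
  have "(\<lambda>p. \<Sum>q. ?A p * ?B q * alt_mono x y p q) sums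
     (((- bessel_fun \<alpha> 1 x) * bessel_fun \<alpha> 1 y - bessel_fun \<alpha> 2 x * (- bessel_fun \<alpha> 0 y)
       - (- bessel_fun \<alpha> 0 x) * bessel_fun \<alpha> 2 y + bessel_fun \<alpha> 1 x * (- bessel_fun \<alpha> 1 y)) / (x - y) ^ 2
       - 2 * (bessel_fun \<alpha> 2 x * bessel_fun \<alpha> 1 y - bessel_fun \<alpha> 1 x * bessel_fun \<alpha> 2 y) / (x - y) ^ 3)"
    unfolding inner by (intro sums_mult sums_mult2 sums_add sums_diff sums_divide A A')
  then show ?thesis unfolding kernel_series_def by (simp add: sums_iff algebra_simps)
qed

text \<open>Joint continuity, which is what determines the kernel on the diagonal.\<close>

lemma tendsto_kernel_series:
  assumes "(f \<longlongrightarrow> x) F" "(g \<longlongrightarrow> y) F" "F \<noteq> bot"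
  shows "((\<lambda>i. kernel_series \<alpha> (f i) (g i)) \<longlongrightarrow> kernel_series \<alpha> x y) F"
  unfolding kernel_series_def
proof (rule tendsto_double_suminf_dominated)
  define R where "R = max 1 (max (\<bar>x\<bar> + 1) (\<bar>y\<bar> + 1))"
  have R: "1 \<le> R" "\<bar>x\<bar> < R" "\<bar>y\<bar> < R" by (auto simp: R_def)
  show "((\<lambda>i. bessel_coeff \<alpha> 2 p * bessel_coeff \<alpha> 1 q * alt_mono (f i) (g i) p q)
     \<longlongrightarrow> bessel_coeff \<alpha> 2 p * bessel_coeff \<alpha> 1 q * alt_mono x y p q) F" for p q
    by (intro tendsto_mult tendsto_const tendsto_alt_mono assms)
  have "eventually (\<lambda>i. \<bar>f i\<bar> < R) F" "eventually (\<lambda>i. \<bar>g i\<bar> < R) F"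
    using tendsto_rabs[OF assms(1)] tendsto_rabs[OF assms(2)] R by (auto dest: order_tendstoD)
  then show "eventually (\<lambda>i. \<forall>p q. \<bar>bessel_coeff \<alpha> 2 p * bessel_coeff \<alpha> 1 q * alt_mono (f i) (g i) p q\<bar>
     \<le> (4 * R) ^ p / fact p * ((4 * R) ^ q / fact q)) F"
  proof eventually_elim
    case (elim i)
    show ?case
    proof (intro allI)
      fix p q
      have "\<bar>bessel_coeff \<alpha> 2 p * bessel_coeff \<alpha> 1 q * alt_mono (f i) (g i) p q\<bar>
         \<le> (1 / fact p) * (1 / fact q) * (4 * R) ^ (p + q)"
        unfolding abs_mult using elim R
        by (intro mult_mono abs_bessel_coeff_le alt_mono_bounds) auto
      then show "\<bar>bessel_coeff \<alpha> 2 p * bessel_coeff \<alpha> 1 q * alt_mono (f i) (g i) p q\<bar>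
         \<le> (4 * R) ^ p / fact p * ((4 * R) ^ q / fact q)" by (simp add: power_add)
    qed
  qed
qed (rule summable_power_over_fact assms(3))+

text \<open>The quarters come from the argument \<open>z\<^sup>2 / 4\<close> of the Bessel series,
  and 1/16 is what remains of the powers of 4 after substituting \<open>u = 4 * x\<close> and
  \<open>v = 4 * y\<close>.\<close>

lemma diff_bessel_kernel_offdiag_eq:
  assumes "u > 0" "v > 0" "u \<noteq> v"
  shows "diff_bessel_kernel_offdiag \<alpha> u v = (u / 4 * (v / 4)) powr (real \<alpha> / 2) / 16 * kernel_series \<alpha> (u / 4) (v / 4)"
proof -
  define x y where "x = u / 4" and "y = v / 4"
  define k where "k = (sqrt u / 2) ^ \<alpha> * (sqrt v / 2) ^ \<alpha>"
  have uv: "u = 4 * x" "v = 4 * y" and xy: "x \<noteq> y" using assms by (auto simp: x_def y_def)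
  define a b c d where "a = bessel_fun \<alpha> 0 x" and "b = bessel_fun \<alpha> 1 x" and "c = bessel_fun \<alpha> 0 y" and "d = bessel_fun \<alpha> 1 y"
  \<comment> \<open>This three-term recurrence eliminates the order \<alpha> - 2.\<close>
  have A: "bessel_fun \<alpha> 2 t = - t * bessel_fun \<alpha> 0 t + (real \<alpha> - 1) * bessel_fun \<alpha> 1 t" for t
    using bessel_fun_recurrence[of \<alpha> 1 t] bessel_fun_derivative_Suc[of \<alpha> 0 t] by (simp add: numeral_2_eq_2)
  have k: "k = (u / 4 * (v / 4)) powr (real \<alpha> / 2)"
  proof -
    have "k = (sqrt (u / 4 * (v / 4))) ^ \<alpha>"
      unfolding k_def power_mult_distrib[symmetric] using assms
      by (simp add: real_sqrt_mult real_sqrt_divide)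
    also have "\<dots> = ((u / 4 * (v / 4)) powr (1 / 2)) powr (real \<alpha>)"
      using assms by (simp add: powr_half_sqrt powr_realpow)
    finally show ?thesis by (simp add: powr_powr)
  qed
  have sq: "(sqrt u)\<^sup>2 / 4 = x" "(sqrt v)\<^sup>2 / 4 = y" using assms by (auto simp: x_def y_def)
  have J: "bessel_J \<alpha> (sqrt u) = (sqrt u / 2) ^ \<alpha> * a" "bessel_J \<alpha> (sqrt v) = (sqrt v / 2) ^ \<alpha> * c"
    unfolding bessel_J_eq sq a_def c_def by simp_all
  have J': "sqrt u * deriv (bessel_J \<alpha>) (sqrt u) = (sqrt u / 2) ^ \<alpha> * (2 * b - real \<alpha> * a)"
    "sqrt v * deriv (bessel_J \<alpha>) (sqrt v) = (sqrt v / 2) ^ \<alpha> * (2 * d - real \<alpha> * c)"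
    unfolding bessel_J_deriv sq a_def b_def c_def d_def by simp_all
  have n1: "bessel_J \<alpha> (sqrt u) * sqrt v * deriv (bessel_J \<alpha>) (sqrt v)
        - sqrt u * deriv (bessel_J \<alpha>) (sqrt u) * bessel_J \<alpha> (sqrt v)
     = k * (a * (2 * d - real \<alpha> * c) - (2 * b - real \<alpha> * a) * c)"
    unfolding mult.assoc J'(2) unfolding mult.assoc[symmetric] J'(1) J k_def by (simp add: algebra_simps)
  have n2: "(u + v - 2 * real \<alpha> ^ 2) * bessel_J \<alpha> (sqrt u) * bessel_J \<alpha> (sqrt v)
        + 2 * sqrt (u * v) * deriv (bessel_J \<alpha>) (sqrt u) * deriv (bessel_J \<alpha>) (sqrt v)
     = k * ((u + v - 2 * real \<alpha> ^ 2) * a * c + 2 * (2 * b - real \<alpha> * a) * (2 * d - real \<alpha> * c))"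
  proof -
    have "2 * sqrt (u * v) * deriv (bessel_J \<alpha>) (sqrt u) * deriv (bessel_J \<alpha>) (sqrt v)
      = 2 * (sqrt u * deriv (bessel_J \<alpha>) (sqrt u)) * (sqrt v * deriv (bessel_J \<alpha>) (sqrt v))"
      by (simp add: real_sqrt_mult)
    then show ?thesis unfolding J' J k_def by (simp add: algebra_simps)
  qed
  define e where "e = x - y"
  have e: "e \<noteq> 0" "x = y + e" "x - y = e" using xy by (auto simp: e_def)
  have "diff_bessel_kernel_offdiag \<alpha> u v
    = k * ((u + v) * (a * (2 * d - real \<alpha> * c) - (2 * b - real \<alpha> * a) * c) / (2 * (u - v) ^ 3)
      - ((u + v - 2 * real \<alpha> ^ 2) * a * c + 2 * (2 * b - real \<alpha> * a) * (2 * d - real \<alpha> * c)) / (4 * (u - v) ^ 2))"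
    unfolding diff_bessel_kernel_offdiag_def n1 n2 by (simp add: algebra_simps)
  also have "\<dots> = k * (((x + y) * (a * d - b * c) / e ^ 3
      - ((x + y) * a * c + 2 * b * d - real \<alpha> * (a * d + b * c)) / e ^ 2) / 16)"
  proof -
    have p: "(u - v) ^ 3 = 64 * e ^ 3" "(u - v) ^ 2 = 16 * e ^ 2"
      unfolding uv e_def by (simp_all add: power2_eq_square power3_eq_cube algebra_simps)
    show ?thesis unfolding p unfolding uv using e(1)
      by (simp add: field_simps power2_eq_square power3_eq_cube)
  qed
  also have "\<dots> = k / 16 * kernel_series \<alpha> x y"
    unfolding kernel_series_offdiag[OF xy] A a_def[symmetric] b_def[symmetric] c_def[symmetric] d_def[symmetric] e(3)
    using e(1) by (simp add: field_simps power2_eq_square power3_eq_cube) (simp add: e(2) algebra_simps)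
  finally show ?thesis by (simp add: k x_def y_def)
qed

lemma diff_bessel_kernel_eq:
  assumes "u > 0" "v > 0"
  shows "diff_bessel_kernel \<alpha> u v = (u / 4 * (v / 4)) powr (real \<alpha> / 2) / 16 * kernel_series \<alpha> (u / 4) (v / 4)"
proof (cases "u = v")
  case False
  then show ?thesis using assms by (simp add: diff_bessel_kernel_def diff_bessel_kernel_offdiag_eq)
next
  case True
  let ?D = "{(u, v). 0 < u \<and> 0 < v \<and> u \<noteq> (v::real)}"
  let ?F = "at (u, u) within ?D"
  \<comment> \<open>\<open>Lim\<close> is determined only along a nontrivial filter, so the diagonal
    point has to be approachable through \<open>?D\<close>.\<close>
  have "(u, u) islimpt ?D"
  proof (unfold islimpt_approachable, intro allI impI)
    fix e :: real assume "e > 0"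
    then show "\<exists>x'\<in>?D. x' \<noteq> (u, u) \<and> dist x' (u, u) < e"
      using assms by (intro bexI[of _ "(u + e / 2, u)"]) (auto simp: dist_Pair_Pair dist_real_def)
  qed
  then have nb: "?F \<noteq> bot" by (simp add: trivial_limit_within)
  have t: "(fst \<longlongrightarrow> u) ?F" "(snd \<longlongrightarrow> u) ?F"
    by (auto intro!: tendsto_eq_intros tendsto_fst tendsto_snd)
  let ?G = "\<lambda>w. (fst w / 4 * (snd w / 4)) powr (real \<alpha> / 2) / 16 * kernel_series \<alpha> (fst w / 4) (snd w / 4)"
  have "(?G \<longlongrightarrow> (u / 4 * (u / 4)) powr (real \<alpha> / 2) / 16 * kernel_series \<alpha> (u / 4) (u / 4)) ?F"
    by (intro tendsto_mult tendsto_divide tendsto_const tendsto_powr tendsto_kernel_series t nb) (use assms in auto)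
  moreover have "eventually (\<lambda>w. ?G w = (\<lambda>(u, v). diff_bessel_kernel_offdiag \<alpha> u v) w) ?F"
    unfolding eventually_at_filter by (rule always_eventually) (auto simp: diff_bessel_kernel_offdiag_eq)
  ultimately have "((\<lambda>(u, v). diff_bessel_kernel_offdiag \<alpha> u v)
      \<longlongrightarrow> (u / 4 * (u / 4)) powr (real \<alpha> / 2) / 16 * kernel_series \<alpha> (u / 4) (u / 4)) ?F"
    by (rule Lim_transform_eventually)
  then show ?thesis using True nb by (simp add: diff_bessel_kernel_def tendsto_Lim)
qed

subsection \<open>The scaling limit\<close>

lemma alt_kernel_skew: "alt_kernel p q x y = - alt_kernel q p x y"
  unfolding alt_kernel_def by (simp add: algebra_simps diff_divide_distrib add_divide_distrib)

lemma alt_kernel_sum_left: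
  assumes "finite A"
  shows "alt_kernel (\<Sum>i\<in>A. Polynomial.smult (c i) (f i)) q x y = (\<Sum>i\<in>A. c i * alt_kernel (f i) q x y)"
  using assms
proof (induction A rule: finite_induct)
  case empty
  then show ?case by (simp add: alt_kernel_def)
next
  case (insert i A)
  have "alt_kernel (Polynomial.smult c p + r) q x y = c * alt_kernel p q x y + alt_kernel r q x y" for c p r
    unfolding alt_kernel_def
    by (simp add: pderiv_add pderiv_smult algebra_simps diff_divide_distrib add_divide_distrib)
  then show ?case using insert by simp
qed

lemma alt_kernel_expand:
  assumes "degree P \<le> a" "degree Q \<le> b" "x \<noteq> y"
  shows "alt_kernel P Q x y = (\<Sum>p\<le>a. \<Sum>q\<le>b. coeff P p * coeff Q q * alt_mono x y p q)"
proof -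
  have m: "(\<Sum>i\<le>n. Polynomial.smult (coeff R i) (monom 1 i)) = R" if "degree R \<le> n" for R :: "real poly" and n
    using poly_as_sum_of_monoms'[OF that] by (simp add: smult_monom)
  have "alt_kernel P Q x y = (\<Sum>p\<le>a. coeff P p * alt_kernel (monom 1 p) Q x y)"
    using alt_kernel_sum_left[of "{..a}" "coeff P" "monom 1" Q x y] m[OF assms(1)] by simp
  also have "\<dots> = (\<Sum>p\<le>a. coeff P p * (\<Sum>q\<le>b. coeff Q q * alt_kernel (monom 1 p) (monom 1 q) x y))"
  proof -
    have "alt_kernel R Q x y = (\<Sum>q\<le>b. coeff Q q * alt_kernel R (monom 1 q) x y)" for R
      using alt_kernel_sum_left[of "{..b}" "coeff Q" "monom 1" R x y] m[OF assms(2)]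
      by (simp add: alt_kernel_skew[of R] sum_negf)
    then show ?thesis by metis
  qed
  finally show ?thesis by (simp add: alt_mono_eq[OF assms(3)] sum_distrib_left mult.assoc)
qed

definition gauss_poly :: "nat \<Rightarrow> nat \<Rightarrow> real \<Rightarrow> real \<Rightarrow> real" where
  "gauss_poly n m x y = - (\<Sum>p\<le>m + 2. \<Sum>q\<le>m + 1. coeff (shift_poly n (m + 2)) p * coeff (shift_poly n (m + 1)) q
     * alt_mono x y p q) / real (m + 1)"

lemma gauss_corr_eq_poly:
  assumes "x \<noteq> y"
  shows "gauss_corr n m x y = gauss_poly n m x y"
  unfolding gauss_corr_def gauss_poly_def
    alt_kernel_expand[OF degree_shift_poly degree_shift_poly assms] ..

definition corr_poly :: "real \<Rightarrow> nat \<Rightarrow> nat \<Rightarrow> real \<Rightarrow> real \<Rightarrow> real" where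
  "corr_poly c k s x y = (\<Sum>t\<le>k. corr_coeff c k s t * gauss_poly (k - t) (s - t) x y)"

text \<open>Both sides are continuous in \<open>y\<close> and agree for \<open>y \<noteq> x\<close>,
  hence also at \<open>y = x\<close>.\<close>

lemma (in iid_array) minor_corr_eq_corr_poly:
  assumes "k \<le> n" "S \<subseteq> {..<m}"
  shows "minor_corr k S S x y = corr_poly (b - 3) k (card S) x y"
proof -
  have off: "minor_corr k S S x y = corr_poly (b - 3) k (card S) x y" if "x \<noteq> y" for y
    using minor_corr_eq_corr_sum[OF assms that]
    by (simp add: corr_sum_def corr_poly_def gauss_corr_eq_poly[OF that])
  show ?thesis
  proof (cases "x = y")
    case True
    have "((\<lambda>y. minor_corr k S S x y) \<longlongrightarrow> minor_corr k S S x x) (at x)"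
      using DERIV_isCont[OF minor_corr_has_dy[OF assms(1,2,2)]] by (simp add: isCont_def)
    moreover have "((\<lambda>y. minor_corr k S S x y) \<longlongrightarrow> corr_poly (b - 3) k (card S) x x) (at x)"
    proof (rule Lim_transform_eventually)
      show "((\<lambda>y. corr_poly (b - 3) k (card S) x y) \<longlongrightarrow> corr_poly (b - 3) k (card S) x x) (at x)"
        unfolding corr_poly_def gauss_poly_def
        by (intro tendsto_sum tendsto_mult tendsto_const tendsto_divide tendsto_minus tendsto_alt_mono tendsto_ident_at) auto
      show "\<forall>\<^sub>F y in at x. corr_poly (b - 3) k (card S) x y = minor_corr k S S x y"
        unfolding eventually_at_filter by (rule always_eventually) (auto simp: off)
    qed
    ultimately show ?thesis using True tendsto_unique[OF trivial_limit_at] by blast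
  qed (rule off)
qed

section \<open>Rescaled coefficients, their bounds and limits\<close>

text \<open>This factor receives the \<open>1 / fact n\<close> of the normalisation, which cancels
  the numerator of the binomial coefficient.\<close>

definition coeff_ratio_A :: "nat \<Rightarrow> nat \<Rightarrow> nat \<Rightarrow> nat \<Rightarrow> real" where
  "coeff_ratio_A N n m p = (if p \<le> m + 2 then fact (m + 2) / fact n * real (n choose (m + 2 - p)) / real N ^ p else 0)"

text \<open>Homogeneity contributes \<open>N ^ 3\<close>, of which the normalisation leaves one
  \<open>N\<close>; it is kept as a numerator because the exponent \<open>\<alpha> + q - 1\<close>
  would be truncated for \<alpha> = q = 0.\<close>

definition coeff_ratio_B :: "nat \<Rightarrow> nat \<Rightarrow> nat \<Rightarrow> nat \<Rightarrow> nat \<Rightarrow> real" where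
  "coeff_ratio_B \<alpha> N n m q = (if q \<le> m + 1 then real (n choose (m + 1 - q)) * real N / real N ^ (\<alpha> + q) else 0)"

lemma gauss_poly_scaled:
  assumes "N > 0"
  shows "gauss_poly n m (x / real N) (y / real N) / (fact n * fact m) / real N ^ 2 / real N ^ \<alpha>
    = (\<Sum>p. \<Sum>q. ((- 1) ^ p / fact p * coeff_ratio_A N n m p) * ((- 1) ^ q / fact q * coeff_ratio_B \<alpha> N n m q) * alt_mono x y p q)"
proof -
  have N: "real N \<noteq> 0" using assms by simp
  have neg: "(- 1 :: real) ^ (a - p) = (- 1) ^ a * (- 1) ^ p" if "p \<le> a" for a p
  proof -
    have "(- 1 :: real) ^ a = (- 1) ^ (a - p) * (- 1) ^ p" using that by (simp flip: power_add)
    moreover have "(- 1 :: real) ^ p * (- 1) ^ p = 1" by (simp flip: power_mult_distrib)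
    ultimately show ?thesis by (simp only: mult.assoc mult_1_right)
  qed
  have t: "- (coeff (shift_poly n (m + 2)) p * coeff (shift_poly n (m + 1)) q * alt_mono (x / real N) (y / real N) p q)
       / real (m + 1) / (fact n * fact m) / real N ^ 2 / real N ^ \<alpha>
     = ((- 1) ^ p / fact p * coeff_ratio_A N n m p) * ((- 1) ^ q / fact q * coeff_ratio_B \<alpha> N n m q) * alt_mono x y p q"
    if "p \<le> m + 2" "q \<le> m + 1" for p q
  proof -
    define a b s r where "a = real (n choose (m + 2 - p))" and "b = real (n choose (m + 1 - q))"
      and "s = (- 1 :: real) ^ p" and "r = (- 1 :: real) ^ q"
    have T: "alt_mono (x / real N) (y / real N) p q = real N ^ 3 / (real N ^ p * real N ^ q) * alt_mono x y p q"
      using alt_mono_homogeneous(2)[OF N, of p q x y] N by (simp add: field_simps power_add)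
    \<comment> \<open>The two signs \<open>(- 1) ^ m\<close> cancel, and the odd shift by 1 in the
      second one cancels the minus sign of \<open>gauss_poly\<close>.\<close>
    have sg: "(- 1 :: real) ^ (m + 2 - p) = (- 1) ^ m * s" "(- 1 :: real) ^ (m + 1 - q) = - ((- 1) ^ m * r)"
      unfolding neg[OF that(1)] neg[OF that(2)] s_def r_def by simp_all
    have cA: "coeff (shift_poly n (m + 2)) p = a * ((- 1) ^ m * s) * fact (m + 2) / fact p"
      unfolding coeff_shift_poly sg a_def using that by simp
    have cB: "coeff (shift_poly n (m + 1)) q = - (b * ((- 1) ^ m * r) * (real (m + 1) * fact m) / fact q)"
      unfolding coeff_shift_poly sg b_def using that by simp
    have sq: "(- 1 :: real) ^ m * (- 1) ^ m = 1" by (simp flip: power_add)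
    have "- (coeff (shift_poly n (m + 2)) p * coeff (shift_poly n (m + 1)) q * alt_mono (x / real N) (y / real N) p q)
       / real (m + 1) / (fact n * fact m) / real N ^ 2 / real N ^ \<alpha>
      = ((- 1) ^ m * (- 1) ^ m) * (s / fact p * (fact (m + 2) / fact n * a / real N ^ p)) *
        (r / fact q * (b * real N / (real N ^ \<alpha> * real N ^ q))) * alt_mono x y p q"
      unfolding cA cB T using N
      by (simp add: divide_simps power2_eq_square power3_eq_cube del: of_nat_add of_nat_Suc fact_Suc)
    then show ?thesis
      using that unfolding sq coeff_ratio_A_def coeff_ratio_B_def s_def r_def a_def b_def by (simp add: power_add)
  qed
  have "gauss_poly n m (x / real N) (y / real N) / (fact n * fact m) / real N ^ 2 / real N ^ \<alpha>
    = (\<Sum>p\<le>m + 2. \<Sum>q\<le>m + 1. - (coeff (shift_poly n (m + 2)) p * coeff (shift_poly n (m + 1)) q * alt_mono (x / real N) (y / real N) p q)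
       / real (m + 1) / (fact n * fact m) / real N ^ 2 / real N ^ \<alpha>)"
    unfolding gauss_poly_def sum_divide_distrib[symmetric] sum_negf[symmetric] ..
  also have "\<dots> = (\<Sum>p\<le>m + 2. \<Sum>q\<le>m + 1. ((- 1) ^ p / fact p * coeff_ratio_A N n m p) * ((- 1) ^ q / fact q * coeff_ratio_B \<alpha> N n m q) * alt_mono x y p q)"
    by (intro sum.cong refl t) auto
  also have "\<dots> = (\<Sum>p\<le>m + 2. \<Sum>q. ((- 1) ^ p / fact p * coeff_ratio_A N n m p) * ((- 1) ^ q / fact q * coeff_ratio_B \<alpha> N n m q) * alt_mono x y p q)"
    by (intro sum.cong refl suminf_finite[symmetric]) (auto simp: coeff_ratio_B_def)
  also have "\<dots> = (\<Sum>p. \<Sum>q. ((- 1) ^ p / fact p * coeff_ratio_A N n m p) * ((- 1) ^ q / fact q * coeff_ratio_B \<alpha> N n m q) * alt_mono x y p q)"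
    by (intro suminf_finite[symmetric]) (auto simp: coeff_ratio_A_def)
  finally show ?thesis .
qed

lemma fact_quotient_le_power:
  assumes "p \<le> k"
  shows "fact k / fact (k - p) \<le> real k ^ p"
proof -
  have "fact k / fact (k - p) = real (fact k div fact (k - p))"
    by (simp add: real_of_nat_div fact_dvd)
  also have "\<dots> \<le> real (k ^ p)"
    using fact_div_fact_le_pow[OF assms] of_nat_le_iff by blast
  finally show ?thesis by simp
qed

text \<open>A falling factorial of length \<open>p\<close> behaves like \<open>N ^ p\<close>. The
  shift is split into \<open>e\<close> and \<open>f\<close> because subtraction of naturals
  truncates; this affects only small \<open>N\<close>.\<close>

lemma fact_quotient_tendsto:
  "(\<lambda>N. fact (N - e + f) / fact (N - e + f - p) / real N ^ p) \<longlonglongrightarrow> 1"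
proof (induction p)
  case (Suc p)
  have "(\<lambda>N. (real N + (real f - real e - real p)) / real N) \<longlonglongrightarrow> 1"
    by real_asymp
  from tendsto_mult[OF Suc this]
  have "(\<lambda>N. fact (N - e + f) / fact (N - e + f - p) / real N ^ p * ((real N + (real f - real e - real p)) / real N)) \<longlonglongrightarrow> 1"
    by simp
  then show ?case
  proof (rule Lim_transform_eventually)
    show "\<forall>\<^sub>F N in sequentially. fact (N - e + f) / fact (N - e + f - p) / real N ^ p * ((real N + (real f - real e - real p)) / real N)
       = fact (N - e + f) / fact (N - e + f - Suc p) / real N ^ Suc p"
      using eventually_gt_at_top[of "e + p"]
    proof eventually_elim
      case (elim N)
      obtain r where r: "N - e + f - p = Suc r" "N - e + f - Suc p = r" "real N + (real f - real e - real p) = real (Suc r)"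
      proof
        show "N - e + f - p = Suc (N - e + f - Suc p)" "N - e + f - Suc p = N - e + f - Suc p" using elim by auto
        show "real N + (real f - real e - real p) = real (Suc (N - e + f - Suc p))" using elim by (simp add: of_nat_diff)
      qed
      show ?case unfolding r using elim by (simp add: field_simps del: of_nat_Suc)
    qed
  qed
qed (auto intro!: tendsto_eventually eventually_sequentiallyI)

lemma choose_complement:
  assumes "k \<le> n"
  shows "real (n choose k) = fact n / (fact k * fact (n - k))"
  using binomial_fact[OF assms, where 'a = real] by simp

lemma coeff_ratio_A_bound:
  assumes "N > 0" "m \<le> N"
  shows "\<bar>coeff_ratio_A N n m p\<bar> \<le> 3 ^ p"
proof (cases "p \<le> m + 2 \<and> m + 2 - p \<le> n")
  case True
  then have "coeff_ratio_A N n m p = fact (m + 2) / fact (m + 2 - p) / fact (n - (m + 2 - p)) / real N ^ p"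
    by (simp add: coeff_ratio_A_def choose_complement field_simps del: fact_Suc)
  also have "\<dots> \<le> fact (m + 2) / fact (m + 2 - p) / 1 / real N ^ p"
    using fact_ge_1[of "n - (m + 2 - p)", where 'a = real] by (intro divide_right_mono divide_left_mono) auto
  also have "\<dots> \<le> real (m + 2) ^ p / 1 / real N ^ p"
    using True by (intro divide_right_mono fact_quotient_le_power) auto
  \<comment> \<open>Here \<open>m + 2 \<le> 3 * N\<close>, since \<open>m \<le> N\<close> and
    \<open>1 \<le> N\<close>.\<close>
  also have "\<dots> \<le> (3 * real N) ^ p / 1 / real N ^ p"
    using assms by (intro divide_right_mono power_mono) auto
  also have "\<dots> = 3 ^ p" using assms by (simp add: power_mult_distrib)
  finally show ?thesis by (simp add: coeff_ratio_A_def)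
qed (auto simp: coeff_ratio_A_def binomial_eq_0 not_le)

text \<open>By symmetry the binomial coefficient is \<open>n choose (\<alpha> + q - 1)\<close>,
  hence at most the power of \<open>N\<close> in the denominator. For \<alpha> = q = 0 it is
  \<open>n choose (n + 1)\<close>, which vanishes.\<close>

lemma coeff_ratio_B_bound:
  assumes "N > 0" "n \<le> N" "n = m + \<alpha>"
  shows "\<bar>coeff_ratio_B \<alpha> N n m q\<bar> \<le> 1"
proof (cases "q \<le> m + 1 \<and> 1 \<le> \<alpha> + q")
  case True
  define j where "j = \<alpha> + q - 1"
  have j: "\<alpha> + q = Suc j" "m + 1 - q = n - j" "j \<le> n" using True assms(3) by (auto simp: j_def)
  have "real (n choose (m + 1 - q)) \<le> real N ^ j"
  proof -
    have "n choose (n - j) = n choose j" using j(3) by (rule binomial_symmetric[symmetric])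
    also have "\<dots> \<le> n ^ j" by (rule binomial_le_pow[OF j(3)])
    also have "\<dots> \<le> N ^ j" by (rule power_mono) (use assms in auto)
    finally show ?thesis unfolding j(2) of_nat_power[symmetric] of_nat_le_iff .
  qed
  moreover have "coeff_ratio_B \<alpha> N n m q = real (n choose (m + 1 - q)) / real N ^ j"
    using True assms(1) unfolding coeff_ratio_B_def j(1) by simp
  ultimately show ?thesis using assms(1) by (simp add: divide_le_eq)
qed (use assms in \<open>auto simp: coeff_ratio_B_def binomial_eq_0\<close>)

text \<open>For \<open>\<alpha> + p < 2\<close> the lower binomial index eventually exceeds
  \<open>N - t\<close>, so the terms vanish as the convention in \<open>bessel_coeff\<close>
  demands.\<close>

lemma coeff_ratio_A_tendsto:
  "(\<lambda>N. (- 1) ^ p / fact p * coeff_ratio_A N (N - t) (N - \<alpha> - t) p) \<longlonglongrightarrow> bessel_coeff \<alpha> 2 p"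
proof (cases "2 \<le> \<alpha> + p")
  case True
  have "(\<lambda>N. (- 1) ^ p / (fact p * fact (\<alpha> + p - 2)) * (fact (N - (\<alpha> + t) + 2) / fact (N - (\<alpha> + t) + 2 - p) / real N ^ p))
     \<longlonglongrightarrow> (- 1) ^ p / (fact p * fact (\<alpha> + p - 2)) * 1"
    by (intro tendsto_mult tendsto_const fact_quotient_tendsto)
  moreover have "\<forall>\<^sub>F N in sequentially. (- 1) ^ p / (fact p * fact (\<alpha> + p - 2)) * (fact (N - (\<alpha> + t) + 2) / fact (N - (\<alpha> + t) + 2 - p) / real N ^ p)
     = (- 1) ^ p / fact p * coeff_ratio_A N (N - t) (N - \<alpha> - t) p"
    using eventually_gt_at_top[of "\<alpha> + t + p"]
  proof eventually_elim
    case (elim N)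
    have e: "N - \<alpha> - t + 2 - p \<le> N - t" "N - t - (N - \<alpha> - t + 2 - p) = \<alpha> + p - 2" "p \<le> N - \<alpha> - t + 2"
      "N - (\<alpha> + t) = N - \<alpha> - t"
      using elim True by auto
    show ?case unfolding coeff_ratio_A_def choose_complement[OF e(1)] e(2,4) using e(3) by simp
  qed
  ultimately show ?thesis using True by (simp add: Lim_transform_eventually bessel_coeff_def)
next
  case False
  have "\<forall>\<^sub>F N in sequentially. 0 = (- 1) ^ p / fact p * coeff_ratio_A N (N - t) (N - \<alpha> - t) p"
    using eventually_gt_at_top[of "\<alpha> + t + p"]
  proof eventually_elim
    case (elim N)
    then have "N - t < N - \<alpha> - t + 2 - p" using False by auto
    then show ?case by (simp add: coeff_ratio_A_def binomial_eq_0)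
  qed
  from Lim_transform_eventually[OF tendsto_const this] show ?thesis using False by (simp add: bessel_coeff_def)
qed

lemma coeff_ratio_B_tendsto:
  "(\<lambda>N. (- 1) ^ q / fact q * coeff_ratio_B \<alpha> N (N - t) (N - \<alpha> - t) q) \<longlonglongrightarrow> bessel_coeff \<alpha> 1 q"
proof (cases "1 \<le> \<alpha> + q")
  case True
  define j where "j = \<alpha> + q - 1"
  have j: "\<alpha> + q = Suc j" using True by (simp add: j_def)
  have "(\<lambda>N. (- 1) ^ q / (fact q * fact j) * (fact (N - t + 0) / fact (N - t + 0 - j) / real N ^ j))
     \<longlonglongrightarrow> (- 1) ^ q / (fact q * fact j) * 1"
    by (intro tendsto_mult tendsto_const fact_quotient_tendsto)
  moreover have "\<forall>\<^sub>F N in sequentially. (- 1) ^ q / (fact q * fact j) * (fact (N - t + 0) / fact (N - t + 0 - j) / real N ^ j)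
     = (- 1) ^ q / fact q * coeff_ratio_B \<alpha> N (N - t) (N - \<alpha> - t) q"
    using eventually_gt_at_top[of "\<alpha> + t + q"]
  proof eventually_elim
    case (elim N)
    have e: "N - \<alpha> - t + 1 - q = N - t - j" "N - t - j \<le> N - t" "N - t - (N - t - j) = j" "q \<le> N - \<alpha> - t + 1"
      using elim j by auto
    show ?case unfolding coeff_ratio_B_def j e(1) choose_complement[OF e(2)] e(3) using e(4) elim by simp
  qed
  ultimately show ?thesis using True by (simp add: Lim_transform_eventually bessel_coeff_def j_def)
next
  case False
  have "\<forall>\<^sub>F N in sequentially. 0 = (- 1) ^ q / fact q * coeff_ratio_B \<alpha> N (N - t) (N - \<alpha> - t) q"
    using eventually_gt_at_top[of "\<alpha> + t + q"]
  proof eventually_elim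
    case (elim N)
    then have "N - t < N - \<alpha> - t + 1 - q" using False by auto
    then show ?case by (simp add: coeff_ratio_B_def binomial_eq_0)
  qed
  from Lim_transform_eventually[OF tendsto_const this] show ?thesis using False by (simp add: bessel_coeff_def)
qed

lemma corr_coeff_scaled:
  assumes "t \<le> m" "m \<le> n"
  shows "corr_coeff c n m t / (fact n * fact m) = c ^ t / fact t / (fact (n - t) * fact (m - t))"
proof -
  have t: "t \<le> n" using assms by simp
  show ?thesis unfolding corr_coeff_def choose_complement[OF assms(1)] choose_complement[OF t]
    by (simp add: field_simps)
qed

text \<open>For \<open>t > N - \<alpha>\<close> truncated subtraction would break the relation
  between the numbers of rows and columns; \<open>corr_coeff\<close> vanishes there, and the guard
  records this inside the series.\<close>

lemma corr_poly_scaled: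
  assumes "N > 0" "\<alpha> \<le> N"
  shows "corr_poly c N (N - \<alpha>) (x / real N) (y / real N) / (fact N * fact (N - \<alpha>)) / real N ^ 2 / real N ^ \<alpha>
    = (\<Sum>t. c ^ t / fact t * (\<Sum>p. \<Sum>q. if t \<le> N - \<alpha> then
        ((- 1) ^ p / fact p * coeff_ratio_A N (N - t) (N - \<alpha> - t) p) *
        ((- 1) ^ q / fact q * coeff_ratio_B \<alpha> N (N - t) (N - \<alpha> - t) q) * alt_mono x y p q else 0))"
proof -
  let ?g = "\<lambda>t. gauss_poly (N - t) (N - \<alpha> - t) (x / real N) (y / real N)"
  have "corr_poly c N (N - \<alpha>) (x / real N) (y / real N) / (fact N * fact (N - \<alpha>)) / real N ^ 2 / real N ^ \<alpha>
     = (\<Sum>t\<le>N. corr_coeff c N (N - \<alpha>) t / (fact N * fact (N - \<alpha>)) * ?g t / real N ^ 2 / real N ^ \<alpha>)"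
    unfolding corr_poly_def by (simp add: sum_divide_distrib)
  also have "\<dots> = (\<Sum>t\<le>N. c ^ t / fact t * (\<Sum>p. \<Sum>q. if t \<le> N - \<alpha> then
        ((- 1) ^ p / fact p * coeff_ratio_A N (N - t) (N - \<alpha> - t) p) *
        ((- 1) ^ q / fact q * coeff_ratio_B \<alpha> N (N - t) (N - \<alpha> - t) q) * alt_mono x y p q else 0))"
  proof (rule sum.cong[OF refl])
    fix t
    show "corr_coeff c N (N - \<alpha>) t / (fact N * fact (N - \<alpha>)) * ?g t / real N ^ 2 / real N ^ \<alpha>
      = c ^ t / fact t * (\<Sum>p. \<Sum>q. if t \<le> N - \<alpha> then
        ((- 1) ^ p / fact p * coeff_ratio_A N (N - t) (N - \<alpha> - t) p) *
        ((- 1) ^ q / fact q * coeff_ratio_B \<alpha> N (N - t) (N - \<alpha> - t) q) * alt_mono x y p q else 0)"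
    proof (cases "t \<le> N - \<alpha>")
      case True
      show ?thesis
        unfolding corr_coeff_scaled[OF True diff_le_self]
        using True gauss_poly_scaled[OF assms(1), of "N - t" "N - \<alpha> - t" x y \<alpha>, symmetric] by simp
    qed (simp add: corr_coeff_def binomial_eq_0)
  qed
  also have "\<dots> = (\<Sum>t. c ^ t / fact t * (\<Sum>p. \<Sum>q. if t \<le> N - \<alpha> then
        ((- 1) ^ p / fact p * coeff_ratio_A N (N - t) (N - \<alpha> - t) p) *
        ((- 1) ^ q / fact q * coeff_ratio_B \<alpha> N (N - t) (N - \<alpha> - t) q) * alt_mono x y p q else 0))"
  proof (rule suminf_finite[symmetric])
    fix t assume "t \<notin> {..N}"
    then have "\<not> t \<le> N - \<alpha>" by simp
    then show "c ^ t / fact t * (\<Sum>p. \<Sum>q. if t \<le> N - \<alpha> then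
        ((- 1) ^ p / fact p * coeff_ratio_A N (N - t) (N - \<alpha> - t) p) *
        ((- 1) ^ q / fact q * coeff_ratio_B \<alpha> N (N - t) (N - \<alpha> - t) q) * alt_mono x y p q else 0) = 0"
      by (simp only: if_False suminf_zero mult_zero_right)
  qed simp
  finally show ?thesis .
qed

text \<open>Dominated convergence, in \<open>p\<close> and \<open>q\<close> for fixed
  \<open>t\<close> and then in \<open>t\<close>. Every \<open>t\<close> yields the same limit, so
  the weights \<open>c ^ t / fact t\<close> sum to the exponential.\<close>

lemma corr_poly_tendsto:
  "(\<lambda>N. corr_poly c N (N - \<alpha>) (x / real N) (y / real N) / (fact N * fact (N - \<alpha>)) / real N ^ 2 / real N ^ \<alpha>)
     \<longlonglongrightarrow> exp c * kernel_series \<alpha> x y"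
proof -
  define R where "R = max 1 (max \<bar>x\<bar> \<bar>y\<bar>)"
  have R: "\<bar>x\<bar> \<le> R" "\<bar>y\<bar> \<le> R" "1 \<le> R" by (auto simp: R_def)
  define a where "a t p q N = (if t \<le> N - \<alpha> then
        ((- 1) ^ p / fact p * coeff_ratio_A N (N - t) (N - \<alpha> - t) p) *
        ((- 1) ^ q / fact q * coeff_ratio_B \<alpha> N (N - t) (N - \<alpha> - t) q) * alt_mono x y p q else 0)" for t p q N
  \<comment> \<open>The base 12 is 3 from the bound on \<open>coeff_ratio_A\<close> times 4 from the
    bound on \<open>alt_mono\<close>.\<close>
  define v where "v p = (12 * R) ^ p / fact p" for p
  define z where "z q = (4 * R) ^ q / fact q" for q
  have sv: "summable v" "summable z" unfolding v_def z_def by (rule summable_power_over_fact)+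
  have bound: "\<bar>a t p q N\<bar> \<le> v p * z q" if N: "N > 0" "\<alpha> \<le> N" for t p q N
  proof (cases "t \<le> N - \<alpha>")
    case True
    have "\<bar>a t p q N\<bar> = (1 / fact p * \<bar>coeff_ratio_A N (N - t) (N - \<alpha> - t) p\<bar>) *
        (1 / fact q * \<bar>coeff_ratio_B \<alpha> N (N - t) (N - \<alpha> - t) q\<bar>) * \<bar>alt_mono x y p q\<bar>"
      using True by (simp add: a_def abs_mult power_abs)
    also have "\<dots> \<le> (1 / fact p * 3 ^ p) * (1 / fact q * 1) * (4 * R) ^ (p + q)"
      using R N True
      by (intro mult_mono mult_nonneg_nonneg alt_mono_bounds order_refl coeff_ratio_A_bound coeff_ratio_B_bound) auto
    also have "\<dots> = v p * z q"
      by (simp add: v_def z_def power_add power_mult_distrib flip: power_mult_distrib[of 3 4])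
    finally show ?thesis .
  next
    case False
    then show ?thesis using R by (simp add: a_def v_def z_def)
  qed
  have lim: "(\<lambda>N. a t p q N) \<longlonglongrightarrow> bessel_coeff \<alpha> 2 p * bessel_coeff \<alpha> 1 q * alt_mono x y p q" for t p q
  proof (rule Lim_transform_eventually)
    show "(\<lambda>N. ((- 1) ^ p / fact p * coeff_ratio_A N (N - t) (N - \<alpha> - t) p) *
        ((- 1) ^ q / fact q * coeff_ratio_B \<alpha> N (N - t) (N - \<alpha> - t) q) * alt_mono x y p q)
       \<longlonglongrightarrow> bessel_coeff \<alpha> 2 p * bessel_coeff \<alpha> 1 q * alt_mono x y p q"
      by (intro tendsto_mult tendsto_const coeff_ratio_A_tendsto coeff_ratio_B_tendsto)
    show "\<forall>\<^sub>F N in sequentially. ((- 1) ^ p / fact p * coeff_ratio_A N (N - t) (N - \<alpha> - t) p) *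
        ((- 1) ^ q / fact q * coeff_ratio_B \<alpha> N (N - t) (N - \<alpha> - t) q) * alt_mono x y p q = a t p q N"
      using eventually_ge_at_top[of "t + \<alpha>"] by eventually_elim (auto simp: a_def)
  qed
  have large: "\<forall>\<^sub>F N in sequentially. N > 0 \<and> \<alpha> \<le> N"
    using eventually_gt_at_top[of 0] eventually_ge_at_top[of \<alpha>] by eventually_elim simp
  have inner: "(\<lambda>N. \<Sum>p. \<Sum>q. a t p q N) \<longlonglongrightarrow> kernel_series \<alpha> x y" for t
    unfolding kernel_series_def
    by (rule tendsto_double_suminf_dominated[OF lim _ sv]) (use large bound in \<open>auto elim!: eventually_mono\<close>)
  have outer: "(\<lambda>N. \<Sum>t. c ^ t / fact t * (\<Sum>p. \<Sum>q. a t p q N)) \<longlonglongrightarrow> (\<Sum>t. c ^ t / fact t * kernel_series \<alpha> x y)"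
  proof (rule tendsto_suminf_dominated[where M = "\<lambda>t. \<bar>c\<bar> ^ t / fact t * ((\<Sum>p. v p) * (\<Sum>q. z q))"])
    show "\<forall>\<^sub>F N in sequentially. \<forall>t. \<bar>c ^ t / fact t * (\<Sum>p. \<Sum>q. a t p q N)\<bar> \<le> \<bar>c\<bar> ^ t / fact t * ((\<Sum>p. v p) * (\<Sum>q. z q))"
      using large
    proof eventually_elim
      case (elim N)
      show ?case
      proof
        fix t
        have "\<bar>\<Sum>p. \<Sum>q. a t p q N\<bar> \<le> (\<Sum>p. v p) * (\<Sum>q. z q)"
          by (rule abs_double_suminf_le[OF bound sv]) (use elim in auto)
        then have "\<bar>c ^ t / fact t\<bar> * \<bar>\<Sum>p. \<Sum>q. a t p q N\<bar> \<le> \<bar>c ^ t / fact t\<bar> * ((\<Sum>p. v p) * (\<Sum>q. z q))"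
          by (rule mult_left_mono) simp
        then show "\<bar>c ^ t / fact t * (\<Sum>p. \<Sum>q. a t p q N)\<bar> \<le> \<bar>c\<bar> ^ t / fact t * ((\<Sum>p. v p) * (\<Sum>q. z q))"
          by (simp only: abs_mult abs_divide power_abs abs_of_pos fact_gt_zero)
      qed
    qed
    show "summable (\<lambda>t. \<bar>c\<bar> ^ t / fact t * ((\<Sum>p. v p) * (\<Sum>q. z q)))"
      by (rule summable_mult2) (rule summable_power_over_fact)
  qed (auto intro!: tendsto_intros inner)
  have "(\<Sum>t. c ^ t / fact t * kernel_series \<alpha> x y) = exp c * kernel_series \<alpha> x y"
    using suminf_mult2[OF summable_power_over_fact[of c], of "kernel_series \<alpha> x y"]
    by (simp add: exp_def divide_inverse mult.commute)
  with outer have "(\<lambda>N. \<Sum>t. c ^ t / fact t * (\<Sum>p. \<Sum>q. a t p q N)) \<longlonglongrightarrow> exp c * kernel_series \<alpha> x y" by simp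
  then show ?thesis
    by (rule Lim_transform_eventually)
       (use large in eventually_elim, simp only: corr_poly_scaled a_def)
qed

section \<open>From random matrices to arrays of entries, and the limit theorem\<close>

lemma char_det_eq_char_minor:
  assumes "A \<in> carrier_mat n m"
  shows "char_det A (complex_of_real z) = complex_of_real (char_minor {..<m} n (\<lambda>p. A $$ p) z)"
proof -
  have dim: "dim_row A = n" "dim_col A = m" using assms by auto
  have gram: "sample_cov A $$ (i, j) = gram (\<lambda>p. A $$ p) n i j" if "i < m" "j < m" for i j
    using that dim by (simp add: sample_cov_def gram_def scalar_prod_def atLeast0LessThan)
  have sd: "dim_row (sample_cov A) = m" "dim_col (sample_cov A) = m"
    using dim by (simp_all add: sample_cov_def)
  let ?C = "map_mat complex_of_real (sample_cov A) - complex_of_real z \<cdot>\<^sub>m 1\<^sub>m (dim_col A)"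
  have C: "?C $$ (i, j) = complex_of_real (gram (\<lambda>p. A $$ p) n i j - z * of_bool (i = j))" if "i < m" "j < m" for i j
    using that sd dim by (simp add: gram)
  have "char_det A (complex_of_real z) = (\<Sum>\<pi> | \<pi> permutes {..<m}. of_int (sign \<pi>) * (\<Prod>i<m. ?C $$ (i, \<pi> i)))"
    unfolding char_det_def Determinant.det_def using sd dim by (simp add: atLeast0LessThan)
  also have "\<dots> = (\<Sum>\<pi> | \<pi> permutes {..<m}. of_int (sign \<pi>) *
      (\<Prod>i<m. complex_of_real (gram (\<lambda>p. A $$ p) n i (\<pi> i) - z * of_bool (i = \<pi> i))))"
  proof (intro sum.cong refl arg_cong2[where f = times] prod.cong)
    fix \<pi> i assume "\<pi> \<in> {\<pi>. \<pi> permutes {..<m}}" "i \<in> {..<m}"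
    then have "i < m" "\<pi> i < m" using permutes_in_image[of \<pi> "{..<m}" i] by auto
    then show "?C $$ (i, \<pi> i) = complex_of_real (gram (\<lambda>p. A $$ p) n i (\<pi> i) - z * of_bool (i = \<pi> i))"
      by (rule C)
  qed
  also have "\<dots> = complex_of_real (char_minor {..<m} n (\<lambda>p. A $$ p) z)"
    unfolding char_minor_def set_det_def by simp
  finally show ?thesis .
qed

lemma iid_array_of_random_matrix:
  assumes Q: "real_distribution Q" "integrable Q (\<lambda>x. x ^ 4)" "prob_space.expectation Q (\<lambda>x. x) = 0"
    "prob_space.variance Q (\<lambda>x. x) = 1" "b = prob_space.expectation Q (\<lambda>x. x ^ 4)"
    and X: "iid_random_matrix M Q n m X"
  shows "iid_array M (\<lambda>p \<omega>. X \<omega> $$ p) n m b"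
proof -
  interpret prob_space M using X by (simp add: iid_random_matrix_def)
  have indep: "indep_vars (\<lambda>_. borel) (\<lambda>p \<omega>. X \<omega> $$ p) ({..<n} \<times> {..<m})"
    using X by (simp add: iid_random_matrix_def)
  have meas: "(\<lambda>\<omega>. X \<omega> $$ p) \<in> borel_measurable M" if "p \<in> {..<n} \<times> {..<m}" for p
    using indep that unfolding indep_vars_def by auto
  have distr: "distr M borel (\<lambda>\<omega>. X \<omega> $$ p) = Q" if "p \<in> {..<n} \<times> {..<m}" for p
    using X that by (auto simp: iid_random_matrix_def)
  have E: "expectation (\<lambda>\<omega>. f (X \<omega> $$ p)) = integral\<^sup>L Q f"
    if "p \<in> {..<n} \<times> {..<m}" "f \<in> borel_measurable borel" for p and f :: "real \<Rightarrow> real"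
    using integral_distr[OF meas[OF that(1)] that(2)] distr[OF that(1)] by simp
  show ?thesis
  proof
    show "indep_vars (\<lambda>_. borel) (\<lambda>p \<omega>. X \<omega> $$ p) ({..<n} \<times> {..<m})" by (rule indep)
    fix p assume p: "p \<in> {..<n} \<times> {..<m}"
    show "integrable M (\<lambda>\<omega>. (X \<omega> $$ p) ^ 4)"
      using integrable_distr_eq[OF meas[OF p], of "\<lambda>x. x ^ 4"] Q(2) distr[OF p] by simp
    show "expectation (\<lambda>\<omega>. X \<omega> $$ p) = 0" using E[OF p, of "\<lambda>x. x"] Q(3) by simp
    \<comment> \<open>As the mean is zero, the variance is the second moment.\<close>
    show "expectation (\<lambda>\<omega>. (X \<omega> $$ p)\<^sup>2) = 1" using E[OF p, of "\<lambda>x. x\<^sup>2"] Q(3,4) by simp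
    show "expectation (\<lambda>\<omega>. (X \<omega> $$ p) ^ 4) = b" using E[OF p, of "\<lambda>x. x ^ 4"] Q(5) by simp
  qed
qed

lemma corr_fun_eq_corr_poly:
  assumes "iid_random_matrix (M n m) Q n m (X n m)" "iid_array (M n m) (\<lambda>p \<omega>. X n m \<omega> $$ p) n m b"
  shows "corr_fun M X n m (complex_of_real x) (complex_of_real y) = complex_of_real (corr_poly (b - 3) n m x y)"
proof -
  interpret iid_array "M n m" "\<lambda>p \<omega>. X n m \<omega> $$ p" n m b by fact
  have "corr_fun M X n m (complex_of_real x) (complex_of_real y)
     = (\<integral>\<omega>. complex_of_real (minor {..<m} n x \<omega> * minor {..<m} n y \<omega>) \<partial>M n m)"
    unfolding corr_fun_def
    by (rule Bochner_Integration.integral_cong)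
       (use assms(1) in \<open>auto simp: iid_random_matrix_def char_det_eq_char_minor\<close>)
  also have "\<dots> = complex_of_real (minor_corr n {..<m} {..<m} x y)"
    unfolding minor_corr_def by (rule integral_complex_of_real)
  finally show ?thesis by (simp add: minor_corr_eq_corr_poly)
qed

theorem theorem6p3:
  fixes Q :: "real measure" and b bstar :: real
    and M :: "nat \<Rightarrow> nat \<Rightarrow> 'a measure"
    and X :: "nat \<Rightarrow> nat \<Rightarrow> 'a \<Rightarrow> real mat"
    and \<alpha> :: nat and \<mu> \<nu> :: real
  assumes "real_distribution Q"
    and "integrable Q (\<lambda>x. x ^ 4)"
    and "prob_space.expectation Q (\<lambda>x. x) = 0"
    and "prob_space.variance Q (\<lambda>x. x) = 1"
    and "b = prob_space.expectation Q (\<lambda>x. x ^ 4)"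
    and "bstar = b - 3"
    and "\<And>n m. m \<le> n \<Longrightarrow> iid_random_matrix (M n m) Q n m (X n m)"
    and "\<mu> > 0" and "\<nu> > 0"
  shows "(\<lambda>N. let n = N; m = N - \<alpha> in
            complex_of_real (1 / 16 * (1 / real N ^ 2) * Z_factor \<alpha> N (\<mu> / 4) (\<nu> / 4))
            * (corr_fun M X n m (complex_of_real (\<mu> / (4 * real N)))
                                (complex_of_real (\<nu> / (4 * real N)))
               / (fact n * fact m)))
         \<longlonglongrightarrow> complex_of_real (exp bstar * diff_bessel_kernel \<alpha> \<mu> \<nu>)"
proof -
  define x y where "x = \<mu> / 4" and "y = \<nu> / 4"
  define \<kappa> where "\<kappa> = (x * y) powr (real \<alpha> / 2)"
  have xy: "x > 0" "y > 0" using assms(8,9) by (auto simp: x_def y_def)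
  let ?P = "\<lambda>N. corr_poly bstar N (N - \<alpha>) (x / real N) (y / real N) / (fact N * fact (N - \<alpha>)) / real N ^ 2 / real N ^ \<alpha>"
  have "(\<lambda>N. complex_of_real (\<kappa> / 16 * ?P N)) \<longlonglongrightarrow> complex_of_real (\<kappa> / 16 * (exp bstar * kernel_series \<alpha> x y))"
    by (intro tendsto_of_real tendsto_mult tendsto_const corr_poly_tendsto)
  also have "\<kappa> / 16 * (exp bstar * kernel_series \<alpha> x y) = exp bstar * diff_bessel_kernel \<alpha> \<mu> \<nu>"
    using diff_bessel_kernel_eq[OF assms(8,9), of \<alpha>] by (simp add: \<kappa>_def x_def y_def)
  finally have "(\<lambda>N. complex_of_real (\<kappa> / 16 * ?P N)) \<longlonglongrightarrow> complex_of_real (exp bstar * diff_bessel_kernel \<alpha> \<mu> \<nu>)" .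
  then show ?thesis
  proof (rule Lim_transform_eventually)
    show "\<forall>\<^sub>F N in sequentially. complex_of_real (\<kappa> / 16 * ?P N) = (let n = N; m = N - \<alpha> in
            complex_of_real (1 / 16 * (1 / real N ^ 2) * Z_factor \<alpha> N (\<mu> / 4) (\<nu> / 4))
            * (corr_fun M X n m (complex_of_real (\<mu> / (4 * real N)))
                                (complex_of_real (\<nu> / (4 * real N)))
               / (fact n * fact m)))"
      using eventually_gt_at_top[of 0]
    proof eventually_elim
      case (elim N)
      have X: "iid_random_matrix (M N (N - \<alpha>)) Q N (N - \<alpha>) (X N (N - \<alpha>))" by (rule assms(7)) simp
      have s: "\<mu> / (4 * real N) = x / real N" "\<nu> / (4 * real N) = y / real N" by (simp_all add: x_def y_def)
      have c: "corr_fun M X N (N - \<alpha>) (complex_of_real (x / real N)) (complex_of_real (y / real N))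
         = complex_of_real (corr_poly bstar N (N - \<alpha>) (x / real N) (y / real N))"
        unfolding assms(6)
        by (rule corr_fun_eq_corr_poly[where M = M and X = X, OF X iid_array_of_random_matrix[OF assms(1-5) X]])
      \<comment> \<open>The power of \<open>N\<close> in the normalising factor is exactly the
        \<open>N ^ \<alpha>\<close> divided out in \<open>?P\<close>.\<close>
      have Z: "Z_factor \<alpha> N (\<mu> / 4) (\<nu> / 4) = \<kappa> / real N ^ \<alpha>"
      proof -
        have "Z_factor \<alpha> N (\<mu> / 4) (\<nu> / 4) = \<kappa> / ((real N ^ 2) powr (real \<alpha> / 2))"
          unfolding Z_factor_def \<kappa>_def x_def[symmetric] y_def[symmetric] using xy elim by (subst powr_divide) auto
        also have "(real N ^ 2) powr (real \<alpha> / 2) = real N ^ \<alpha>"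
        proof -
          have "(real N ^ 2) powr (real \<alpha> / 2) = (real N powr 2) powr (real \<alpha> / 2)"
            using elim by simp
          also have "\<dots> = real N powr real \<alpha>" unfolding powr_powr by simp
          also have "\<dots> = real N ^ \<alpha>" using elim by (simp add: powr_realpow)
          finally show ?thesis .
        qed
        finally show ?thesis .
      qed
      show ?case unfolding Let_def s c Z by simp
    qed
  qed
qed

end
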